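(* Let $V$ be the solution of the convertible bond problem (P) described in the context, under the standing assumptions stated there. Then there is $t^*\in(-\infty,T)$ such that the free boundary $\Gamma=\partial\{V>\gamma x\}\cap D_T$ hits the fixed boundary only at $(K/\gamma,t^* )$ and at no other fixed boundary point; that is, the closure of $\Gamma$ meets the fixed boundary exactly in the point $(K/\gamma,t^* )$.
   Context: Constants: $K>0$ (call price and face value), $\gamma>0$ (conversion factor), $T>0$ (maturity), $\sigma>0$ (volatility), $r>0$ (interest rate), $q>0$ (dividend rate), $c\ge 0$ (coupon rate). Put $D_T=(0,K/\gamma)\times(0,T)$ and $$\mathcal{L}=-\partial_t-\tfrac12\sigma^2x^2\partial_{xx}-(r-q)x\,\partial_x+r.$$ Problem (P): find $V$ with $\gamma x\le V\le K$ in $D_T$ such that $$\mathcal{L}V=c\ \text{ in } D_T\cap\{\gamma x<V<K\},\qquad \mathcal{L}V\ge c\ \text{ in } D_T,$$ $$V(K/\gamma,t)=K\ \ (0\le t\le T),\qquad V(x,T)=K\ \ (0\le x\le K/\gamma).$$ A solution $V$ belongs to $W^{2,p}_{x,\mathrm{loc}}\cap W^{1,p}_{t,\mathrm{loc}}(D_T)$ for $1<p<\infty$ (i.e. $V,V_x,V_{xx},V_t\in L^p_{\mathrm{loc}}(D_T)$), the (in)equalities hold almost everywhere, and the boundary values are attained continuously. In particular there is a smooth fit along the free boundary. No boundary value is prescribed on $\{x=0\}$. Standing assumptions: $c<rK$ and $c<qK$. Only solutions with $\lim_{x\to0}x^2V_{xx}(x,t)=\lim_{x\to0}xV_x(x,t)=0$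 are considered (in this class the solution is unique). The conversion (exercise) region $\Lambda=\{(x,t)\in D_T: V(x,t)=\gamma x\}$ is nonempty. The fixed boundary consists of the two lateral sides $\{x=0\}$ and $\{x=K/\gamma\}$ and the terminal side $\{t=T\}$ of $D_T$. The bottom $\{t=0\}$ is not part of it: no data are given there, as the problem runs backward from $t=T$. *)

theory Defs
  imports "HOL-Analysis.Analysis"
begin

section \<open>Weak derivatives and local Lebesgue spaces\<close>

primrec Ck_fun :: "nat \<Rightarrow> ('a::euclidean_space \<Rightarrow> real) \<Rightarrow> bool" where
  "Ck_fun 0 f \<longleftrightarrow> continuous_on UNIV f"
| "Ck_fun (Suc n) f \<longleftrightarrow> f differentiable_on UNIV \<and>
     (\<forall>b\<in>Basis. Ck_fun n (\<lambda>z. frechet_derivative f (at z) b))"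

definition test_function :: "'a::euclidean_space set \<Rightarrow> ('a \<Rightarrow> real) \<Rightarrow> bool" where
  "test_function D \<phi> \<longleftrightarrow> (\<forall>n. Ck_fun n \<phi>) \<and>
     (\<exists>S. compact S \<and> S \<subseteq> D \<and> (\<forall>z. z \<notin> S \<longrightarrow> \<phi> z = 0))"

definition locally_Lp :: "'a::euclidean_space set \<Rightarrow> real \<Rightarrow> ('a \<Rightarrow> real) \<Rightarrow> bool" where
  "locally_Lp D p f \<longleftrightarrow> f \<in> borel_measurable (lebesgue_on D) \<and>
     (\<forall>S. compact S \<and> S \<subseteq> D \<longrightarrow> set_integrable lebesgue S (\<lambda>z. \<bar>f z\<bar> powr p))"

text \<open>The function \<open>g\<close> is the weak derivative of \<open>u\<close> on the open set \<open>D\<close> in the direction \<open>e\<close>;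
  it is determined by \<open>u\<close> only up to a null set.\<close>

definition has_weak_partial ::
  "'a::euclidean_space set \<Rightarrow> 'a \<Rightarrow> ('a \<Rightarrow> real) \<Rightarrow> ('a \<Rightarrow> real) \<Rightarrow> bool" where
  "has_weak_partial D e u g \<longleftrightarrow> locally_Lp D 1 u \<and> locally_Lp D 1 g \<and>
     (\<forall>\<phi>. test_function D \<phi> \<longrightarrow>
        (LINT z:D|lebesgue. u z * frechet_derivative \<phi> (at z) e)
          = - (LINT z:D|lebesgue. g z * \<phi> z))"


section \<open>The convertible bond problem\<close>

text \<open>Points are pairs \<open>(x, t)\<close> of stock price and time. The functions \<open>Vx\<close>, \<open>Vxx\<close>, \<open>Vt\<close> below
  stand for representatives of the weak derivatives of \<open>V\<close>.\<close>

definition cb_domain :: "real \<Rightarrow> real \<Rightarrow> real \<Rightarrow> (real \<times> real) set" where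
  "cb_domain K \<gamma> T = {0<..<K/\<gamma>} \<times> {0<..<T}"

definition cb_fixed_boundary :: "real \<Rightarrow> real \<Rightarrow> real \<Rightarrow> (real \<times> real) set" where
  "cb_fixed_boundary K \<gamma> T =
     {0} \<times> {0..T} \<union> {K/\<gamma>} \<times> {0..T} \<union> {0..K/\<gamma>} \<times> {T}"

text \<open>The part of the fixed boundary on which data are prescribed; \<open>{x = 0}\<close> only contributes
  its terminal corner.\<close>

definition cb_data_boundary :: "real \<Rightarrow> real \<Rightarrow> real \<Rightarrow> (real \<times> real) set" where
  "cb_data_boundary K \<gamma> T = {K/\<gamma>} \<times> {0..T} \<union> {0..K/\<gamma>} \<times> {T}"

definition cb_operator ::
  "real \<Rightarrow> real \<Rightarrow> real \<Rightarrow> (real \<times> real \<Rightarrow> real) \<Rightarrow> (real \<times> real \<Rightarrow> real)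
     \<Rightarrow> (real \<times> real \<Rightarrow> real) \<Rightarrow> (real \<times> real \<Rightarrow> real) \<Rightarrow> real \<times> real \<Rightarrow> real" where
  "cb_operator \<sigma> r q V Vx Vxx Vt z =
     - Vt z - 1/2 * \<sigma>\<^sup>2 * (fst z)\<^sup>2 * Vxx z - (r - q) * fst z * Vx z + r * V z"

definition cb_regular ::
  "(real \<times> real) set \<Rightarrow> (real \<times> real \<Rightarrow> real) \<Rightarrow> (real \<times> real \<Rightarrow> real)
     \<Rightarrow> (real \<times> real \<Rightarrow> real) \<Rightarrow> (real \<times> real \<Rightarrow> real) \<Rightarrow> bool" where
  "cb_regular D V Vx Vxx Vt \<longleftrightarrow>
     has_weak_partial D (1, 0) V Vx \<and>
     has_weak_partial D (1, 0) Vx Vxx \<and>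
     has_weak_partial D (0, 1) V Vt \<and>
     (\<forall>p>1. locally_Lp D p V \<and> locally_Lp D p Vx \<and> locally_Lp D p Vxx \<and> locally_Lp D p Vt)"

text \<open>By Sobolev embedding the regularity class consists of (classes of) continuous functions;
  \<open>V\<close> is the continuous representative, so that the sets \<open>{V = \<gamma>x}\<close> and \<open>{V > \<gamma>x}\<close> make sense
  pointwise. Continuity up to the data boundary expresses that the boundary values are attained
  continuously.\<close>

definition cb_solution ::
  "real \<Rightarrow> real \<Rightarrow> real \<Rightarrow> real \<Rightarrow> real \<Rightarrow> real \<Rightarrow> real \<Rightarrow> (real \<times> real \<Rightarrow> real)
     \<Rightarrow> (real \<times> real \<Rightarrow> real) \<Rightarrow> (real \<times> real \<Rightarrow> real) \<Rightarrow> (real \<times> real \<Rightarrow> real) \<Rightarrow> bool" where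
  "cb_solution K \<gamma> T \<sigma> r q c V Vx Vxx Vt \<longleftrightarrow>
     cb_regular (cb_domain K \<gamma> T) V Vx Vxx Vt \<and>
     continuous_on (cb_domain K \<gamma> T \<union> cb_data_boundary K \<gamma> T) V \<and>
     (\<forall>z\<in>cb_domain K \<gamma> T. \<gamma> * fst z \<le> V z \<and> V z \<le> K) \<and>
     (AE z in lebesgue. z \<in> cb_domain K \<gamma> T \<longrightarrow> \<gamma> * fst z < V z \<longrightarrow> V z < K \<longrightarrow>
        cb_operator \<sigma> r q V Vx Vxx Vt z = c) \<and>
     (AE z in lebesgue. z \<in> cb_domain K \<gamma> T \<longrightarrow> cb_operator \<sigma> r q V Vx Vxx Vt z \<ge> c) \<and>
     (\<forall>t\<in>{0..T}. V (K/\<gamma>, t) = K) \<and>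
     (\<forall>x\<in>{0..K/\<gamma>}. V (x, T) = K)"

definition cb_vanishing_at_zero ::
  "real \<Rightarrow> (real \<times> real \<Rightarrow> real) \<Rightarrow> (real \<times> real \<Rightarrow> real) \<Rightarrow> bool" where
  "cb_vanishing_at_zero T Vx Vxx \<longleftrightarrow>
     (\<forall>t\<in>{0<..<T}. ((\<lambda>x. x\<^sup>2 * Vxx (x, t)) \<longlongrightarrow> 0) (at_right 0) \<and>
                   ((\<lambda>x. x * Vx (x, t)) \<longlongrightarrow> 0) (at_right 0))"

definition cb_conversion_region ::
  "real \<Rightarrow> real \<Rightarrow> real \<Rightarrow> (real \<times> real \<Rightarrow> real) \<Rightarrow> (real \<times> real) set" where
  "cb_conversion_region K \<gamma> T V = {z \<in> cb_domain K \<gamma> T. V z = \<gamma> * fst z}"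

definition cb_free_boundary ::
  "real \<Rightarrow> real \<Rightarrow> real \<Rightarrow> (real \<times> real \<Rightarrow> real) \<Rightarrow> (real \<times> real) set" where
  "cb_free_boundary K \<gamma> T V =
     frontier {z \<in> cb_domain K \<gamma> T. V z > \<gamma> * fst z} \<inter> cb_domain K \<gamma> T"

end

theory Submission
  imports Defs
begin

text \<open>The operator is invariant under dilations \<open>x \<mapsto> a x\<close> and time shifts, so comparing \<open>V\<close> with
  \<open>V (a x, t) / a\<close> (\<open>a \<ge> 1\<close>) and with \<open>V (x, t + s)\<close> shows that the conversion region is
  \<open>{x \<ge> h t}\<close> with \<open>h\<close> increasing. A barrier at the corner keeps it away from the terminal time, and
  \<open>V \<ge> K exp (- r (T - t))\<close> keeps it away from \<open>x = 0\<close>; so \<open>t\<^sup>*\<close> is the supremum of its times.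
  In the comparisons the set \<open>{V = K}\<close> is an obstacle, because there only \<open>L V \<ge> c\<close> is known, and \<open>V\<close> may
  indeed equal \<open>K\<close> on a time interval ending at \<open>T\<close>. A strong maximum principle repairs this: if \<open>V = K\<close> at
  one interior point, then \<open>V = K\<close> at all later times, so both functions compared equal \<open>K\<close> there.

  Pointwise comparison with functions whose second derivatives exist only almost everywhere is made
  possible by mollification: the \<open>L\<^sup>6\<close> bounds make the commutator with the coefficients small.\<close>

section \<open>Smooth product test functions\<close>

text \<open>All comparisons are terminal value problems on sets where the difference
  \<open>g\<close> is negative, and the two obstacles behave differently there. The lower one is
  harmless: where the wanted inequality fails, the function that should be smaller lies strictly
  above \<open>\<gamma> * x\<close>. At the upper one the inequality for \<open>- V\<close> is
  missing. The coupon condition helps: the constant \<open>K\<close> satisfies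
  \<open>L K = r K > c\<close>, so barriers of the form \<open>K\<close> minus a bump can be
  compared with \<open>V\<close> as long as \<open>V < K\<close>. The strong maximum principle then
  rests on a conflict of two rates. A barrier in a thin tube forces \<open>K - V\<close> to grow at
  least linearly into the tube from a last contact point. On the other hand, for second space and
  first time derivatives in \<open>L^p\<close>, means over parabolic cylinders of size \<theta>
  differ from the point value by order \<open>\<theta>^(2 - 3/p)\<close>, where 3 is the parabolic
  dimension (one for space, two for time). At a contact point this bounds the mean of the
  nonnegative \<open>K - V\<close>. Any p above 3 beats the linear rate; p = 6 gives the convenient
  power 3/2. All kernels are products of a function of \<open>x\<close> and one of \<open>t\<close>,
  so the weak derivatives are tested against products only.\<close>

definition expflat :: "nat \<Rightarrow> real \<Rightarrow> real" where
  "expflat m s = (if s \<le> 0 then 0 else exp (- 1 / s) / s ^ m)"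

lemma expflat_tendsto_0: "(expflat m \<longlongrightarrow> 0) (at 0)"
proof -
  have "((\<lambda>s::real. inverse s ^ m / exp (inverse s)) \<longlongrightarrow> 0) (at_right 0)"
    using filterlim_compose[OF tendsto_power_div_exp_0 filterlim_inverse_at_top_right] .
  then have "(expflat m \<longlongrightarrow> 0) (at_right 0)"
  proof (rule Lim_transform_eventually)
    show "\<forall>\<^sub>F s in at_right 0. inverse s ^ m / exp (inverse s) = expflat m s"
      by (rule eventually_at_rightI[of 0 1])
        (auto simp: expflat_def exp_minus field_simps)
  qed
  moreover have "(expflat m \<longlongrightarrow> 0) (at_left 0)"
    by (rule Lim_transform_eventually[OF tendsto_const],
        rule eventually_at_leftI[of "-1"]) (auto simp: expflat_def)
  ultimately show ?thesis
    by (simp add: filterlim_split_at)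
qed

text \<open>The power \<open>s ^ m\<close> is carried along so that the family is closed under
  differentiation up to linear combinations. At 0 the difference quotient of
  \<open>expflat m\<close> is \<open>expflat (Suc m)\<close>, which tends to 0.\<close>

lemma expflat_deriv:
  "(expflat m has_real_derivative (- real m * expflat (Suc m) s + expflat (Suc (Suc m)) s)) (at s)"
proof (cases s "0::real" rule: linorder_cases)
  case less
  have "((\<lambda>s::real. 0) has_real_derivative 0) (at s)"
    by simp
  then have "(expflat m has_real_derivative 0) (at s)"
    by (rule has_field_derivative_transform_within_open[where S="{..<0}"])
      (use less in \<open>auto simp: expflat_def\<close>)
  then show ?thesis
    using less by (simp add: expflat_def)
next
  case equal
  have "((\<lambda>h. (expflat m (0 + h) - expflat m 0) / h) \<longlongrightarrow> 0) (at 0)"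
  proof (rule Lim_transform_eventually[OF expflat_tendsto_0])
    show "\<forall>\<^sub>F h in at 0. expflat (Suc m) h = (expflat m (0 + h) - expflat m 0) / h"
      by (auto simp: expflat_def eventually_at_filter field_simps)
  qed
  then show ?thesis
    using equal by (simp add: DERIV_def expflat_def)
next
  case greater
  have d: "((\<lambda>s::real. exp (- 1 / s) / s ^ m) has_real_derivative
      (exp (- 1 / s) * (1 / s\<^sup>2) * s ^ m - exp (- 1 / s) * (real m * s ^ (m - 1))) / (s ^ m * s ^ m)) (at s)"
    using greater by (auto intro!: derivative_eq_intros simp: power2_eq_square)
  have "(exp (- 1 / s) * (1 / s\<^sup>2) * s ^ m - exp (- 1 / s) * (real m * s ^ (m - 1))) / (s ^ m * s ^ m)
      = - real m * expflat (Suc m) s + expflat (Suc (Suc m)) s"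
    using greater by (cases m) (simp_all add: expflat_def field_simps power2_eq_square)
  with d have "((\<lambda>s::real. exp (- 1 / s) / s ^ m) has_real_derivative
      (- real m * expflat (Suc m) s + expflat (Suc (Suc m)) s)) (at s)"
    by simp
  then show ?thesis
    by (rule has_field_derivative_transform_within_open[where S="{0<..}"])
      (use greater in \<open>auto simp: expflat_def\<close>)
qed

text \<open>A syntactic class closed under differentiation and containing a bump function: membership gives
  \<open>Ck_fun n\<close> for all \<open>n\<close> at once.\<close>

inductive smooth_real :: "(real \<Rightarrow> real) \<Rightarrow> bool" where
  smooth_const: "smooth_real (\<lambda>x. a)"
| smooth_ident: "smooth_real (\<lambda>x. x)"
| smooth_add: "smooth_real f \<Longrightarrow> smooth_real g \<Longrightarrow> smooth_real (\<lambda>x. f x + g x)"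
| smooth_mult: "smooth_real f \<Longrightarrow> smooth_real g \<Longrightarrow> smooth_real (\<lambda>x. f x * g x)"
| smooth_flat: "smooth_real f \<Longrightarrow> smooth_real (\<lambda>x. expflat m (f x))"

lemma smooth_real_deriv_exists:
  assumes "smooth_real f"
  shows "\<exists>f'. smooth_real f' \<and> (\<forall>x. (f has_real_derivative f' x) (at x))"
  using assms
proof induction
  case (smooth_const a)
  then show ?case by (intro exI[of _ "\<lambda>x. 0"]) (auto intro: smooth_real.intros)
next
  case smooth_ident
  then show ?case by (intro exI[of _ "\<lambda>x. 1"]) (auto intro: smooth_real.intros)
next
  case (smooth_add f g)
  then obtain f' g' where "smooth_real f'" "smooth_real g'"
    "\<forall>x. (f has_real_derivative f' x) (at x)" "\<forall>x. (g has_real_derivative g' x) (at x)"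
    by blast
  then show ?case
    by (intro exI[of _ "\<lambda>x. f' x + g' x"]) (auto intro!: smooth_real.intros derivative_intros)
next
  case (smooth_mult f g)
  then obtain f' g' where "smooth_real f'" "smooth_real g'"
    "\<forall>x. (f has_real_derivative f' x) (at x)" "\<forall>x. (g has_real_derivative g' x) (at x)"
    by blast
  then show ?case using smooth_mult.hyps
    by (intro exI[of _ "\<lambda>x. f' x * g x + g' x * f x"])
       (auto intro!: smooth_real.intros derivative_eq_intros)
next
  case (smooth_flat f m)
  then obtain f' where f': "smooth_real f'" "\<forall>x. (f has_real_derivative f' x) (at x)"
    by blast
  let ?d = "\<lambda>x. (- real m * expflat (Suc m) (f x) + expflat (Suc (Suc m)) (f x)) * f' x"
  have "smooth_real ?d"
    using f' smooth_flat.hyps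
    by (intro smooth_real.smooth_mult smooth_real.smooth_add smooth_real.smooth_const
        smooth_real.smooth_flat) auto
  moreover have "((\<lambda>x. expflat m (f x)) has_real_derivative ?d x) (at x)" for x
    using DERIV_chain2[OF expflat_deriv] f' by blast
  ultimately show ?case by (intro exI[of _ ?d]) auto
qed

lemma smooth_real_compose:
  assumes "smooth_real f" "smooth_real g"
  shows "smooth_real (\<lambda>x. f (g x))"
  using assms by induction (auto intro: smooth_real.intros)

lemma smooth_real_affine: "smooth_real f \<Longrightarrow> smooth_real (\<lambda>x. f ((x - a) / e))"
proof -
  assume "smooth_real f"
  moreover have "smooth_real (\<lambda>x. (x + - a) * (1 / e))"
    by (intro smooth_real.intros)
  ultimately show ?thesis
    using smooth_real_compose[of f "\<lambda>x. (x + - a) * (1 / e)"] by simp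
qed

lemma smooth_real_deriv:
  assumes "smooth_real f"
  shows "smooth_real (deriv f)" "(f has_real_derivative deriv f x) (at x)"
proof -
  obtain f' where f': "smooth_real f'" "\<And>x. (f has_real_derivative f' x) (at x)"
    using smooth_real_deriv_exists[OF assms] by blast
  moreover have "deriv f = f'"
    using DERIV_imp_deriv f'(2) by blast
  ultimately show "smooth_real (deriv f)" "(f has_real_derivative deriv f x) (at x)"
    by auto
qed

lemma smooth_real_continuous: "smooth_real f \<Longrightarrow> continuous_on S f"
  by (meson DERIV_isCont continuous_at_imp_continuous_on smooth_real_deriv(2))

lemma smooth_real_continuous_compose:
  "smooth_real f \<Longrightarrow> continuous_on S g \<Longrightarrow> continuous_on S (\<lambda>z. f (g z))"
  using continuous_on_compose2[OF smooth_real_continuous[of f UNIV]] by auto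

lemma smooth_prod_has_derivative:
  assumes "smooth_real f" "smooth_real h"
  shows "((\<lambda>z. f (fst z) * h (snd z)) has_derivative
    (\<lambda>v. deriv f (fst z) * h (snd z) * fst v + f (fst z) * deriv h (snd z) * snd v)) (at z)"
proof -
  have 1: "((\<lambda>z. f (fst z)) has_derivative (\<lambda>v. deriv f (fst z) * fst v)) (at z)"
    using DERIV_compose_FDERIV[OF smooth_real_deriv(2)[OF assms(1)],
        of fst, OF has_derivative_fst[OF has_derivative_ident], of z UNIV]
    by (simp add: mult.commute)
  have 2: "((\<lambda>z. h (snd z)) has_derivative (\<lambda>v. deriv h (snd z) * snd v)) (at z)"
    using DERIV_compose_FDERIV[OF smooth_real_deriv(2)[OF assms(2)],
        of snd, OF has_derivative_snd[OF has_derivative_ident], of z UNIV]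
    by (simp add: mult.commute)
  show ?thesis
    using has_derivative_mult[OF 1 2] by (simp add: algebra_simps)
qed

lemma smooth_prod_frechet:
  assumes "smooth_real f" "smooth_real h"
  shows "frechet_derivative (\<lambda>z. f (fst z) * h (snd z)) (at z) v =
    deriv f (fst z) * h (snd z) * fst v + f (fst z) * deriv h (snd z) * snd v"
  by (simp add: frechet_derivative_at[OF smooth_prod_has_derivative[OF assms], symmetric])

lemma Ck_fun_smooth_prod:
  assumes "smooth_real f" "smooth_real h"
  shows "Ck_fun n (\<lambda>z::real \<times> real. f (fst z) * h (snd z))"
  using assms
proof (induction n arbitrary: f h)
  case 0
  then show ?case
    by (auto intro!: continuous_intros smooth_real_continuous_compose[of f]
      smooth_real_continuous_compose[of h])
next
  case (Suc n)
  have "(\<lambda>z::real \<times> real. f (fst z) * h (snd z)) differentiable_on UNIV"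
    using smooth_prod_has_derivative[OF Suc.prems]
    by (auto simp: differentiable_on_def differentiable_def intro: has_derivative_at_withinI)
  then show ?case
    using Suc smooth_real_deriv(1)
    by (auto simp: Basis_prod_def smooth_prod_frechet[OF Suc.prems])
qed

lemma test_function_smooth_prod:
  assumes "smooth_real f" "smooth_real h"
    and "\<And>x. x \<notin> {a..b} \<Longrightarrow> f x = 0" "\<And>t. t \<notin> {c..d} \<Longrightarrow> h t = 0"
    and "cbox (a, c) (b, d) \<subseteq> D"
  shows "test_function D (\<lambda>z. f (fst z) * h (snd z))"
  unfolding test_function_def
proof (intro conjI allI exI[of _ "cbox (a, c) (b, d)"])
  fix z :: "real \<times> real"
  show "z \<notin> cbox (a, c) (b, d) \<longrightarrow> f (fst z) * h (snd z) = 0"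
    using assms(3)[of "fst z"] assms(4)[of "snd z"] by (cases z) auto
qed (use assms Ck_fun_smooth_prod in auto)

lemma deriv_zero_outside:
  fixes f :: "real \<Rightarrow> real"
  assumes "\<And>x. x \<notin> {a..b} \<Longrightarrow> f x = 0" "x \<notin> {a..b}"
  shows "deriv f x = 0"
proof -
  have "((\<lambda>x. 0) has_real_derivative 0) (at x)" by simp
  then have "(f has_real_derivative 0) (at x)"
    by (rule has_field_derivative_transform_within_open[where S="- {a..b}"])
      (use assms in auto)
  then show ?thesis by (rule DERIV_imp_deriv)
qed

section \<open>Weak derivatives tested against products\<close>

lemma absolutely_integrable_mult_continuous:
  fixes g \<phi> :: "'a::euclidean_space \<Rightarrow> real"
  assumes "g absolutely_integrable_on S" "continuous_on S \<phi>" "compact S"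
  shows "(\<lambda>z. g z * \<phi> z) absolutely_integrable_on S"
proof -
  have "(\<lambda>z. \<phi> z * g z) absolutely_integrable_on S"
  proof (rule absolutely_integrable_bounded_measurable_product[OF bilinear_times])
    show "\<phi> \<in> borel_measurable (lebesgue_on S)"
      using assms by (intro continuous_imp_measurable_on_sets_lebesgue)
        (auto simp: fmeasurableD lmeasurable_compact)
    show "bounded (\<phi> ` S)"
      using assms compact_continuous_image compact_imp_bounded by blast
  qed (use assms in \<open>auto simp: fmeasurableD lmeasurable_compact\<close>)
  then show ?thesis by (simp add: mult.commute)
qed

lemma locally_Lp_1_absolutely_integrable:
  assumes "locally_Lp D 1 u" "compact S" "S \<subseteq> D" "D \<in> sets lebesgue"
  shows "u absolutely_integrable_on S"
proof (rule measurable_bounded_by_integrable_imp_absolutely_integrable)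
  have S: "S \<in> sets lebesgue"
    using assms(2) by (simp add: fmeasurableD lmeasurable_compact)
  show "u \<in> borel_measurable (lebesgue_on S)"
    using assms(1,3) by (auto simp: locally_Lp_def intro: measurable_restrict_mono)
  show "S \<in> sets lebesgue" by fact
  have "set_integrable lebesgue S (\<lambda>z. \<bar>u z\<bar> powr 1)"
    using assms by (auto simp: locally_Lp_def)
  then show "(\<lambda>z. \<bar>u z\<bar>) integrable_on S"
    using set_lebesgue_integral_eq_integral(1) by fastforce
qed auto

text \<open>Passes from Lebesgue integrals over \<open>D\<close> to gauge integrals over a box
  carrying the support of the test function. All later estimates live on one fixed box, independent
  of the scale of the kernel.\<close>

lemma weak_partial_prod:
  assumes w: "has_weak_partial D e u g" and D: "open D"
    and sm: "smooth_real f" "smooth_real h"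
    and supp: "\<And>x. x \<notin> {a..b} \<Longrightarrow> f x = 0" "\<And>t. t \<notin> {c..d} \<Longrightarrow> h t = 0"
    and sub: "cbox (a, c) (b, d) \<subseteq> D"
  shows "integral (cbox (a, c) (b, d))
      (\<lambda>z. u z * (deriv f (fst z) * h (snd z) * fst e + f (fst z) * deriv h (snd z) * snd e))
    = - integral (cbox (a, c) (b, d)) (\<lambda>z. g z * (f (fst z) * h (snd z)))"
proof -
  let ?B = "cbox (a, c) (b, d)"
  let ?\<phi> = "\<lambda>z. f (fst z) * h (snd z)"
  let ?\<psi> = "\<lambda>z. deriv f (fst z) * h (snd z) * fst e + f (fst z) * deriv h (snd z) * snd e"
  have cont: "continuous_on ?B ?\<phi>" "continuous_on ?B ?\<psi>"
    by (intro continuous_intros smooth_real_continuous_compose[OF sm(1)]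
        smooth_real_continuous_compose[OF sm(2)]
        smooth_real_continuous_compose[OF smooth_real_deriv(1)[OF sm(1)]]
        smooth_real_continuous_compose[OF smooth_real_deriv(1)[OF sm(2)]])+
  have int: "(LINT z:D|lebesgue. v z * \<theta> z) = integral ?B (\<lambda>z. v z * \<theta> z)"
    if "locally_Lp D 1 v" "continuous_on ?B \<theta>" "\<And>z. z \<notin> ?B \<Longrightarrow> \<theta> z = 0" for v \<theta>
  proof -
    have "v absolutely_integrable_on ?B"
      using locally_Lp_1_absolutely_integrable[OF that(1) compact_cbox sub] D by auto
    then have "(\<lambda>z. v z * \<theta> z) absolutely_integrable_on ?B"
      using absolutely_integrable_mult_continuous that(2) compact_cbox by blast
    moreover have "(LINT z:D|lebesgue. v z * \<theta> z) = (LINT z:?B|lebesgue. v z * \<theta> z)"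
      unfolding set_lebesgue_integral_def
      using sub that(3) by (intro Bochner_Integration.integral_cong refl)
        (auto simp: indicator_def)
    ultimately show ?thesis
      using set_lebesgue_integral_eq_integral(2) by simp
  qed
  have *: "f (fst z) * h (snd z) = 0" "?\<psi> z = 0" if "z \<notin> ?B" for z
  proof -
    have "fst z \<notin> {a..b} \<or> snd z \<notin> {c..d}"
      using that by (cases z) auto
    then have "(f (fst z) = 0 \<and> deriv f (fst z) = 0) \<or> (h (snd z) = 0 \<and> deriv h (snd z) = 0)"
      using supp deriv_zero_outside[of a b f, OF supp(1)] deriv_zero_outside[of c d h, OF supp(2)]
      by blast
    then show "f (fst z) * h (snd z) = 0" "?\<psi> z = 0" by auto
  qed
  have "(LINT z:D|lebesgue. u z * ?\<psi> z) = - (LINT z:D|lebesgue. g z * ?\<phi> z)"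
    using w test_function_smooth_prod[OF sm supp sub]
    unfolding has_weak_partial_def smooth_prod_frechet[OF sm, symmetric] by blast
  then show ?thesis
    using int[OF _ cont(2)] int[OF _ cont(1)] w * unfolding has_weak_partial_def by simp
qed

lemma weak_partial_x:
  assumes "has_weak_partial D (1, 0) u g" "open D" "smooth_real f" "smooth_real h"
    and "\<And>x. x \<notin> {a..b} \<Longrightarrow> f x = 0" "\<And>t. t \<notin> {c..d} \<Longrightarrow> h t = 0"
    and "cbox (a, c) (b, d) \<subseteq> D"
  shows "integral (cbox (a, c) (b, d)) (\<lambda>z. u z * (deriv f (fst z) * h (snd z)))
    = - integral (cbox (a, c) (b, d)) (\<lambda>z. g z * (f (fst z) * h (snd z)))"
  using weak_partial_prod[OF assms] by simp

lemma weak_partial_t: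
  assumes "has_weak_partial D (0, 1) u g" "open D" "smooth_real f" "smooth_real h"
    and "\<And>x. x \<notin> {a..b} \<Longrightarrow> f x = 0" "\<And>t. t \<notin> {c..d} \<Longrightarrow> h t = 0"
    and "cbox (a, c) (b, d) \<subseteq> D"
  shows "integral (cbox (a, c) (b, d)) (\<lambda>z. u z * (f (fst z) * deriv h (snd z)))
    = - integral (cbox (a, c) (b, d)) (\<lambda>z. g z * (f (fst z) * h (snd z)))"
  using weak_partial_prod[OF assms] by simp

text \<open>Two integrations by parts, the first with \<open>deriv f\<close> as test factor: it is
  again smooth and vanishes outside the same interval.\<close>

lemma weak_partial_xx:
  assumes "has_weak_partial D (1, 0) u ux" "has_weak_partial D (1, 0) ux uxx"
    and "open D" "smooth_real f" "smooth_real h"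
    and "\<And>x. x \<notin> {a..b} \<Longrightarrow> f x = 0" "\<And>t. t \<notin> {c..d} \<Longrightarrow> h t = 0"
    and "cbox (a, c) (b, d) \<subseteq> D"
  shows "integral (cbox (a, c) (b, d)) (\<lambda>z. u z * (deriv (deriv f) (fst z) * h (snd z)))
    = integral (cbox (a, c) (b, d)) (\<lambda>z. uxx z * (f (fst z) * h (snd z)))"
  using weak_partial_x[OF assms(1,3) smooth_real_deriv(1)[OF assms(4)] assms(5)
      deriv_zero_outside[OF assms(6)] assms(7,8)]
    weak_partial_x[OF assms(2-8)]
  by simp

section \<open>Mollification\<close>

definition bump :: "real \<Rightarrow> real" where
  "bump y = expflat 2 (1 - y * y)"

text \<open>The factor \<open>s\<^sup>-\<^sup>2\<close> in \<open>bump\<close> makes \<open>y * bump y\<close> the derivative of an explicit compactly supported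
  function, so that scaling a mollifier changes it by second derivatives of test functions.\<close>

definition bump_prim :: "real \<Rightarrow> real" where
  "bump_prim y = - 1 / 2 * expflat 0 (1 - y * y)"

lemma smooth_real_bump: "smooth_real bump" and smooth_real_bump_prim: "smooth_real bump_prim"
proof -
  have "smooth_real (\<lambda>y. 1 + (- 1) * (y * y))"
    by (intro smooth_real.intros)
  then have *: "smooth_real (\<lambda>y. 1 - y * y)" by simp
  show "smooth_real bump"
    unfolding bump_def using smooth_real.smooth_flat[OF *] .
  show "smooth_real bump_prim"
    unfolding bump_prim_def using smooth_real.smooth_mult[OF smooth_real.smooth_const smooth_real.smooth_flat[OF *]] .
qed

lemma deriv_bump_prim: "deriv bump_prim = (\<lambda>y. y * bump y)"
proof
  fix y
  have "(bump_prim has_real_derivative (- 1 / 2 * (expflat 2 (1 - y * y) * (- 2 * y)))) (at y)"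
    unfolding bump_prim_def
    by (auto intro!: derivative_eq_intros DERIV_chain2[where f="expflat 0"] expflat_deriv[of 0, simplified]
        simp: numeral_2_eq_2)
  then show "deriv bump_prim y = y * bump y"
    by (simp add: DERIV_imp_deriv bump_def)
qed

lemma bump_nonneg: "bump y \<ge> 0"
  by (simp add: bump_def expflat_def)

lemma one_minus_sq_pos_iff: "0 < 1 - y * y \<longleftrightarrow> \<bar>y\<bar> < 1" for y :: real
  using abs_square_less_1[of y] by (auto simp: power2_eq_square)

lemma bump_pos: "\<bar>y\<bar> < 1 \<Longrightarrow> bump y > 0"
  using one_minus_sq_pos_iff[of y] by (simp add: bump_def expflat_def)

lemma bump_zero: "y \<notin> {-1..1} \<Longrightarrow> bump y = 0"
  using one_minus_sq_pos_iff[of y] by (auto simp: bump_def expflat_def)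

lemma bump_prim_zero: "y \<notin> {-1..1} \<Longrightarrow> bump_prim y = 0"
  using one_minus_sq_pos_iff[of y] by (auto simp: bump_prim_def expflat_def)

lemma bounded_of_compact_support:
  fixes f :: "real \<Rightarrow> real"
  assumes "continuous_on UNIV f" "\<And>y. y \<notin> {-1..1} \<Longrightarrow> f y = 0"
  obtains P where "P > 0" "\<And>y. \<bar>f y\<bar> \<le> P"
proof -
  have "compact (f ` {-1..1})"
    using assms(1) by (intro compact_continuous_image) (auto intro: continuous_on_subset)
  then obtain P where P: "P > 0" "\<And>y. y \<in> {-1..1} \<Longrightarrow> \<bar>f y\<bar> \<le> P"
    using compact_imp_bounded bounded_pos by (metis imageI real_norm_def)
  show ?thesis
    using that[of P] P assms(2) by (metis abs_zero less_imp_le)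
qed

lemma bump_mass_pos: "integral {-1..1} bump > 0"
proof -
  have c: "continuous_on {-1..1} bump"
    by (rule smooth_real_continuous[OF smooth_real_bump])
  have "integral {-1..1} bump \<noteq> 0"
    using integral_eq_0_iff[OF c] bump_nonneg bump_pos[of 0] by fastforce
  then show ?thesis
    using integral_nonneg[OF integrable_continuous_real[OF c]] bump_nonneg by fastforce
qed

text \<open>The affine substitution gives the integral over the rescaled support; the integrand
  vanishes on the rest of \<open>{a..b}\<close>. Thus the domain of integration need not move with
  \<open>x\<close> and \<open>e\<close>.\<close>

lemma integral_rescale:
  fixes f :: "real \<Rightarrow> real"
  assumes f: "continuous_on UNIV f" "\<And>y. y \<notin> {-1..1} \<Longrightarrow> f y = 0" and "e > 0"
    and "a \<le> x - e" "x + e \<le> b"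
  shows "integral {a..b} (\<lambda>\<xi>. f ((\<xi> - x) / e)) = e * integral {-1..1} f"
proof -
  have "(f has_integral integral {-1..1} f) (cbox (-1) 1)"
    using integrable_integral[OF integrable_continuous_real[OF continuous_on_subset[OF f(1)]]] by simp
  from has_integral_affinity'[OF this, of "1 / e" "- x / e"]
  have "((\<lambda>\<xi>. f (1 / e * \<xi> + - x / e)) has_integral e * integral {-1..1} f)
      {e * (- 1 - - x / e)..e * (1 - - x / e)}"
    using \<open>e > 0\<close> by simp
  moreover have "1 / e * \<xi> + - x / e = (\<xi> - x) / e" for \<xi>
    by (simp add: diff_divide_distrib)
  moreover have "e * (- 1 - - x / e) = x - e" "e * (1 - - x / e) = x + e"
    using \<open>e > 0\<close> by (simp_all add: field_simps)
  ultimately have "((\<lambda>\<xi>. f ((\<xi> - x) / e)) has_integral e * integral {-1..1} f) {x - e..x + e}"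
    by simp
  then have "((\<lambda>\<xi>. f ((\<xi> - x) / e)) has_integral e * integral {-1..1} f) {a..b}"
    by (rule has_integral_on_superset) (use assms in \<open>auto intro!: f(2) simp: field_simps\<close>)
  then show ?thesis by (rule integral_unique)
qed

text \<open>The kernel is not normalised: with \<open>bump\<close> in both factors its integral is
  \<open>e * \<delta>\<close> times the square of \<open>bump_mass\<close>. Two independent scales
  are kept because equal ones serve for smoothing and the pair \<open>s\<close>,
  \<open>s\<^sup>2\<close> for parabolic means.\<close>

abbreviation pkernel :: "(real \<Rightarrow> real) \<Rightarrow> (real \<Rightarrow> real) \<Rightarrow> real \<Rightarrow> real \<Rightarrow> real \<Rightarrow> real \<Rightarrow> real \<times> real \<Rightarrow> real" where
  "pkernel f h x e t \<delta> z \<equiv> f ((fst z - x) / e) * h ((snd z - t) / \<delta>)"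

lemma integral_rescale_prod:
  fixes f h :: "real \<Rightarrow> real"
  assumes "continuous_on UNIV f" "\<And>y. y \<notin> {-1..1} \<Longrightarrow> f y = 0"
    and "continuous_on UNIV h" "\<And>y. y \<notin> {-1..1} \<Longrightarrow> h y = 0"
    and "e > 0" "\<delta> > 0" "a \<le> x - e" "x + e \<le> b" "c \<le> t - \<delta>" "t + \<delta> \<le> d"
  shows "integral (cbox (a, c) (b, d)) (\<lambda>z. f ((fst z - x) / e) * h ((snd z - t) / \<delta>))
    = e * \<delta> * (integral {-1..1} f * integral {-1..1} h)"
proof -
  have "continuous_on (cbox (a, c) (b, d)) (\<lambda>z. f ((fst z - x) / e) * h ((snd z - t) / \<delta>))"
    using assms(5,6)
    by (intro continuous_intros continuous_on_compose2[OF assms(1)] continuous_on_compose2[OF assms(3)]) auto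
  from integral_prod_continuous[OF this]
  show ?thesis
    using integral_rescale[OF assms(1,2,5,7,8)] integral_rescale[OF assms(3,4,6,9,10)] by simp
qed

text \<open>Only the weight depends on the parameter, so continuity of \<open>V\<close> suffices.
  The parameter set \<open>U\<close> is general because the kernel is differentiated both in its
  centre (all reals) and in its scale (positive reals).\<close>

lemma leibniz_weighted:
  fixes V :: "'a::euclidean_space \<Rightarrow> real" and k k' :: "real \<Rightarrow> 'a \<Rightarrow> real"
  assumes V: "continuous_on (cbox u v) V" and U: "open U" "convex U" "s \<in> U"
    and d: "\<And>s z. s \<in> U \<Longrightarrow> ((\<lambda>s. k s z) has_real_derivative k' s z) (at s)"
    and c: "\<And>s. s \<in> U \<Longrightarrow> continuous_on (cbox u v) (k s)"
    and c': "continuous_on (U \<times> cbox u v) (\<lambda>p. k' (fst p) (snd p))"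
  shows "((\<lambda>s. integral (cbox u v) (\<lambda>z. V z * k s z)) has_real_derivative integral (cbox u v) (\<lambda>z. V z * k' s z)) (at s)"
proof -
  have "((\<lambda>s. integral (cbox u v) (\<lambda>z. V z * k s z)) has_real_derivative
      integral (cbox u v) (\<lambda>z. V z * k' s z)) (at s within U)"
  proof (rule leibniz_rule_field_derivative)
    show "((\<lambda>s. V z * k s z) has_real_derivative V z * k' s z) (at s within U)" if "s \<in> U" for s z
      using DERIV_cmult[OF d[OF that]] by (rule has_field_derivative_at_within)
    show "(\<lambda>z. V z * k s z) integrable_on cbox u v" if "s \<in> U" for s
      by (intro integrable_continuous continuous_on_mult V c that)
    have "continuous_on (U \<times> cbox u v) (\<lambda>p. V (snd p))"
      by (rule continuous_on_compose2[OF V continuous_on_snd]) (auto intro: continuous_intros)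
    then show "continuous_on (U \<times> cbox u v) (\<lambda>(s, z). V z * k' s z)"
      unfolding case_prod_unfold by (intro continuous_on_mult c')
  qed (use U in auto)
  then show ?thesis using at_within_open[OF U(3,1)] by simp
qed

text \<open>The centre \<open>x\<close> enters only through the kernel, so every derivative of the
  mollified function falls on the smooth factor \<open>f\<close>, with a factor
  \<open>- 1 / e\<close> from the chain rule.\<close>

lemma mollify_has_derivative_x:
  assumes V: "continuous_on (cbox (a, c) (b, d)) V" and "e > 0" "\<delta> > 0"
    and sm: "smooth_real f" "smooth_real h"
  shows "((\<lambda>x. integral (cbox (a, c) (b, d)) (\<lambda>z. V z * pkernel f h x e t \<delta> z))
    has_real_derivative integral (cbox (a, c) (b, d)) (\<lambda>z. V z * pkernel (deriv f) h x e t \<delta> z) * (- 1 / e)) (at x)"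
proof -
  have "((\<lambda>x. integral (cbox (a, c) (b, d)) (\<lambda>z. V z * pkernel f h x e t \<delta> z)) has_real_derivative
      integral (cbox (a, c) (b, d)) (\<lambda>z. V z * (deriv f ((fst z - x) / e) * h ((snd z - t) / \<delta>) * (- 1 / e)))) (at x)"
  proof (rule leibniz_weighted[OF V open_UNIV convex_UNIV UNIV_I])
    show "((\<lambda>x. f ((fst z - x) / e) * h ((snd z - t) / \<delta>)) has_real_derivative deriv f ((fst z - x) / e) * h ((snd z - t) / \<delta>) * (- 1 / e)) (at x)" for x z
      using assms(2,3) by (auto intro!: derivative_eq_intros DERIV_chain2[where f=f] smooth_real_deriv(2)[OF sm(1)])
  qed (use assms(2,3) in \<open>(intro continuous_intros smooth_real_continuous_compose[OF sm(1)] smooth_real_continuous_compose[OF sm(2)]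
      smooth_real_continuous_compose[OF smooth_real_deriv(1)[OF sm(1)]]; simp)+\<close>)
  then show ?thesis by (simp only: mult.assoc[symmetric] integral_mult_left)
qed

lemma mollify_has_derivative_t:
  assumes V: "continuous_on (cbox (a, c) (b, d)) V" and "e > 0" "\<delta> > 0"
    and sm: "smooth_real f" "smooth_real h"
  shows "((\<lambda>t. integral (cbox (a, c) (b, d)) (\<lambda>z. V z * pkernel f h x e t \<delta> z))
    has_real_derivative integral (cbox (a, c) (b, d)) (\<lambda>z. V z * pkernel f (deriv h) x e t \<delta> z) * (- 1 / \<delta>)) (at t)"
proof -
  have "((\<lambda>t. integral (cbox (a, c) (b, d)) (\<lambda>z. V z * pkernel f h x e t \<delta> z)) has_real_derivative
      integral (cbox (a, c) (b, d)) (\<lambda>z. V z * (f ((fst z - x) / e) * deriv h ((snd z - t) / \<delta>) * (- 1 / \<delta>)))) (at t)"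
  proof (rule leibniz_weighted[OF V open_UNIV convex_UNIV UNIV_I])
    show "((\<lambda>t. f ((fst z - x) / e) * h ((snd z - t) / \<delta>)) has_real_derivative f ((fst z - x) / e) * deriv h ((snd z - t) / \<delta>) * (- 1 / \<delta>)) (at t)" for t z
      using assms(2,3) by (auto intro!: derivative_eq_intros DERIV_chain2[where f=h] smooth_real_deriv(2)[OF sm(2)])
  qed (use assms(2,3) in \<open>(intro continuous_intros smooth_real_continuous_compose[OF sm(1)] smooth_real_continuous_compose[OF sm(2)]
      smooth_real_continuous_compose[OF smooth_real_deriv(1)[OF sm(2)]]; simp)+\<close>)
  then show ?thesis by (simp only: mult.assoc[symmetric] integral_mult_left)
qed

lemma mollify_continuous:
  assumes V: "continuous_on (cbox (a, c) (b, d)) V" and "e > 0" "\<delta> > 0"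
    and sm: "smooth_real f" "smooth_real h"
  shows "continuous_on UNIV (\<lambda>p. integral (cbox (a, c) (b, d))
      (\<lambda>z. V z * pkernel f h (fst p) e (snd p) \<delta> z))"
proof (rule integral_continuous_on_param)
  have V2: "continuous_on (UNIV \<times> cbox (a, c) (b, d)) (\<lambda>p::(real \<times> real) \<times> real \<times> real. V (snd p))"
    by (rule continuous_on_compose2[OF V continuous_on_snd]) (auto intro: continuous_intros)
  show "continuous_on (UNIV \<times> cbox (a, c) (b, d))
      (\<lambda>(p, z). V z * pkernel f h (fst p) e (snd p) \<delta> z)"
    unfolding case_prod_unfold using assms(2,3)
    by (intro continuous_intros V2 smooth_real_continuous_compose[OF sm(1)]
          smooth_real_continuous_compose[OF sm(2)]) auto
qed

lemma smooth_real_affine_DERIV: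
  assumes "smooth_real f"
  shows "((\<lambda>\<xi>. f ((\<xi> - x) / e)) has_real_derivative deriv f ((\<xi> - x) / e) * (1 / e)) (at \<xi>)"
proof (rule DERIV_chain2[OF smooth_real_deriv(2)[OF assms]])
  show "((\<lambda>\<xi>. (\<xi> - x) / e) has_real_derivative 1 / e) (at \<xi>)"
    by (rule DERIV_cdivide) (auto intro!: derivative_eq_intros)
qed

lemma deriv_affine:
  assumes "smooth_real f"
  shows "deriv (\<lambda>\<xi>. f ((\<xi> - x) / e)) = (\<lambda>\<xi>. deriv f ((\<xi> - x) / e) * (1 / e))"
  using smooth_real_affine_DERIV[OF assms] by (intro ext DERIV_imp_deriv)

lemma deriv_deriv_affine:
  assumes "smooth_real f"
  shows "deriv (deriv (\<lambda>\<xi>. f ((\<xi> - x) / e))) = (\<lambda>\<xi>. deriv (deriv f) ((\<xi> - x) / e) * (1 / e\<^sup>2))"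
  unfolding deriv_affine[OF assms]
  using DERIV_cmult_right[OF smooth_real_affine_DERIV[OF smooth_real_deriv(1)[OF assms]], where c="1 / e"]
  by (intro ext DERIV_imp_deriv) (simp add: power2_eq_square)

context
  fixes a b c d x t e \<delta> :: real and f h :: "real \<Rightarrow> real" and D :: "(real \<times> real) set"
  assumes D: "open D" "cbox (a, c) (b, d) \<subseteq> D"
    and sm: "smooth_real f" "smooth_real h"
    and supp: "\<And>y. y \<notin> {-1..1} \<Longrightarrow> f y = 0" "\<And>y. y \<notin> {-1..1} \<Longrightarrow> h y = 0"
    and pos: "e > 0" "\<delta> > 0"
    and fits: "a \<le> x - e" "x + e \<le> b" "c \<le> t - \<delta>" "t + \<delta> \<le> d"
begin

private lemma supp_affine:
  "\<xi> \<notin> {a..b} \<Longrightarrow> f ((\<xi> - x) / e) = 0" "\<tau> \<notin> {c..d} \<Longrightarrow> h ((\<tau> - t) / \<delta>) = 0"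
  using pos fits by (auto intro!: supp simp: field_simps)

private lemmas affine_facts = D(1) smooth_real_affine[OF sm(1), of x e] smooth_real_affine[OF sm(2), of t \<delta>]
  supp_affine D(2)

text \<open>Differentiating the kernel in its centre and in the integration variable differs by a
  sign, and so does integration by parts. The signs cancel, so the derivative of a mollification is
  the mollification of the weak derivative.\<close>

lemma mollify_weak_x:
  assumes "has_weak_partial D (1, 0) V Vx"
  shows "integral (cbox (a, c) (b, d)) (\<lambda>z. V z * pkernel (deriv f) h x e t \<delta> z) * (- 1 / e)
    = integral (cbox (a, c) (b, d)) (\<lambda>z. Vx z * pkernel f h x e t \<delta> z)"
  using weak_partial_x[OF assms affine_facts, simplified deriv_affine[OF sm(1)]]
  by (simp add: mult_ac flip: integral_mult_right integral_mult_left)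

lemma mollify_weak_xx:
  assumes "has_weak_partial D (1, 0) V Vx" "has_weak_partial D (1, 0) Vx Vxx"
  shows "integral (cbox (a, c) (b, d)) (\<lambda>z. V z * pkernel (deriv (deriv f)) h x e t \<delta> z) * (1 / e\<^sup>2)
    = integral (cbox (a, c) (b, d)) (\<lambda>z. Vxx z * pkernel f h x e t \<delta> z)"
  using weak_partial_xx[OF assms affine_facts, simplified deriv_deriv_affine[OF sm(1)]]
  by (simp add: mult_ac flip: integral_mult_right integral_mult_left)

lemma mollify_weak_t:
  assumes "has_weak_partial D (0, 1) V Vt"
  shows "integral (cbox (a, c) (b, d)) (\<lambda>z. V z * pkernel f (deriv h) x e t \<delta> z) * (- 1 / \<delta>)
    = integral (cbox (a, c) (b, d)) (\<lambda>z. Vt z * pkernel f h x e t \<delta> z)"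
  using weak_partial_t[OF assms affine_facts, simplified deriv_affine[OF sm(2)]]
  by (simp add: mult_ac flip: integral_mult_right integral_mult_left)

end

text \<open>A substitute for Hoelder's inequality with a free level \<open>s\<close>: where
  \<bar>g\<bar> exceeds \<open>s\<close>, it is at most its sixth power divided by
  \<open>s ^ 5\<close>. Each application picks the level that balances the two terms.\<close>

lemma integral_mult_le_power6:
  fixes g \<phi> :: "'a::euclidean_space \<Rightarrow> real" and u v :: 'a
  defines "S \<equiv> cbox u v"
  assumes g: "g absolutely_integrable_on S" "(\<lambda>z. \<bar>g z\<bar> powr 6) integrable_on S"
    and \<phi>: "continuous_on S \<phi>" "\<And>z. z \<in> S \<Longrightarrow> 0 \<le> \<phi> z" "\<And>z. z \<in> S \<Longrightarrow> \<phi> z \<le> P"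
    and "s > 0"
  shows "integral S (\<lambda>z. \<bar>g z\<bar> * \<phi> z) \<le> s * integral S \<phi> + P / s ^ 5 * integral S (\<lambda>z. \<bar>g z\<bar> powr 6)"
proof -
  have gi: "(\<lambda>z. \<bar>g z\<bar> * \<phi> z) integrable_on S"
    using absolutely_integrable_mult_continuous[OF absolutely_integrable_norm[OF g(1)] \<phi>(1)]
    by (simp add: comp_def S_def set_lebesgue_integral_eq_integral(1))
  have \<phi>i: "\<phi> integrable_on S"
    using \<phi>(1) unfolding S_def by (rule integrable_continuous)
  have "integral S (\<lambda>z. \<bar>g z\<bar> * \<phi> z) \<le> integral S (\<lambda>z. s * \<phi> z + P / s ^ 5 * \<bar>g z\<bar> powr 6)"
  proof (rule integral_le[OF gi])
    show "(\<lambda>z. s * \<phi> z + P / s ^ 5 * \<bar>g z\<bar> powr 6) integrable_on S"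
      by (intro integrable_add integrable_on_mult_right \<phi>i g)
    fix z assume z: "z \<in> S"
    have P: "0 \<le> P" using \<phi>(2,3)[OF z] by simp
    show "\<bar>g z\<bar> * \<phi> z \<le> s * \<phi> z + P / s ^ 5 * \<bar>g z\<bar> powr 6"
    proof (cases "\<bar>g z\<bar> \<le> s")
      case True
      then show ?thesis
        using \<phi>(2)[OF z] P \<open>s > 0\<close> by (intro add_increasing2 mult_right_mono) auto
    next
      case False
      have "\<bar>g z\<bar> * s ^ 5 \<le> \<bar>g z\<bar> * \<bar>g z\<bar> ^ 5"
        using False \<open>s > 0\<close> by (intro mult_left_mono power_mono) auto
      then have "\<bar>g z\<bar> \<le> \<bar>g z\<bar> powr 6 / s ^ 5"
        using \<open>s > 0\<close> False by (simp add: field_simps powr_numeral power_Suc[symmetric] del: power_Suc abs_power2 abs_power_minus)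
      then have "\<bar>g z\<bar> * \<phi> z \<le> (\<bar>g z\<bar> powr 6 / s ^ 5) * P"
        using \<phi>(2,3)[OF z] by (intro mult_mono) auto
      then show ?thesis
        using \<phi>(2)[OF z] \<open>s > 0\<close> by (intro add_increasing) (auto simp: mult.commute)
    qed
  qed
  also have "\<dots> = s * integral S \<phi> + P / s ^ 5 * integral S (\<lambda>z. \<bar>g z\<bar> powr 6)"
    by (simp only: integral_add[OF integrable_on_mult_right[OF \<phi>i] integrable_on_mult_right[OF g(2)]]
        integral_mult_right)
  finally show ?thesis .
qed

lemma has_integral_le_AE:
  fixes f g :: "'a::euclidean_space \<Rightarrow> real"
  assumes "(f has_integral i) S" "(g has_integral j) S"
    and "AE z in lebesgue. z \<in> S \<longrightarrow> f z \<le> g z"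
  shows "i \<le> j"
proof -
  obtain N where N: "N \<in> null_sets lebesgue" "{z. \<not> (z \<in> S \<longrightarrow> f z \<le> g z)} \<subseteq> N"
    using assms(3) unfolding eventually_ae_filter by auto
  have "((\<lambda>z. if z \<in> N then g z else f z) has_integral i) S"
    by (rule has_integral_spike[of N, OF _ _ assms(1)]) (use N(1) negligible_iff_null_sets in auto)
  then show ?thesis
    by (rule has_integral_le[OF _ assms(2)]) (use N(2) in auto)
qed

lemma dist_Pair_le: "dist (x, t) (x', t') \<le> \<bar>x - x'\<bar> + \<bar>t - t'\<bar>" for x t x' t' :: real
  using sqrt_sum_squares_le_sum_abs by (simp add: dist_Pair_Pair dist_real_def)

lemma abs_fst_diff_le_dist: "\<bar>fst z - fst p\<bar> \<le> dist p z" for z p :: "real \<times> real"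
  using dist_fst_le[of p z] by (simp add: dist_real_def abs_minus_commute)

lemma abs_snd_diff_le_dist: "\<bar>snd z - snd p\<bar> \<le> dist p z" for z p :: "real \<times> real"
  using dist_snd_le[of p z] by (simp add: dist_real_def abs_minus_commute)

lemma open_contains_box:
  fixes N :: "(real \<times> real) set"
  assumes "open N" "(x0, t0) \<in> N"
  obtains R where "R > 0" "cbox (x0 - 2 * R, t0 - 2 * R) (x0 + 2 * R, t0 + 2 * R) \<subseteq> N"
proof -
  obtain e where e: "e > 0" "cball (x0, t0) e \<subseteq> N"
    using assms open_contains_cball by blast
  have "cbox (x0 - 2 * (e / 4), t0 - 2 * (e / 4)) (x0 + 2 * (e / 4), t0 + 2 * (e / 4)) \<subseteq> cball (x0, t0) e"
  proof
    fix z assume "z \<in> cbox (x0 - 2 * (e / 4), t0 - 2 * (e / 4)) (x0 + 2 * (e / 4), t0 + 2 * (e / 4))"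
    then have "x0 - 2 * (e / 4) \<le> fst z" "fst z \<le> x0 + 2 * (e / 4)"
      "t0 - 2 * (e / 4) \<le> snd z" "snd z \<le> t0 + 2 * (e / 4)"
      by (auto simp: mem_Times_iff cbox_Pair_eq)
    then have "\<bar>x0 - fst z\<bar> \<le> e / 2" "\<bar>t0 - snd z\<bar> \<le> e / 2"
      by linarith+
    then show "z \<in> cball (x0, t0) e"
      using dist_Pair_le[of x0 t0 "fst z" "snd z"] by simp
  qed
  with e show ?thesis using that[of "e / 4"] by auto
qed

abbreviation "bump_mass \<equiv> integral {-1..1} bump"

text \<open>The kernel is nonnegative with known mass and vanishes off the small rectangle, so the
  oscillation of \<open>V\<close> there bounds the error.\<close>

lemma mollify_close:
  fixes V :: "real \<times> real \<Rightarrow> real"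
  assumes V: "continuous_on (cbox (a, c) (b, d)) V"
    and pos: "e > 0" "\<delta> > 0" and fits: "a \<le> x - e" "x + e \<le> b" "c \<le> t - \<delta>" "t + \<delta> \<le> d"
    and osc: "\<And>z. z \<in> cbox (a, c) (b, d) \<Longrightarrow> \<bar>fst z - x\<bar> \<le> e \<Longrightarrow> \<bar>snd z - t\<bar> \<le> \<delta> \<Longrightarrow> \<bar>V z - v\<bar> \<le> \<omega>"
  shows "\<bar>integral (cbox (a, c) (b, d)) (\<lambda>z. V z * pkernel bump bump x e t \<delta> z)
      - v * (e * \<delta> * (bump_mass * bump_mass))\<bar> \<le> \<omega> * (e * \<delta> * (bump_mass * bump_mass))"
proof -
  let ?B = "cbox (a, c) (b, d)"
  let ?\<phi> = "\<lambda>z. bump ((fst z - x) / e) * bump ((snd z - t) / \<delta>)"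
  have c\<phi>: "continuous_on ?B ?\<phi>"
    using pos by (intro continuous_intros smooth_real_continuous_compose[OF smooth_real_bump]) auto
  have \<phi>: "(?\<phi> has_integral e * \<delta> * (bump_mass * bump_mass)) ?B"
    using integrable_integral[OF integrable_continuous[OF c\<phi>]]
      integral_rescale_prod[OF smooth_real_continuous[OF smooth_real_bump] bump_zero
        smooth_real_continuous[OF smooth_real_bump] bump_zero pos fits] by simp
  have V\<phi>: "((\<lambda>z. V z * ?\<phi> z) has_integral integral ?B (\<lambda>z. V z * ?\<phi> z)) ?B"
    by (intro integrable_integral integrable_continuous continuous_on_mult V c\<phi>)
  have pt: "\<bar>V z * ?\<phi> z - v * ?\<phi> z\<bar> \<le> \<omega> * ?\<phi> z" if "z \<in> ?B" for z
  proof (cases "\<bar>fst z - x\<bar> \<le> e \<and> \<bar>snd z - t\<bar> \<le> \<delta>")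
    case True
    have "\<bar>(V z - v) * ?\<phi> z\<bar> \<le> \<omega> * ?\<phi> z"
      using osc[OF that] True bump_nonneg by (simp add: abs_mult mult_right_mono)
    then show ?thesis by (simp add: algebra_simps)
  next
    case False
    then have "(fst z - x) / e \<notin> {-1..1} \<or> (snd z - t) / \<delta> \<notin> {-1..1}"
      using pos by (auto simp: abs_le_iff field_simps)
    then have "?\<phi> z = 0" using bump_zero by auto
    then show ?thesis by (metis abs_zero diff_self mult_zero_right order_refl)
  qed
  have "integral ?B (\<lambda>z. V z * ?\<phi> z) - v * (e * \<delta> * (bump_mass * bump_mass)) \<le> \<omega> * (e * \<delta> * (bump_mass * bump_mass))"
    by (rule has_integral_le[OF has_integral_diff[OF V\<phi> has_integral_mult_right[OF \<phi>]]
          has_integral_mult_right[OF \<phi>]]) (use pt in \<open>auto simp: abs_le_iff\<close>)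
  moreover have "v * (e * \<delta> * (bump_mass * bump_mass)) - integral ?B (\<lambda>z. V z * ?\<phi> z) \<le> \<omega> * (e * \<delta> * (bump_mass * bump_mass))"
    by (rule has_integral_le[OF has_integral_diff[OF has_integral_mult_right[OF \<phi>] V\<phi>]
          has_integral_mult_right[OF \<phi>]]) (use pt in \<open>auto simp: abs_le_iff\<close>)
  ultimately show ?thesis by linarith
qed

section \<open>Supersolutions as limits of classical ones\<close>

text \<open>The derivatives are two-sided along the coordinate lines even if \<open>U\<close> is
  closed, and no joint continuity of them is asked for. This is just what the first and second order
  conditions at a minimum consume.\<close>

definition classical_on ::
  "(real \<times> real) set \<Rightarrow> (real \<times> real \<Rightarrow> real) \<Rightarrow> (real \<times> real \<Rightarrow> real)
    \<Rightarrow> (real \<times> real \<Rightarrow> real) \<Rightarrow> (real \<times> real \<Rightarrow> real) \<Rightarrow> bool" where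
  "classical_on U W Wx Wxx Wt \<longleftrightarrow> continuous_on U W \<and>
    (\<forall>z\<in>U. ((\<lambda>x. W (x, snd z)) has_real_derivative Wx z) (at (fst z)) \<and>
           ((\<lambda>x. Wx (x, snd z)) has_real_derivative Wxx z) (at (fst z)) \<and>
           ((\<lambda>t. W (fst z, t)) has_real_derivative Wt z) (at (snd z)))"

abbreviation supersol_approx ::
  "real \<Rightarrow> real \<Rightarrow> real \<Rightarrow> (real \<times> real \<Rightarrow> real) \<Rightarrow> real \<times> real \<Rightarrow> real \<Rightarrow> real \<Rightarrow> real \<Rightarrow> bool" where
  "supersol_approx \<sigma> r q f z0 k d e \<equiv> \<exists>W Wx Wxx Wt. classical_on (cball z0 d) W Wx Wxx Wt \<and>
    (\<forall>z\<in>cball z0 d. \<bar>W z - f z\<bar> < e \<and> k - e \<le> cb_operator \<sigma> r q W Wx Wxx Wt z)"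

text \<open>Near \<open>z0\<close> the function \<open>f\<close> satisfies \<open>L f \<ge> k\<close> in the sense of uniform approximation by
  classical functions. This replaces second derivatives that exist only almost everywhere.\<close>

definition supersol ::
  "real \<Rightarrow> real \<Rightarrow> real \<Rightarrow> (real \<times> real \<Rightarrow> real) \<Rightarrow> real \<times> real \<Rightarrow> real \<Rightarrow> bool" where
  "supersol \<sigma> r q f z0 k \<longleftrightarrow> (\<exists>d>0. \<forall>e>0. supersol_approx \<sigma> r q f z0 k d e)"

text \<open>Only the coefficients change between \<xi> and \<open>x\<close>, by
  \<open>\<bar>\<xi>\<^sup>2 - x\<^sup>2\<bar> \<le> 2 * X * e\<close> in the second order term and
  by at most \<open>e\<close> in the first order term. The factor \<open>s\<close> may have either
  sign, so that \<open>V\<close> and \<open>- V\<close> are treated together.\<close>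

lemma frozen_coefficient_bound:
  fixes x \<xi> X \<sigma> r q s v vx vxx vt :: real
  assumes "\<bar>\<xi> - x\<bar> \<le> e" "\<bar>\<xi>\<bar> \<le> X" "\<bar>x\<bar> \<le> X"
  shows "s * (- vt - 1/2 * \<sigma>\<^sup>2 * \<xi>\<^sup>2 * vxx - (r - q) * \<xi> * vx + r * v)
      - \<bar>s\<bar> * (\<sigma>\<^sup>2 * X + \<bar>r - q\<bar>) * e * (\<bar>vx\<bar> + \<bar>vxx\<bar>)
    \<le> s * (- vt - 1/2 * \<sigma>\<^sup>2 * x\<^sup>2 * vxx - (r - q) * x * vx + r * v)"
proof -
  have "\<bar>\<xi>\<^sup>2 - x\<^sup>2\<bar> = \<bar>\<xi> - x\<bar> * \<bar>\<xi> + x\<bar>"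
    by (simp add: power2_eq_square flip: abs_mult) (simp add: algebra_simps)
  also have "\<dots> \<le> e * (2 * X)"
    using assms by (intro mult_mono) auto
  finally have 1: "\<bar>\<xi>\<^sup>2 - x\<^sup>2\<bar> \<le> e * (2 * X)" .
  have e: "e \<ge> 0" and X: "X \<ge> 0" using assms by linarith+
  let ?d = "1/2 * \<sigma>\<^sup>2 * (\<xi>\<^sup>2 - x\<^sup>2) * vxx + (r - q) * (\<xi> - x) * vx"
  have "\<bar>?d\<bar> \<le> 1/2 * \<sigma>\<^sup>2 * \<bar>\<xi>\<^sup>2 - x\<^sup>2\<bar> * \<bar>vxx\<bar> + \<bar>r - q\<bar> * \<bar>\<xi> - x\<bar> * \<bar>vx\<bar>"
    by (rule order_trans[OF abs_triangle_ineq]) (simp add: abs_mult)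
  also have "\<dots> \<le> 1/2 * \<sigma>\<^sup>2 * (e * (2 * X)) * \<bar>vxx\<bar> + \<bar>r - q\<bar> * e * \<bar>vx\<bar>"
    using 1 assms by (intro add_mono mult_right_mono mult_left_mono) auto
  also have "\<dots> \<le> (\<sigma>\<^sup>2 * X + \<bar>r - q\<bar>) * e * \<bar>vxx\<bar> + (\<sigma>\<^sup>2 * X + \<bar>r - q\<bar>) * e * \<bar>vx\<bar>"
    using e X by (intro add_mono mult_right_mono) (auto simp: algebra_simps)
  finally have "\<bar>?d\<bar> \<le> (\<sigma>\<^sup>2 * X + \<bar>r - q\<bar>) * e * (\<bar>vx\<bar> + \<bar>vxx\<bar>)"
    by (simp add: algebra_simps)
  then have "\<bar>s\<bar> * \<bar>?d\<bar> \<le> \<bar>s\<bar> * ((\<sigma>\<^sup>2 * X + \<bar>r - q\<bar>) * e * (\<bar>vx\<bar> + \<bar>vxx\<bar>))"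
    by (rule mult_left_mono) simp
  then have "- (s * ?d) \<le> \<bar>s\<bar> * ((\<sigma>\<^sup>2 * X + \<bar>r - q\<bar>) * e * (\<bar>vx\<bar> + \<bar>vxx\<bar>))"
    using abs_ge_minus_self[of "s * ?d"] unfolding abs_mult by linarith
  then show ?thesis by (simp add: algebra_simps)
qed

text \<open>The mollification at scale \<open>e = n\<^sup>-\<^sup>2\<close>: moving the coefficients out of the convolution costs
  \<open>e\<close> times a mollified \<open>\<bar>Vx\<bar> + \<bar>Vxx\<bar>\<close>, which the \<open>L\<^sup>6\<close> bound controls by \<open>O(n)\<close>.\<close>

lemma mollified_operator_bound:
  fixes V Vx Vxx Vt :: "real \<times> real \<Rightarrow> real"
  assumes D: "open D" "cbox (a, c) (b, d) \<subseteq> D"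
    and V: "continuous_on (cbox (a, c) (b, d)) V"
    and w: "has_weak_partial D (1, 0) V Vx" "has_weak_partial D (1, 0) Vx Vxx" "has_weak_partial D (0, 1) V Vt"
    and L6: "(\<lambda>z. \<bar>Vx z\<bar> powr 6) integrable_on cbox (a, c) (b, d)" "(\<lambda>z. \<bar>Vxx z\<bar> powr 6) integrable_on cbox (a, c) (b, d)"
    and X: "\<bar>a\<bar> \<le> X" "\<bar>b\<bar> \<le> X"
    and AE: "AE z in lebesgue. z \<in> cbox (a, c) (b, d) \<longrightarrow> k \<le> s * cb_operator \<sigma> r q V Vx Vxx Vt z"
  shows "\<exists>C. \<forall>n x t e. n \<ge> (1::real) \<longrightarrow> e = 1 / n\<^sup>2 \<longrightarrow> a \<le> x - e \<longrightarrow> x + e \<le> b \<longrightarrow> c \<le> t - e \<longrightarrow> t + e \<le> d \<longrightarrow>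
    (let I = (\<lambda>g. integral (cbox (a, c) (b, d)) (\<lambda>z. g z * pkernel bump bump x e t e z))
     in (k - C / n) * (e * e * (bump_mass * bump_mass))
       \<le> s * (- I Vt - 1/2 * \<sigma>\<^sup>2 * x\<^sup>2 * I Vxx - (r - q) * x * I Vx + r * I V))"
proof -
  let ?B = "cbox (a, c) (b, d)"
  obtain P where P: "P > 0" "\<And>y. \<bar>bump y\<bar> \<le> P"
    using bounded_of_compact_support[OF smooth_real_continuous[OF smooth_real_bump] bump_zero] by auto
  define A where "A = \<bar>s\<bar> * (\<sigma>\<^sup>2 * X + \<bar>r - q\<bar>)"
  have A: "A \<ge> 0" unfolding A_def using X by (intro mult_nonneg_nonneg add_nonneg_nonneg) auto
  define M where "M = integral ?B (\<lambda>z. \<bar>Vx z\<bar> powr 6) + integral ?B (\<lambda>z. \<bar>Vxx z\<bar> powr 6)"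
  have M: "M \<ge> 0" unfolding M_def using L6 by (intro add_nonneg_nonneg integral_nonneg) auto
  define m2 where "m2 = bump_mass * bump_mass"
  have m2: "m2 > 0" unfolding m2_def using bump_mass_pos by simp
  have ai: "V absolutely_integrable_on ?B" "Vx absolutely_integrable_on ?B"
      "Vxx absolutely_integrable_on ?B" "Vt absolutely_integrable_on ?B"
    using w D unfolding has_weak_partial_def
    by (auto intro!: locally_Lp_1_absolutely_integrable[of D])
  \<comment> \<open>The two summands come from the two terms of
    \<open>integral_mult_le_power6\<close> at level \<open>n\<close>, applied to \<open>Vx\<close>
    and \<open>Vxx\<close>. With \<open>e = 1 / n\<^sup>2\<close> they contribute
    \<open>e * n = 1 / n\<close> and \<open>1 / (n ^ 5 * e) = 1 / n ^ 3\<close>.\<close>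
  define C where "C = A * 2 + A * (P * P * M / m2)"
  show ?thesis
  proof (rule exI[of _ C], intro allI impI)
    fix n x t e :: real
    assume n: "n \<ge> 1" and e: "e = 1 / n\<^sup>2"
      and fits: "a \<le> x - e" "x + e \<le> b" "c \<le> t - e" "t + e \<le> d"
    have e0: "e > 0" using n e by simp
    define \<phi> where "\<phi> = (\<lambda>z::real \<times> real. bump ((fst z - x) / e) * bump ((snd z - t) / e))"
    define I where "I = (\<lambda>g. integral ?B (\<lambda>z. g z * \<phi> z))"
    have c\<phi>: "continuous_on ?B \<phi>" unfolding \<phi>_def
      using e0 by (intro continuous_intros smooth_real_continuous_compose[OF smooth_real_bump]) auto
    have I: "((\<lambda>z. g z * \<phi> z) has_integral I g) ?B" if "g absolutely_integrable_on ?B" for g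
      unfolding I_def using absolutely_integrable_mult_continuous[OF that c\<phi> compact_cbox]
      by (intro integrable_integral) (simp add: set_lebesgue_integral_eq_integral(1))
    have Iabs: "((\<lambda>z. \<bar>g z\<bar> * \<phi> z) has_integral I (\<lambda>z. \<bar>g z\<bar>)) ?B" if "g absolutely_integrable_on ?B" for g
      using I[of "\<lambda>z. \<bar>g z\<bar>"] absolutely_integrable_norm[OF that] by (simp add: comp_def)
    have \<phi>: "(\<phi> has_integral e * e * m2) ?B"
      using integrable_integral[OF integrable_continuous[OF c\<phi>]]
        integral_rescale_prod[OF smooth_real_continuous[OF smooth_real_bump] bump_zero
          smooth_real_continuous[OF smooth_real_bump] bump_zero e0 e0 fits]
      by (simp add: \<phi>_def m2_def)
    have \<phi>0: "0 \<le> \<phi> z" for z by (simp add: \<phi>_def bump_nonneg)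
    have \<phi>P: "\<phi> z \<le> P * P" for z
      unfolding \<phi>_def using P(2) bump_nonneg P(1) by (intro mult_mono) (auto intro: order_trans[OF abs_ge_self])
    have le: "(e * e * m2) * k - A * e * (I (\<lambda>z. \<bar>Vx z\<bar>) + I (\<lambda>z. \<bar>Vxx z\<bar>))
        \<le> s * (- I Vt - 1/2 * \<sigma>\<^sup>2 * x\<^sup>2 * I Vxx - (r - q) * x * I Vx + r * I V)"
    proof (rule has_integral_le_AE)
      show "((\<lambda>z. \<phi> z * k - A * e * (\<bar>Vx z\<bar> * \<phi> z + \<bar>Vxx z\<bar> * \<phi> z)) has_integral
          (e * e * m2) * k - A * e * (I (\<lambda>z. \<bar>Vx z\<bar>) + I (\<lambda>z. \<bar>Vxx z\<bar>))) ?B"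
        by (intro has_integral_diff has_integral_mult_left has_integral_mult_right has_integral_add Iabs ai \<phi>)
      show "((\<lambda>z. s * (- (Vt z * \<phi> z) - 1/2 * \<sigma>\<^sup>2 * x\<^sup>2 * (Vxx z * \<phi> z) - (r - q) * x * (Vx z * \<phi> z) + r * (V z * \<phi> z)))
          has_integral s * (- I Vt - 1/2 * \<sigma>\<^sup>2 * x\<^sup>2 * I Vxx - (r - q) * x * I Vx + r * I V)) ?B"
        by (intro has_integral_diff has_integral_mult_right has_integral_add has_integral_neg I ai)
      show "AE z in lebesgue. z \<in> ?B \<longrightarrow> \<phi> z * k - A * e * (\<bar>Vx z\<bar> * \<phi> z + \<bar>Vxx z\<bar> * \<phi> z) \<le>
          s * (- (Vt z * \<phi> z) - 1/2 * \<sigma>\<^sup>2 * x\<^sup>2 * (Vxx z * \<phi> z) - (r - q) * x * (Vx z * \<phi> z) + r * (V z * \<phi> z))"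
        using AE
      proof eventually_elim
        case (elim z)
        show ?case
        proof
          assume z: "z \<in> ?B"
          \<comment> \<open>Freezing the coefficients is legitimate only within distance
            \<open>e\<close> of \<open>x\<close>, that is, on the support of the kernel; elsewhere
            both sides are multiplied by 0.\<close>
          have "k - A * e * (\<bar>Vx z\<bar> + \<bar>Vxx z\<bar>)
            \<le> s * (- Vt z - 1/2 * \<sigma>\<^sup>2 * x\<^sup>2 * Vxx z - (r - q) * x * Vx z + r * V z)" if "\<phi> z \<noteq> 0"
          proof -
            have "\<bar>fst z - x\<bar> \<le> e"
              using that bump_zero[of "(fst z - x) / e"] e0 by (auto simp: \<phi>_def abs_le_iff field_simps)
            moreover have "\<bar>fst z\<bar> \<le> X" using z X by (cases z) auto
            moreover have "\<bar>x\<bar> \<le> X" using fits e0 X by auto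
            ultimately show ?thesis
              using frozen_coefficient_bound[of "fst z" x e X s "Vt z" \<sigma> "Vxx z" r q "Vx z" "V z"] elim z
              unfolding cb_operator_def A_def by linarith
          qed
          then have "\<phi> z * (k - A * e * (\<bar>Vx z\<bar> + \<bar>Vxx z\<bar>))
            \<le> \<phi> z * (s * (- Vt z - 1/2 * \<sigma>\<^sup>2 * x\<^sup>2 * Vxx z - (r - q) * x * Vx z + r * V z))"
            using \<phi>0[of z] by (cases "\<phi> z = 0") (auto intro: mult_left_mono)
          then show "\<phi> z * k - A * e * (\<bar>Vx z\<bar> * \<phi> z + \<bar>Vxx z\<bar> * \<phi> z) \<le>
            s * (- (Vt z * \<phi> z) - 1/2 * \<sigma>\<^sup>2 * x\<^sup>2 * (Vxx z * \<phi> z) - (r - q) * x * (Vx z * \<phi> z) + r * (V z * \<phi> z))"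
            by (simp add: algebra_simps)
        qed
      qed
    qed
    have bound: "I (\<lambda>z. \<bar>g z\<bar>) \<le> n * (e * e * m2) + P * P / n ^ 5 * integral ?B (\<lambda>z. \<bar>g z\<bar> powr 6)"
      if "g absolutely_integrable_on ?B" "(\<lambda>z. \<bar>g z\<bar> powr 6) integrable_on ?B" for g
      using integral_mult_le_power6[OF that c\<phi> \<phi>0 \<phi>P, of n] n integral_unique[OF \<phi>] by (simp add: I_def)
    have "I (\<lambda>z. \<bar>Vx z\<bar>) + I (\<lambda>z. \<bar>Vxx z\<bar>) \<le> 2 * n * (e * e * m2) + P * P / n ^ 5 * M"
      using bound[OF ai(2) L6(1)] bound[OF ai(3) L6(2)] by (simp add: M_def algebra_simps)
    then have "A * e * (I (\<lambda>z. \<bar>Vx z\<bar>) + I (\<lambda>z. \<bar>Vxx z\<bar>)) \<le> A * e * (2 * n * (e * e * m2) + P * P / n ^ 5 * M)"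
      using A e0 by (intro mult_left_mono) auto
    also have "\<dots> = (A * 2 * (e * n) + A * (P * P * M / m2) * (1 / (n ^ 5 * e))) * (e * e * m2)"
      using e0 m2 n by (simp add: field_simps)
    also have "\<dots> \<le> C / n * (e * e * m2)"
    proof (intro mult_right_mono)
      have e1: "e * n = 1 / n" using n e by (simp add: power2_eq_square)
      have "1 / (n ^ 5 * e) = 1 / n ^ 3" using n e by (simp add: power2_eq_square power3_eq_cube eval_nat_numeral)
      also have "\<dots> \<le> 1 / n" using n self_le_power[of n 3] by (intro divide_left_mono) auto
      finally have "1 / (n ^ 5 * e) \<le> 1 / n" .
      then have "A * (P * P * M / m2) * (1 / (n ^ 5 * e)) \<le> A * (P * P * M / m2) * (1 / n)"
        using A M m2 by (intro mult_left_mono) auto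
      then show "A * 2 * (e * n) + A * (P * P * M / m2) * (1 / (n ^ 5 * e)) \<le> C / n"
        unfolding e1 C_def by (simp add: add_divide_distrib)
      show "0 \<le> e * e * m2" using e0 m2 by simp
    qed
    finally have "(k - C / n) * (e * e * m2)
      \<le> (e * e * m2) * k - A * e * (I (\<lambda>z. \<bar>Vx z\<bar>) + I (\<lambda>z. \<bar>Vxx z\<bar>))"
      by (simp add: algebra_simps)
    also note le
    finally show "let I = (\<lambda>g. integral ?B (\<lambda>z. g z * pkernel bump bump x e t e z))
     in (k - C / n) * (e * e * (bump_mass * bump_mass))
       \<le> s * (- I Vt - 1/2 * \<sigma>\<^sup>2 * x\<^sup>2 * I Vxx - (r - q) * x * I Vx + r * I V)"
      unfolding Let_def I_def \<phi>_def m2_def .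
  qed
qed

lemma locally_Lp_integrable_power:
  assumes "locally_Lp D 6 g" "cbox u v \<subseteq> D"
  shows "(\<lambda>z. \<bar>g z\<bar> powr 6) integrable_on cbox u v"
  using assms compact_cbox unfolding locally_Lp_def
  by (blast intro: set_lebesgue_integral_eq_integral(1))

text \<open>The normalised mollifications of \<open>s * V\<close> are the approximants: uniform
  continuity controls the values and \<open>mollified_operator_bound\<close> the operator. The
  radius of the ball is fixed by the neighbourhood \<open>N\<close> before the accuracy is chosen,
  as \<open>supersol\<close> demands. A negative \<open>s\<close> is allowed, provided that the
  one-sided inequality for \<open>s * L V\<close> holds.\<close>

lemma weak_supersolution_imp_supersol:
  fixes V Vx Vxx Vt :: "real \<times> real \<Rightarrow> real"
  assumes D: "open D" and V: "continuous_on D V"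
    and w: "has_weak_partial D (1, 0) V Vx" "has_weak_partial D (1, 0) Vx Vxx" "has_weak_partial D (0, 1) V Vt"
    and L6: "locally_Lp D 6 Vx" "locally_Lp D 6 Vxx"
    and N: "open N" "N \<subseteq> D" "z0 \<in> N"
    and AE: "AE z in lebesgue. z \<in> N \<longrightarrow> k \<le> s * cb_operator \<sigma> r q V Vx Vxx Vt z"
  shows "supersol \<sigma> r q (\<lambda>z. s * V z) z0 k"
proof -
  obtain x0 t0 where z0: "z0 = (x0, t0)" by (cases z0)
  obtain R where R: "R > 0" "cbox (x0 - 2 * R, t0 - 2 * R) (x0 + 2 * R, t0 + 2 * R) \<subseteq> N"
    using open_contains_box[OF N(1)] N(3) z0 by blast
  \<comment> \<open>Half-width \<open>2 * R\<close>: centres within \<open>R\<close> of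
    \<open>z0\<close> and scales at most \<open>R\<close> keep the kernel inside the box.\<close>
  define a b c d where abcd: "a = x0 - 2 * R" "b = x0 + 2 * R" "c = t0 - 2 * R" "d = t0 + 2 * R"
  let ?B = "cbox (a, c) (b, d)"
  have BN: "?B \<subseteq> N" and BD: "?B \<subseteq> D" using R N by (auto simp: abcd)
  have cV: "continuous_on ?B V" using V BD continuous_on_subset by blast
  define m2 where "m2 = bump_mass * bump_mass"
  have m2: "m2 > 0" unfolding m2_def using bump_mass_pos by simp
  have ae: "AE z in lebesgue. z \<in> ?B \<longrightarrow> k \<le> s * cb_operator \<sigma> r q V Vx Vxx Vt z"
    using AE BN by (auto elim!: eventually_mono)
  have X: "\<bar>a\<bar> \<le> \<bar>x0\<bar> + 2 * R" "\<bar>b\<bar> \<le> \<bar>x0\<bar> + 2 * R" using R by (auto simp: abcd)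
  obtain C where C: "\<forall>n x t \<epsilon>. n \<ge> (1::real) \<longrightarrow> \<epsilon> = 1 / n\<^sup>2 \<longrightarrow> a \<le> x - \<epsilon> \<longrightarrow> x + \<epsilon> \<le> b \<longrightarrow>
      c \<le> t - \<epsilon> \<longrightarrow> t + \<epsilon> \<le> d \<longrightarrow>
    (let I = (\<lambda>g. integral ?B (\<lambda>z. g z * pkernel bump bump x \<epsilon> t \<epsilon> z))
     in (k - C / n) * (\<epsilon> * \<epsilon> * (bump_mass * bump_mass))
       \<le> s * (- I Vt - 1/2 * \<sigma>\<^sup>2 * x\<^sup>2 * I Vxx - (r - q) * x * I Vx + r * I V))"
    using mollified_operator_bound[OF D BD cV w locally_Lp_integrable_power[OF L6(1) BD]
        locally_Lp_integrable_power[OF L6(2) BD] X ae] by (elim exE) (rule that)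
  show ?thesis
    unfolding supersol_def
  proof (intro exI[of _ R] conjI allI impI R(1))
    fix e :: real assume e: "e > 0"
    \<comment> \<open>Gives \<open>\<bar>s\<bar> * \<omega> < e\<close> with no case distinction for
      \<open>s = 0\<close>.\<close>
    define \<omega> where "\<omega> = e / (2 * (\<bar>s\<bar> + 1))"
    have \<omega>: "\<omega> > 0" using e by (simp add: \<omega>_def)
    obtain \<eta> where \<eta>: "\<eta> > 0" "\<forall>z\<in>?B. \<forall>z'\<in>?B. dist z' z < \<eta> \<longrightarrow> dist (V z') (V z) < \<omega>"
      using compact_uniformly_continuous[OF cV compact_cbox] \<omega> unfolding uniformly_continuous_on_def by blast
    \<comment> \<open>The entries make the kernel fit into the box, push the operator error
      \<open>C / n\<close> below \<open>e\<close>, and bring the support of the kernel below the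
      modulus of continuity \<eta>.\<close>
    define n where "n = max 1 (max (1 / R) (max (\<bar>C\<bar> / e + 1) (2 / \<eta> + 1)))"
    have n: "n \<ge> 1" "n \<ge> 1 / R" "n > C / e" "n > 2 / \<eta>"
    proof -
      have "C / e \<le> \<bar>C\<bar> / e" using e by (intro divide_right_mono) auto
      then show "n > C / e" by (simp add: n_def)
    qed (simp_all add: n_def)
    define \<epsilon> where "\<epsilon> = 1 / n\<^sup>2"
    have \<epsilon>n: "\<epsilon> \<le> 1 / n" unfolding \<epsilon>_def using n(1) self_le_power[of n 2] by (intro divide_left_mono) auto
    have \<epsilon>0: "\<epsilon> > 0" using n(1) by (simp add: \<epsilon>_def)
    have "1 / n \<le> R" using n(1,2) R(1) by (simp add: field_simps)
    then have \<epsilon>R: "\<epsilon> \<le> R" using \<epsilon>n by linarith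
    have "2 * (1 / n) < \<eta>" using n(1,4) \<eta>(1) by (simp add: field_simps)
    then have \<epsilon>\<eta>: "2 * \<epsilon> < \<eta>" using \<epsilon>n by linarith
    have Cn: "C / n < e" using n(1,3) e by (simp add: field_simps)
    define J where "J = (\<lambda>f h p. integral ?B (\<lambda>z. V z * pkernel f h (fst p) \<epsilon> (snd p) \<epsilon> z))"
    define cc where "cc = s * (1 / (\<epsilon> * \<epsilon> * m2))"
    define W where "W = (\<lambda>p. cc * J bump bump p)"
    define Wx where "Wx = (\<lambda>p. cc * (J (deriv bump) bump p * (- 1 / \<epsilon>)))"
    define Wxx where "Wxx = (\<lambda>p. cc * (J (deriv (deriv bump)) bump p * (1 / \<epsilon>\<^sup>2)))"
    define Wt where "Wt = (\<lambda>p. cc * (J bump (deriv bump) p * (- 1 / \<epsilon>)))"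
    have Jx: "((\<lambda>x. J f h (x, t)) has_real_derivative J (deriv f) h (x, t) * (- 1 / \<epsilon>)) (at x)"
      if "smooth_real f" "smooth_real h" for f h x t
      using mollify_has_derivative_x[OF cV \<epsilon>0 \<epsilon>0 that] by (simp add: J_def)
    have Jt: "((\<lambda>t. J f h (x, t)) has_real_derivative J f (deriv h) (x, t) * (- 1 / \<epsilon>)) (at t)"
      if "smooth_real f" "smooth_real h" for f h x t
      using mollify_has_derivative_t[OF cV \<epsilon>0 \<epsilon>0 that] by (simp add: J_def)
    note sb = smooth_real_bump
    have "classical_on (cball z0 R) W Wx Wxx Wt"
      unfolding classical_on_def
    proof (intro conjI ballI)
      have "continuous_on UNIV (J bump bump)"
        using mollify_continuous[OF cV \<epsilon>0 \<epsilon>0 sb sb] by (simp add: J_def)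
      then show "continuous_on (cball z0 R) W"
        unfolding W_def by (intro continuous_intros) (auto intro: continuous_on_subset)
      fix z :: "real \<times> real"
      obtain x t where z: "z = (x, t)" by (cases z)
      show "((\<lambda>x. W (x, snd z)) has_real_derivative Wx z) (at (fst z))"
        unfolding W_def Wx_def z using DERIV_cmult[OF Jx[OF sb sb]] by simp
      show "((\<lambda>t. W (fst z, t)) has_real_derivative Wt z) (at (snd z))"
        unfolding W_def Wt_def z using DERIV_cmult[OF Jt[OF sb sb]] by simp
      have "((\<lambda>x. cc * (J (deriv bump) bump (x, t) * (- 1 / \<epsilon>))) has_real_derivative
          cc * (J (deriv (deriv bump)) bump (x, t) * (- 1 / \<epsilon>) * (- 1 / \<epsilon>))) (at x)"
        by (intro DERIV_cmult DERIV_cmult_right Jx smooth_real_deriv(1) sb)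
      then show "((\<lambda>x. Wx (x, snd z)) has_real_derivative Wxx z) (at (fst z))"
        unfolding Wx_def Wxx_def z by (simp add: power2_eq_square)
    qed
    moreover have "\<bar>W p - s * V p\<bar> < e \<and> cb_operator \<sigma> r q W Wx Wxx Wt p \<ge> k - e" if "p \<in> cball z0 R" for p
    proof -
      obtain x t where p: "p = (x, t)" by (cases p)
      have "\<bar>x - x0\<bar> \<le> R" "\<bar>t - t0\<bar> \<le> R"
        using that abs_fst_diff_le_dist[of p z0] abs_snd_diff_le_dist[of p z0] by (auto simp: p z0)
      then have fits: "a \<le> x - \<epsilon>" "x + \<epsilon> \<le> b" "c \<le> t - \<epsilon>" "t + \<epsilon> \<le> d"
        using \<epsilon>R by (auto simp: abcd)
      then have pB: "p \<in> ?B" using \<epsilon>0 by (simp add: p cbox_Pair_eq)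
      have "\<bar>V z - V p\<bar> \<le> \<omega>" if "z \<in> ?B" "\<bar>fst z - x\<bar> \<le> \<epsilon>" "\<bar>snd z - t\<bar> \<le> \<epsilon>" for z
      proof -
        have "dist z p < \<eta>"
          using dist_Pair_le[of "fst z" "snd z" x t] that \<epsilon>\<eta> by (simp add: p)
        then have "dist (V z) (V p) < \<omega>" using \<eta>(2) pB that(1) by blast
        then show ?thesis by (simp add: dist_real_def)
      qed
      from mollify_close[OF cV \<epsilon>0 \<epsilon>0 fits this]
      have cl: "\<bar>J bump bump p - V p * (\<epsilon> * \<epsilon> * m2)\<bar> \<le> \<omega> * (\<epsilon> * \<epsilon> * m2)"
        by (simp add: J_def p m2_def)
      have E: "\<epsilon> * \<epsilon> * m2 > 0" using \<epsilon>0 m2 by simp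
      have "W p - s * V p = s * ((J bump bump p - V p * (\<epsilon> * \<epsilon> * m2)) / (\<epsilon> * \<epsilon> * m2))"
        using m2 \<epsilon>0 by (simp add: W_def cc_def diff_divide_distrib right_diff_distrib)
      then have "\<bar>W p - s * V p\<bar> = \<bar>s\<bar> * (\<bar>J bump bump p - V p * (\<epsilon> * \<epsilon> * m2)\<bar> / (\<epsilon> * \<epsilon> * m2))"
        using m2 \<epsilon>0 by (simp add: abs_mult)
      also have "\<dots> \<le> \<bar>s\<bar> * \<omega>"
        using cl E by (intro mult_left_mono) (simp_all add: pos_divide_le_eq)
      also have "\<dots> < e" proof -
        have "(\<bar>s\<bar> + 1) * \<omega> = e / 2" by (simp add: \<omega>_def field_simps)
        then show ?thesis using e \<omega> by (simp add: distrib_right)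
      qed
      finally have 1: "\<bar>W p - s * V p\<bar> < e" .
      define I where "I = (\<lambda>g. integral ?B (\<lambda>z. g z * pkernel bump bump x \<epsilon> t \<epsilon> z))"
      have W: "W p = cc * I V" by (simp add: W_def J_def I_def p)
      have Wx: "Wx p = cc * I Vx"
        unfolding Wx_def J_def p fst_conv snd_conv I_def
        by (subst mollify_weak_x[OF D BD sb sb _ _ \<epsilon>0 \<epsilon>0 fits w(1)]) (auto intro: bump_zero)
      have Wxx: "Wxx p = cc * I Vxx"
        unfolding Wxx_def J_def p fst_conv snd_conv I_def
        by (subst mollify_weak_xx[OF D BD sb sb _ _ \<epsilon>0 \<epsilon>0 fits w(1,2)]) (auto intro: bump_zero)
      have Wt: "Wt p = cc * I Vt"
        unfolding Wt_def J_def p fst_conv snd_conv I_def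
        by (subst mollify_weak_t[OF D BD sb sb _ _ \<epsilon>0 \<epsilon>0 fits w(3)]) (auto intro: bump_zero)
      have "cb_operator \<sigma> r q W Wx Wxx Wt p
          = s * (- I Vt - 1/2 * \<sigma>\<^sup>2 * x\<^sup>2 * I Vxx - (r - q) * x * I Vx + r * I V) / (\<epsilon> * \<epsilon> * m2)"
        unfolding cb_operator_def W Wx Wxx Wt unfolding cc_def p fst_conv
        by (simp add: algebra_simps add_divide_distrib diff_divide_distrib)
      moreover have "(k - C / n) * (\<epsilon> * \<epsilon> * m2)
          \<le> s * (- I Vt - 1/2 * \<sigma>\<^sup>2 * x\<^sup>2 * I Vxx - (r - q) * x * I Vx + r * I V)"
        using C[rule_format, OF n(1) \<epsilon>_def fits] unfolding Let_def I_def m2_def .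
      ultimately have "k - C / n \<le> cb_operator \<sigma> r q W Wx Wxx Wt p"
        using E by (simp add: pos_le_divide_eq)
      then show ?thesis using 1 Cn by simp
    qed
    ultimately show "supersol_approx \<sigma> r q (\<lambda>z. s * V z) z0 k R e" by blast
  qed
qed

section \<open>Parabolic means\<close>

text \<open>The absolute kernel has mass of order \<open>s ^ 3\<close>. The level
  \<open>1 / sqrt s\<close> in \<open>integral_mult_le_power6\<close> makes both terms of order
  \<open>s\<^sup>2 * sqrt s\<close>.\<close>

lemma parabolic_kernel_integral_bound:
  fixes g :: "real \<times> real \<Rightarrow> real"
  assumes sm: "smooth_real f" "smooth_real h"
    and supp: "\<And>y. y \<notin> {-1..1} \<Longrightarrow> f y = 0" "\<And>y. y \<notin> {-1..1} \<Longrightarrow> h y = 0"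
    and g: "g absolutely_integrable_on cbox (a, c) (b, d)" "(\<lambda>z. \<bar>g z\<bar> powr 6) integrable_on cbox (a, c) (b, d)"
  shows "\<exists>C. \<forall>s>0. a \<le> x - s \<longrightarrow> x + s \<le> b \<longrightarrow> c \<le> t - s\<^sup>2 \<longrightarrow> t + s\<^sup>2 \<le> d \<longrightarrow>
    \<bar>integral (cbox (a, c) (b, d)) (\<lambda>z. g z * pkernel f h x s t (s\<^sup>2) z)\<bar> \<le> C * (s\<^sup>2 * sqrt s)"
proof -
  let ?B = "cbox (a, c) (b, d)"
  note cf = smooth_real_continuous[OF sm(1)] and ch = smooth_real_continuous[OF sm(2)]
  obtain P where P: "P > 0" "\<And>y. \<bar>f y\<bar> \<le> P" using bounded_of_compact_support[OF cf supp(1)] by auto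
  obtain Q where Q: "Q > 0" "\<And>y. \<bar>h y\<bar> \<le> Q" using bounded_of_compact_support[OF ch supp(2)] by auto
  define F where "F = integral {-1..1} (\<lambda>y. \<bar>f y\<bar>) * integral {-1..1} (\<lambda>y. \<bar>h y\<bar>)"
  define M where "M = integral ?B (\<lambda>z. \<bar>g z\<bar> powr 6)"
  show ?thesis
  proof (intro exI[of _ "F + P * Q * M"] allI impI)
    fix s :: real
    assume s: "s > 0" and fits: "a \<le> x - s" "x + s \<le> b" "c \<le> t - s\<^sup>2" "t + s\<^sup>2 \<le> d"
    define \<phi> where "\<phi> = (\<lambda>z::real \<times> real. f ((fst z - x) / s) * h ((snd z - t) / s\<^sup>2))"
    have c\<phi>: "continuous_on ?B \<phi>" unfolding \<phi>_def
      using s by (intro continuous_intros smooth_real_continuous_compose[OF sm(1)]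
          smooth_real_continuous_compose[OF sm(2)]) auto
    have ca: "continuous_on ?B (\<lambda>z. \<bar>\<phi> z\<bar>)" using c\<phi> by (intro continuous_intros)
    have i1: "(\<lambda>z. g z * \<phi> z) integrable_on ?B"
      using absolutely_integrable_mult_continuous[OF g(1) c\<phi> compact_cbox]
      by (simp add: set_lebesgue_integral_eq_integral(1))
    have i2: "(\<lambda>z. \<bar>g z\<bar> * \<bar>\<phi> z\<bar>) integrable_on ?B"
      using absolutely_integrable_mult_continuous[OF absolutely_integrable_norm[OF g(1)] ca compact_cbox]
      by (simp add: comp_def set_lebesgue_integral_eq_integral(1))
    have "\<bar>integral ?B (\<lambda>z. g z * \<phi> z)\<bar> \<le> integral ?B (\<lambda>z. \<bar>g z\<bar> * \<bar>\<phi> z\<bar>)"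
      using integral_norm_bound_integral[OF i1 i2] by (simp add: abs_mult)
    also have "\<dots> \<le> 1 / sqrt s * integral ?B (\<lambda>z. \<bar>\<phi> z\<bar>) + P * Q / (1 / sqrt s) ^ 5 * M"
      unfolding M_def
    proof (rule integral_mult_le_power6[OF g ca])
      show "\<bar>\<phi> z\<bar> \<le> P * Q" for z
        unfolding \<phi>_def abs_mult using P Q by (intro mult_mono) auto
    qed (use s in auto)
    also have "integral ?B (\<lambda>z. \<bar>\<phi> z\<bar>) = s * s\<^sup>2 * F"
    proof -
      have "continuous_on UNIV (\<lambda>y. \<bar>f y\<bar>)" "continuous_on UNIV (\<lambda>y. \<bar>h y\<bar>)"
        using cf ch by (auto intro: continuous_intros)
      from integral_rescale_prod[OF this(1) _ this(2) _ s _ fits]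
      show ?thesis using supp s by (simp add: \<phi>_def F_def abs_mult)
    qed
    also have "1 / sqrt s * (s * s\<^sup>2 * F) + P * Q / (1 / sqrt s) ^ 5 * M = (F + P * Q * M) * (s\<^sup>2 * sqrt s)"
    proof -
      have "1 / sqrt s * s = sqrt s" using s by (simp add: real_div_sqrt)
      moreover have "1 / (1 / sqrt s) ^ 5 = s\<^sup>2 * sqrt s"
      proof -
        have "sqrt s ^ 5 = (sqrt s * sqrt s)\<^sup>2 * sqrt s"
          by algebra
        then show ?thesis using s by (simp add: power_divide)
      qed
      moreover have "1 / sqrt s * (s * s\<^sup>2 * F) = (1 / sqrt s * s) * (s\<^sup>2 * F)" by simp
      moreover have "P * Q / (1 / sqrt s) ^ 5 * M = (1 / (1 / sqrt s) ^ 5) * (P * Q * M)" by simp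
      ultimately show ?thesis
        by (simp only:) (simp add: algebra_simps)
    qed
    finally show "\<bar>integral ?B (\<lambda>z. g z * pkernel f h x s t (s\<^sup>2) z)\<bar>
      \<le> (F + P * Q * M) * (s\<^sup>2 * sqrt s)" by (simp add: \<phi>_def)
  qed
qed

text \<open>The normalised mean \<open>G s\<close> tends to a multiple of \<open>V (x, t)\<close> as
  the scale shrinks. Its derivative in the scale can be written with \<open>Vxx\<close> and
  \<open>Vt\<close> alone and is bounded by a multiple of \<open>sqrt s\<close>, so
  \<open>G s\<close> is within order \<open>s * sqrt s\<close> of its limit. The first derivative in
  space does not enter, since the kernel is even and its scale derivative is a second derivative in
  \<open>x\<close> plus a first derivative in \<open>t\<close>.\<close>

lemma parabolic_mean_estimate:
  fixes V Vx Vxx Vt :: "real \<times> real \<Rightarrow> real"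
  assumes D: "open D" "cbox (a, c) (b, d) \<subseteq> D" and V: "continuous_on (cbox (a, c) (b, d)) V"
    and w: "has_weak_partial D (1, 0) V Vx" "has_weak_partial D (1, 0) Vx Vxx" "has_weak_partial D (0, 1) V Vt"
    and L6: "locally_Lp D 6 Vxx" "locally_Lp D 6 Vt"
    and s1: "a \<le> x - s1" "x + s1 \<le> b" "c \<le> t - s1\<^sup>2" "t + s1\<^sup>2 \<le> d"
  shows "\<exists>C. \<forall>s>0. s \<le> s1 \<longrightarrow>
    \<bar>integral (cbox (a, c) (b, d)) (\<lambda>z. V z * pkernel bump bump x s t (s\<^sup>2) z)
      - V (x, t) * (s ^ 3 * (bump_mass * bump_mass))\<bar> \<le> C * sqrt s * s ^ 4"
proof -
  let ?B = "cbox (a, c) (b, d)"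
  define m2 where "m2 = bump_mass * bump_mass"
  have m2: "m2 > 0" unfolding m2_def using bump_mass_pos by simp
  note sb = smooth_real_bump and sp = smooth_real_bump_prim
  have sdp: "smooth_real (deriv bump_prim)" using smooth_real_deriv(1)[OF sp] .
  have dp0: "deriv bump_prim y = 0" if "y \<notin> {-1..1}" for y
    using bump_zero[OF that] by (simp add: deriv_bump_prim)
  have ddp: "deriv (deriv bump_prim) y = bump y + y * deriv bump y" for y
    unfolding deriv_bump_prim
    by (rule DERIV_imp_deriv) (auto intro!: derivative_eq_intros smooth_real_deriv(2)[OF sb])
  have ai: "Vxx absolutely_integrable_on ?B" "Vt absolutely_integrable_on ?B"
    using w D unfolding has_weak_partial_def
    by (auto intro!: locally_Lp_1_absolutely_integrable[of D])
  define J where "J = (\<lambda>(g :: real \<times> real \<Rightarrow> real) f h s. integral ?B (\<lambda>z. g z * pkernel f h x s t (s\<^sup>2) z))"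
  have fits: "a \<le> x - s" "x + s \<le> b" "c \<le> t - s\<^sup>2" "t + s\<^sup>2 \<le> d" if "s > 0" "s \<le> s1" for s
  proof -
    have "s\<^sup>2 \<le> s1\<^sup>2" using that by (intro power_mono) auto
    then show "a \<le> x - s" "x + s \<le> b" "c \<le> t - s\<^sup>2" "t + s\<^sup>2 \<le> d"
      using s1 that by linarith+
  qed
  have "\<exists>C1. \<forall>s>0. a \<le> x - s \<longrightarrow> x + s \<le> b \<longrightarrow> c \<le> t - s\<^sup>2 \<longrightarrow> t + s\<^sup>2 \<le> d \<longrightarrow>
      \<bar>J Vxx bump_prim bump s\<bar> \<le> C1 * (s\<^sup>2 * sqrt s)"
    unfolding J_def by (rule parabolic_kernel_integral_bound[OF sp sb _ _ ai(1)
        locally_Lp_integrable_power[OF L6(1) D(2)]]) (auto intro: bump_prim_zero bump_zero)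
  then obtain C1 where C1: "\<forall>s>0. a \<le> x - s \<longrightarrow> x + s \<le> b \<longrightarrow> c \<le> t - s\<^sup>2 \<longrightarrow> t + s\<^sup>2 \<le> d \<longrightarrow>
      \<bar>J Vxx bump_prim bump s\<bar> \<le> C1 * (s\<^sup>2 * sqrt s)"
    by (elim exE) (rule that)
  have "\<exists>C2. \<forall>s>0. a \<le> x - s \<longrightarrow> x + s \<le> b \<longrightarrow> c \<le> t - s\<^sup>2 \<longrightarrow> t + s\<^sup>2 \<le> d \<longrightarrow>
      \<bar>J Vt bump (deriv bump_prim) s\<bar> \<le> C2 * (s\<^sup>2 * sqrt s)"
    unfolding J_def by (rule parabolic_kernel_integral_bound[OF sb sdp _ _ ai(2)
        locally_Lp_integrable_power[OF L6(2) D(2)]]) (auto intro: bump_zero dp0)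
  then obtain C2 where C2: "\<forall>s>0. a \<le> x - s \<longrightarrow> x + s \<le> b \<longrightarrow> c \<le> t - s\<^sup>2 \<longrightarrow> t + s\<^sup>2 \<le> d \<longrightarrow>
      \<bar>J Vt bump (deriv bump_prim) s\<bar> \<le> C2 * (s\<^sup>2 * sqrt s)"
    by (elim exE) (rule that)
  define G where "G = (\<lambda>s. integral ?B (\<lambda>z. V z * (1 / s ^ 3 * pkernel bump bump x s t (s\<^sup>2) z)))"
  have GJ: "G s = J V bump bump s / s ^ 3" if "s > 0" for s
  proof -
    have "G s = integral ?B (\<lambda>z. (V z * pkernel bump bump x s t (s\<^sup>2) z) * (1 / s ^ 3))"
      unfolding G_def by (rule arg_cong[where f="integral ?B"]) (auto simp: fun_eq_iff)
    then show ?thesis unfolding J_def integral_mult_left by simp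
  qed
  define G' where "G' = (\<lambda>s. - (1 / s\<^sup>2) * (J Vxx bump_prim bump s - 2 * J Vt bump (deriv bump_prim) s))"
  \<comment> \<open>The scale derivative of the normalised kernel. The factor 3 from
    \<open>1 / s ^ 3\<close> splits as 1 for space and 2 for time, and each share joins the matching
    chain rule term to form \<open>bump y + y * deriv bump y\<close>, the second derivative of
    \<open>bump_prim\<close>.\<close>
  let ?k = "\<lambda>s z. - (1 / s ^ 4) * (deriv (deriv bump_prim) ((fst z - x) / s) * bump ((snd z - t) / s\<^sup>2)
      + 2 * pkernel bump (deriv (deriv bump_prim)) x s t (s\<^sup>2) z)"
  have c1: "continuous_on (S \<times> ?B) (\<lambda>p. f ((fst (snd p) - x) / fst p))"
    and c2: "continuous_on (S \<times> ?B) (\<lambda>p. f ((snd (snd p) - t) / (fst p)\<^sup>2))"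
    if "smooth_real f" "S \<subseteq> {0<..}" for f S
    using that by (auto intro!: continuous_intros smooth_real_continuous_compose[OF that(1)])
  have c1': "continuous_on ?B (\<lambda>z. f ((fst z - x) / s))"
    and c2': "continuous_on ?B (\<lambda>z. f ((snd z - t) / s\<^sup>2))"
    if "smooth_real f" "s > 0" for f s
    using that by (auto intro!: continuous_intros smooth_real_continuous_compose[OF that(1)])
  have der: "(G has_real_derivative G' s) (at s)" if s: "s > 0" "s \<le> s1" for s
  proof -
    have "(G has_real_derivative integral ?B (\<lambda>z. V z * ?k s z)) (at s)"
      unfolding G_def
    proof (rule leibniz_weighted[OF V, where U="{0<..}"])
      fix \<eta> :: real and z assume \<eta>: "\<eta> \<in> {0<..}"
      define u v where "u = fst z - x" and "v = snd z - t"
      have "((\<lambda>s. 1 / s ^ 3 * (bump (u / s) * bump (v / s\<^sup>2))) has_real_derivative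
          - (3 / \<eta> ^ 4) * (bump (u / \<eta>) * bump (v / \<eta>\<^sup>2))
          + 1 / \<eta> ^ 3 * (deriv bump (u / \<eta>) * (- u / \<eta>\<^sup>2) * bump (v / \<eta>\<^sup>2)
            + bump (u / \<eta>) * (deriv bump (v / \<eta>\<^sup>2) * (- 2 * v / \<eta> ^ 3)))) (at \<eta>)"
      proof -
        have d1: "((\<lambda>s. 1 / s ^ 3) has_real_derivative - (3 / \<eta> ^ 4)) (at \<eta>)"
          using \<eta> by (auto intro!: derivative_eq_intros simp: field_simps eval_nat_numeral)
        have d2: "((\<lambda>s. bump (u / s)) has_real_derivative deriv bump (u / \<eta>) * (- u / \<eta>\<^sup>2)) (at \<eta>)"
          by (rule DERIV_chain2[OF smooth_real_deriv(2)[OF sb]])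
            (use \<eta> in \<open>auto intro!: derivative_eq_intros simp: field_simps eval_nat_numeral\<close>)
        have d3: "((\<lambda>s. bump (v / s\<^sup>2)) has_real_derivative deriv bump (v / \<eta>\<^sup>2) * (- 2 * v / \<eta> ^ 3)) (at \<eta>)"
          by (rule DERIV_chain2[OF smooth_real_deriv(2)[OF sb]])
            (use \<eta> in \<open>auto intro!: derivative_eq_intros simp: field_simps eval_nat_numeral\<close>)
        show ?thesis
          using DERIV_mult[OF d1 DERIV_mult[OF d2 d3]] by (simp add: algebra_simps)
      qed
      moreover have "- (3 / \<eta> ^ 4) * (bump (u / \<eta>) * bump (v / \<eta>\<^sup>2))
          + 1 / \<eta> ^ 3 * (deriv bump (u / \<eta>) * (- u / \<eta>\<^sup>2) * bump (v / \<eta>\<^sup>2)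
            + bump (u / \<eta>) * (deriv bump (v / \<eta>\<^sup>2) * (- 2 * v / \<eta> ^ 3)))
        = - (1 / \<eta> ^ 4) * (deriv (deriv bump_prim) (u / \<eta>) * bump (v / \<eta>\<^sup>2)
          + 2 * (bump (u / \<eta>) * deriv (deriv bump_prim) (v / \<eta>\<^sup>2)))"
      proof -
        have "1 / \<eta> ^ 3 * (- u / \<eta>\<^sup>2) = - (1 / \<eta> ^ 4) * (u / \<eta>)"
          "1 / \<eta> ^ 3 * (- 2 * v / \<eta> ^ 3) = - (1 / \<eta> ^ 4) * (2 * (v / \<eta>\<^sup>2))"
          using \<eta> by (simp_all add: field_simps eval_nat_numeral)
        then have "1 / \<eta> ^ 3 * (A * (- u / \<eta>\<^sup>2) * B) = - (1 / \<eta> ^ 4) * (u / \<eta>) * A * B"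
          "1 / \<eta> ^ 3 * (A * (B * (- 2 * v / \<eta> ^ 3))) = - (1 / \<eta> ^ 4) * (2 * (v / \<eta>\<^sup>2)) * A * B" for A B
          by (metis mult.assoc mult.commute)+
        then show ?thesis
          unfolding ddp distrib_left[of "1 / \<eta> ^ 3"] by (simp only:) (simp add: algebra_simps)
      qed
      ultimately show "((\<lambda>s. 1 / s ^ 3 * pkernel bump bump x s t (s\<^sup>2) z) has_real_derivative ?k \<eta> z) (at \<eta>)"
        by (simp add: u_def v_def)
    next
      fix \<eta> :: real assume \<eta>: "\<eta> \<in> {0<..}"
      show "continuous_on ?B (\<lambda>z. 1 / \<eta> ^ 3 * pkernel bump bump x \<eta> t (\<eta>\<^sup>2) z)"
        using \<eta> by (intro continuous_intros c1' c2' sb) auto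
    next
      show "continuous_on ({0<..} \<times> ?B) (\<lambda>p. ?k (fst p) (snd p))"
        by (intro continuous_intros c1 c2 sb smooth_real_deriv(1)[OF sdp]) auto
    qed (use s in auto)
    moreover have "integral ?B (\<lambda>z. V z * ?k s z) = G' s"
    proof -
      have i: "(\<lambda>z. V z * pkernel f h x s t (s\<^sup>2) z) integrable_on ?B"
        if "smooth_real f" "smooth_real h" for f h
        using s that by (intro integrable_continuous continuous_intros V c1' c2') auto
      have "integral ?B (\<lambda>z. V z * ?k s z) = integral ?B (\<lambda>z. - (1 / s ^ 4) *
          (V z * pkernel (deriv (deriv bump_prim)) bump x s t (s\<^sup>2) z
          + 2 * (V z * pkernel bump (deriv (deriv bump_prim)) x s t (s\<^sup>2) z)))"
        by (rule arg_cong[where f="integral ?B"]) (auto simp: fun_eq_iff algebra_simps)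
      also have "\<dots> = - (1 / s ^ 4) * (J V (deriv (deriv bump_prim)) bump s + 2 * J V bump (deriv (deriv bump_prim)) s)"
        unfolding J_def integral_mult_right
        by (subst integral_add) (auto intro!: i integrable_on_mult_right sb smooth_real_deriv(1)[OF sdp])
      \<comment> \<open>Both derivatives are moved onto \<open>V\<close> in space, but only one in
        time, where the factor \<open>deriv bump_prim\<close> remains. Either way a factor
        \<open>s\<^sup>2\<close> is gained, because the time scale is
        \<open>s\<^sup>2\<close>.\<close>
      also have "J V (deriv (deriv bump_prim)) bump s = s\<^sup>2 * J Vxx bump_prim bump s"
        using mollify_weak_xx[OF D sp sb bump_prim_zero bump_zero _ _ fits[OF s] w(1,2)] s
        by (simp add: J_def field_simps)
      also have "J V bump (deriv (deriv bump_prim)) s = - s\<^sup>2 * J Vt bump (deriv bump_prim) s"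
        using mollify_weak_t[OF D sb sdp bump_zero dp0 _ _ fits[OF s] w(3)] s
        by (simp add: J_def field_simps)
      also have "- (1 / s ^ 4) * (s\<^sup>2 * J Vxx bump_prim bump s + 2 * (- s\<^sup>2 * J Vt bump (deriv bump_prim) s)) = G' s"
        using s by (simp add: G'_def field_simps eval_nat_numeral)
      finally show ?thesis .
    qed
    ultimately show ?thesis by simp
  qed
  define C where "C = \<bar>C1\<bar> + 2 * \<bar>C2\<bar>"
  have G': "\<bar>G' s\<bar> \<le> C * sqrt s" if s: "s > 0" "s \<le> s1" for s
  proof -
    have nn: "s\<^sup>2 * sqrt s \<ge> 0" using s by simp
    have "\<bar>J Vxx bump_prim bump s\<bar> \<le> C1 * (s\<^sup>2 * sqrt s)" "\<bar>J Vt bump (deriv bump_prim) s\<bar> \<le> C2 * (s\<^sup>2 * sqrt s)"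
      using C1 C2 fits[OF s] s by blast+
    moreover have "C1 * (s\<^sup>2 * sqrt s) \<le> \<bar>C1\<bar> * (s\<^sup>2 * sqrt s)" "C2 * (s\<^sup>2 * sqrt s) \<le> \<bar>C2\<bar> * (s\<^sup>2 * sqrt s)"
      using nn by (auto intro: mult_right_mono)
    ultimately have "\<bar>J Vxx bump_prim bump s - 2 * J Vt bump (deriv bump_prim) s\<bar> \<le> C * (s\<^sup>2 * sqrt s)"
      unfolding C_def by (simp add: distrib_right)
    then have "\<bar>J Vxx bump_prim bump s - 2 * J Vt bump (deriv bump_prim) s\<bar> / s\<^sup>2 \<le> C * sqrt s"
      using s by (simp add: pos_divide_le_eq mult_ac)
    then show ?thesis by (simp add: G'_def abs_mult)
  qed
  have lim: "\<exists>s0>0. \<forall>s>0. s \<le> s0 \<longrightarrow> s \<le> s1 \<longrightarrow> \<bar>G s - V (x, t) * m2\<bar> \<le> \<omega>"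
    if "\<omega> > 0" and s1: "s1 > 0" for \<omega>
  proof -
    have p: "(x, t) \<in> ?B" using fits[OF s1] s1 by (simp add: cbox_Pair_eq) (smt (verit) zero_le_power2)
    then obtain \<eta> where \<eta>: "\<eta> > 0" "\<forall>z\<in>?B. dist z (x, t) < \<eta> \<longrightarrow> dist (V z) (V (x, t)) < \<omega> / m2"
      using V \<open>\<omega> > 0\<close> m2 unfolding continuous_on_iff by (metis divide_pos_pos)
    define s0 where "s0 = min 1 (\<eta> / 3)"
    show ?thesis
    proof (intro exI[of _ s0] conjI allI impI)
      show "s0 > 0" using \<eta> by (simp add: s0_def)
      fix s :: real assume s: "s > 0" "s \<le> s0" "s \<le> s1"
      have sq: "s\<^sup>2 \<le> s" using s power_le_one_iff[of s 1] by (simp add: s0_def power2_eq_square mult_left_le)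
      have "\<bar>V z - V (x, t)\<bar> \<le> \<omega> / m2" if z: "z \<in> ?B" "\<bar>fst z - x\<bar> \<le> s" "\<bar>snd z - t\<bar> \<le> s\<^sup>2" for z
      proof -
        have "dist z (x, t) \<le> 2 * s"
          using dist_Pair_le[of "fst z" "snd z" x t] z sq by simp
        also have "\<dots> < \<eta>" using s \<eta>(1) by (simp add: s0_def)
        finally show ?thesis using \<eta>(2) z(1) by (auto simp: dist_real_def intro: less_imp_le)
      qed
      from mollify_close[OF V _ _ fits[OF s(1,3)] this]
      have "\<bar>J V bump bump s - V (x, t) * (s * s\<^sup>2 * m2)\<bar> \<le> \<omega> / m2 * (s * s\<^sup>2 * m2)"
        using s(1) by (simp add: J_def m2_def)
      then have "\<bar>J V bump bump s - V (x, t) * m2 * s ^ 3\<bar> \<le> \<omega> * s ^ 3"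
        using m2 by (simp add: power2_eq_square power3_eq_cube mult_ac)
      then have "\<bar>J V bump bump s - V (x, t) * m2 * s ^ 3\<bar> / s ^ 3 \<le> \<omega>"
        using s(1) by (simp add: pos_divide_le_eq)
      moreover have "\<bar>G s - V (x, t) * m2\<bar> = \<bar>J V bump bump s - V (x, t) * m2 * s ^ 3\<bar> / s ^ 3"
      proof -
        have "G s - V (x, t) * m2 = (J V bump bump s - V (x, t) * m2 * s ^ 3) / s ^ 3"
          using s(1) by (simp add: GJ diff_divide_distrib)
        then show ?thesis using s(1) by (simp add: abs_divide)
      qed
      ultimately show "\<bar>G s - V (x, t) * m2\<bar> \<le> \<omega>" by simp
    qed
  qed
  show ?thesis
  proof (intro exI[of _ C] allI impI)
    fix s :: real assume s: "s > 0" "s \<le> s1"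
    have C0: "C \<ge> 0" by (simp add: C_def)
    have "\<bar>G s - V (x, t) * m2\<bar> \<le> C * sqrt s * s"
    proof (rule field_le_epsilon)
      fix \<omega> :: real assume \<omega>: "\<omega> > 0"
      obtain s0 where s0: "s0 > 0" "\<forall>s>0. s \<le> s0 \<longrightarrow> s \<le> s1 \<longrightarrow> \<bar>G s - V (x, t) * m2\<bar> \<le> \<omega>"
        using lim[OF \<omega>] s by auto
      \<comment> \<open>The normalised kernel has no meaning at scale 0, so the mean value theorem
        is applied between a small positive scale and \<open>s\<close>; the limit supplies the
        remaining error \<omega>.\<close>
      define \<zeta> where "\<zeta> = min s0 (s / 2)"
      have \<zeta>: "\<zeta> > 0" "\<zeta> < s" "\<zeta> \<le> s0" using s0 s by (auto simp: \<zeta>_def)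
      obtain \<xi> where \<xi>: "\<zeta> < \<xi>" "\<xi> < s" "G s - G \<zeta> = (s - \<zeta>) * G' \<xi>"
        using MVT2[OF \<zeta>(2), of G G'] der \<zeta> s by force
      have "\<bar>G' \<xi>\<bar> \<le> C * sqrt s"
        using G'[of \<xi>] \<xi> \<zeta> s C0 by (smt (verit) mult_left_mono real_sqrt_le_mono)
      then have "\<bar>G s - G \<zeta>\<bar> \<le> s * (C * sqrt s)"
        unfolding \<xi>(3) abs_mult using \<zeta> by (intro mult_mono) auto
      moreover have "\<bar>G \<zeta> - V (x, t) * m2\<bar> \<le> \<omega>" using s0(2) \<zeta> s by simp
      ultimately show "\<bar>G s - V (x, t) * m2\<bar> \<le> C * sqrt s * s + \<omega>" by (simp add: mult_ac)
    qed
    then have "\<bar>G s - V (x, t) * m2\<bar> * s ^ 3 \<le> C * sqrt s * s * s ^ 3"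
      using s by (intro mult_right_mono) auto
    moreover have "J V bump bump s - V (x, t) * (s ^ 3 * m2) = (G s - V (x, t) * m2) * s ^ 3"
      using s(1) by (simp add: GJ[OF s(1)] left_diff_distrib)
    ultimately show "\<bar>integral ?B (\<lambda>z. V z * pkernel bump bump x s t (s\<^sup>2) z)
      - V (x, t) * (s ^ 3 * (bump_mass * bump_mass))\<bar> \<le> C * sqrt s * s ^ 4"
      using s(1) by (simp add: J_def m2_def abs_mult eval_nat_numeral mult_ac)
  qed
qed

section \<open>The minimum principle\<close>

lemma classical_on_subset: "classical_on U W Wx Wxx Wt \<Longrightarrow> S \<subseteq> U \<Longrightarrow> classical_on S W Wx Wxx Wt"
  unfolding classical_on_def by (auto intro: continuous_on_subset)

lemma classical_on_add:
  assumes "classical_on U W Wx Wxx Wt" "classical_on U Z Zx Zxx Zt"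
  shows "classical_on U (\<lambda>z. W z + Z z) (\<lambda>z. Wx z + Zx z) (\<lambda>z. Wxx z + Zxx z) (\<lambda>z. Wt z + Zt z)"
  using assms unfolding classical_on_def by (auto intro!: continuous_intros derivative_intros)

lemma supersolI:
  assumes "d > 0"
    and "\<And>e. e > 0 \<Longrightarrow> supersol_approx \<sigma> r q f z0 k d e"
  shows "supersol \<sigma> r q f z0 k"
  using assms unfolding supersol_def by blast

lemma supersolE:
  assumes "supersol \<sigma> r q f z0 k"
  obtains d where "d > 0" "\<And>e. e > 0 \<Longrightarrow> supersol_approx \<sigma> r q f z0 k d e"
proof -
  obtain d where "d > 0" "\<forall>e>0. supersol_approx \<sigma> r q f z0 k d e"
    using assms unfolding supersol_def by blast
  then show ?thesis by (intro that[of d]) auto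
qed

lemma supersol_mono:
  assumes "supersol \<sigma> r q f z0 k" "k' \<le> k"
  shows "supersol \<sigma> r q f z0 k'"
proof -
  obtain d where d: "d > 0" "\<And>e. e > 0 \<Longrightarrow> supersol_approx \<sigma> r q f z0 k d e"
    using supersolE[OF assms(1)] by metis
  show ?thesis
  proof (rule supersolI[OF d(1)])
    fix e :: real assume "e > 0"
    from d(2)[OF this] show "supersol_approx \<sigma> r q f z0 k' d e"
      using assms(2) by (elim exE conjE) (intro exI conjI, assumption, force)
  qed
qed

lemma supersol_add:
  assumes "supersol \<sigma> r q f z0 k" "supersol \<sigma> r q g z0 l"
  shows "supersol \<sigma> r q (\<lambda>z. f z + g z) z0 (k + l)"
proof -
  obtain d where d: "d > 0" "\<And>e. e > 0 \<Longrightarrow> supersol_approx \<sigma> r q f z0 k d e"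
    using supersolE[OF assms(1)] by metis
  obtain d' where d': "d' > 0" "\<And>e. e > 0 \<Longrightarrow> supersol_approx \<sigma> r q g z0 l d' e"
    using supersolE[OF assms(2)] by metis
  show ?thesis
  proof (rule supersolI[of "min d d'"])
    show "min d d' > 0" using d d' by simp
    fix e :: real assume "e > 0"
    then have e: "e / 2 > 0" by simp
    obtain W Wx Wxx Wt where W: "classical_on (cball z0 d) W Wx Wxx Wt"
      "\<And>z. z \<in> cball z0 d \<Longrightarrow> \<bar>W z - f z\<bar> < e / 2 \<and> k - e / 2 \<le> cb_operator \<sigma> r q W Wx Wxx Wt z"
      using d(2)[OF e] by blast
    obtain Z Zx Zxx Zt where Z: "classical_on (cball z0 d') Z Zx Zxx Zt"
      "\<And>z. z \<in> cball z0 d' \<Longrightarrow> \<bar>Z z - g z\<bar> < e / 2 \<and> l - e / 2 \<le> cb_operator \<sigma> r q Z Zx Zxx Zt z"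
      using d'(2)[OF e] by blast
    have "classical_on (cball z0 (min d d')) (\<lambda>z. W z + Z z) (\<lambda>z. Wx z + Zx z) (\<lambda>z. Wxx z + Zxx z) (\<lambda>z. Wt z + Zt z)"
      by (intro classical_on_add classical_on_subset[OF W(1)] classical_on_subset[OF Z(1)]) auto
    moreover have "\<bar>(W z + Z z) - (f z + g z)\<bar> < e \<and> k + l - e \<le> cb_operator \<sigma> r q (\<lambda>z. W z + Z z)
        (\<lambda>z. Wx z + Zx z) (\<lambda>z. Wxx z + Zxx z) (\<lambda>z. Wt z + Zt z) z" if "z \<in> cball z0 (min d d')" for z
    proof -
      have "cb_operator \<sigma> r q (\<lambda>z. W z + Z z) (\<lambda>z. Wx z + Zx z) (\<lambda>z. Wxx z + Zxx z) (\<lambda>z. Wt z + Zt z) z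
        = cb_operator \<sigma> r q W Wx Wxx Wt z + cb_operator \<sigma> r q Z Zx Zxx Zt z"
        by (simp add: cb_operator_def algebra_simps)
      moreover have "\<bar>W z - f z\<bar> < e / 2" "k - e / 2 \<le> cb_operator \<sigma> r q W Wx Wxx Wt z"
        "\<bar>Z z - g z\<bar> < e / 2" "l - e / 2 \<le> cb_operator \<sigma> r q Z Zx Zxx Zt z"
        using W(2)[of z] Z(2)[of z] that by (simp_all del: less_divide_eq_numeral1)
      ultimately show ?thesis by linarith
    qed
    ultimately show "supersol_approx \<sigma> r q (\<lambda>z. f z + g z) z0 (k + l) (min d d') e"
      by blast
  qed
qed

lemma supersol_classical:
  assumes "open U" "z0 \<in> U" "classical_on U W Wx Wxx Wt"
    and "\<And>z. z \<in> U \<Longrightarrow> k \<le> cb_operator \<sigma> r q W Wx Wxx Wt z"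
  shows "supersol \<sigma> r q W z0 k"
proof -
  obtain d where d: "d > 0" "cball z0 d \<subseteq> U" using assms(1,2) open_contains_cball by blast
  show ?thesis
  proof (rule supersolI[OF d(1)])
    fix e :: real assume "e > 0"
    show "\<exists>W' Wx Wxx Wt. classical_on (cball z0 d) W' Wx Wxx Wt \<and>
      (\<forall>z\<in>cball z0 d. \<bar>W' z - W z\<bar> < e \<and> k - e \<le> cb_operator \<sigma> r q W' Wx Wxx Wt z)"
    proof (rule exI[of _ W], rule exI[of _ Wx], rule exI[of _ Wxx], rule exI[of _ Wt], intro conjI ballI)
      show "classical_on (cball z0 d) W Wx Wxx Wt" by (rule classical_on_subset[OF assms(3) d(2)])
      fix z assume "z \<in> cball z0 d"
      then show "\<bar>W z - W z\<bar> < e" "k - e \<le> cb_operator \<sigma> r q W Wx Wxx Wt z"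
        using assms(4)[of z] d(2) \<open>e > 0\<close> by auto
    qed
  qed
qed

text \<open>The operator is invariant under dilations in \<open>x\<close> and translations in \<open>t\<close>.\<close>

lemma supersol_dilate_translate:
  assumes "supersol \<sigma> r q f (a * x, t + s) k" "a \<ge> 1"
  shows "supersol \<sigma> r q (\<lambda>z. f (a * fst z, snd z + s)) (x, t) k"
proof -
  obtain d where d: "d > 0" "\<And>e. e > 0 \<Longrightarrow> supersol_approx \<sigma> r q f (a * x, t + s) k d e"
    using supersolE[OF assms(1)] by metis
  define d' where "d' = d / (2 * a)"
  let ?m = "\<lambda>z. (a * fst z, snd z + s)"
  have m: "?m z \<in> cball (a * x, t + s) d" if "z \<in> cball (x, t) d'" for z
  proof -
    have "\<bar>x - fst z\<bar> \<le> d'" "\<bar>t - snd z\<bar> \<le> d'"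
      using that abs_fst_diff_le_dist[of z "(x, t)"] abs_snd_diff_le_dist[of z "(x, t)"]
      by (auto simp: abs_minus_commute)
    moreover have "d' \<le> a * d'" using assms(2) d(1) by (simp add: d'_def field_simps)
    ultimately have "a * \<bar>x - fst z\<bar> \<le> a * d'" "\<bar>t - snd z\<bar> \<le> a * d'"
      using assms(2) by (auto intro: mult_left_mono)
    moreover have "a * d' = d / 2" using assms(2) by (simp add: d'_def)
    moreover have "\<bar>a * x - a * fst z\<bar> = a * \<bar>x - fst z\<bar>"
      using assms(2) by (simp add: abs_mult flip: right_diff_distrib)
    ultimately show ?thesis
      using dist_Pair_le[of "a * x" "t + s" "a * fst z" "snd z + s"] by simp
  qed
  show ?thesis
  proof (rule supersolI[of d'])
    show "d' > 0" using d(1) assms(2) by (simp add: d'_def)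
    fix e :: real assume "e > 0"
    then obtain W Wx Wxx Wt where W: "classical_on (cball (a * x, t + s) d) W Wx Wxx Wt"
      "\<And>z. z \<in> cball (a * x, t + s) d \<Longrightarrow> \<bar>W z - f z\<bar> < e \<and> k - e \<le> cb_operator \<sigma> r q W Wx Wxx Wt z"
      using d(2) by blast
    let ?W = "\<lambda>z. W (?m z)" and ?Wx = "\<lambda>z. Wx (?m z) * a" and ?Wxx = "\<lambda>z. Wxx (?m z) * a * a" and ?Wt = "\<lambda>z. Wt (?m z)"
    have "classical_on (cball (x, t) d') ?W ?Wx ?Wxx ?Wt"
      unfolding classical_on_def
    proof (intro conjI ballI)
      show "continuous_on (cball (x, t) d') ?W"
        using W(1) m unfolding classical_on_def
        by (intro continuous_on_compose2[where f="?m" and g=W and t="cball (a * x, t + s) d"] continuous_intros) auto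
      fix z assume "z \<in> cball (x, t) d'"
      from m[OF this] have D: "((\<lambda>x. W (x, snd z + s)) has_real_derivative Wx (?m z)) (at (a * fst z))"
        "((\<lambda>x. Wx (x, snd z + s)) has_real_derivative Wxx (?m z)) (at (a * fst z))"
        "((\<lambda>t. W (a * fst z, t)) has_real_derivative Wt (?m z)) (at (snd z + s))"
        using W(1) unfolding classical_on_def by fastforce+
      have dl: "((\<lambda>x. a * x) has_real_derivative a) (at (fst z))"
        by (auto intro!: derivative_eq_intros)
      have dt: "((\<lambda>t. t + s) has_real_derivative 1) (at (snd z))"
        by (auto intro!: derivative_eq_intros)
      show "((\<lambda>x. ?W (x, snd z)) has_real_derivative ?Wx z) (at (fst z))"
        using DERIV_chain2[OF D(1) dl] by simp
      show "((\<lambda>x. ?Wx (x, snd z)) has_real_derivative ?Wxx z) (at (fst z))"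
        using DERIV_cmult_right[OF DERIV_chain2[OF D(2) dl], of a] by simp
      show "((\<lambda>t. ?W (fst z, t)) has_real_derivative ?Wt z) (at (snd z))"
        using DERIV_chain2[OF D(3) dt] by simp
    qed
    moreover have "\<bar>?W z - f (?m z)\<bar> < e \<and> k - e \<le> cb_operator \<sigma> r q ?W ?Wx ?Wxx ?Wt z"
      if "z \<in> cball (x, t) d'" for z
      using W(2)[OF m[OF that]] by (simp add: cb_operator_def power2_eq_square mult_ac)
    ultimately have *: "classical_on (cball (x, t) d') ?W ?Wx ?Wxx ?Wt \<and> (\<forall>z\<in>cball (x, t) d'. \<bar>?W z - f (?m z)\<bar> < e \<and> k - e \<le> cb_operator \<sigma> r q ?W ?Wx ?Wxx ?Wt z)"
      by blast
    show "supersol_approx \<sigma> r q (\<lambda>z. f (?m z)) (x, t) k d' e"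
      by (rule exI[of _ ?W], rule exI[of _ ?Wx], rule exI[of _ ?Wxx], rule exI[of _ ?Wt]) (rule *)
  qed
qed

text \<open>The second derivative is known at the single point \<open>a\<close> only. If it were
  negative, \<open>f'\<close> would be negative just to the right of \<open>a\<close>, and the mean
  value theorem would produce a smaller value.\<close>

lemma second_derivative_nonneg_at_local_min:
  fixes f f' :: "real \<Rightarrow> real"
  assumes \<delta>: "\<delta> > 0" and f: "\<And>x. \<bar>x - a\<bar> < \<delta> \<Longrightarrow> (f has_real_derivative f' x) (at x)"
    and f': "(f' has_real_derivative l) (at a)" and min: "\<And>x. \<bar>x - a\<bar> < \<delta> \<Longrightarrow> f a \<le> f x"
  shows "f' a = 0" "l \<ge> 0"
proof -
  show 0: "f' a = 0"
    using DERIV_local_min[OF f[of a] \<delta>] min \<delta> by (auto simp: abs_minus_commute)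
  show "l \<ge> 0"
  proof (rule ccontr)
    assume "\<not> l \<ge> 0"
    then obtain d where d: "d > 0" "\<And>h. 0 < h \<Longrightarrow> h < d \<Longrightarrow> f' (a + h) < f' a"
      using DERIV_neg_dec_right[OF f'] by auto
    define h where "h = min d \<delta> / 2"
    have h: "0 < h" "h < d" "h < \<delta>" using d \<delta> by (auto simp: h_def)
    obtain \<xi> where \<xi>: "a < \<xi>" "\<xi> < a + h" "f (a + h) - f a = (a + h - a) * f' \<xi>"
      using MVT2[of a "a + h" f f'] f h by force
    have "f' \<xi> < 0" using d(2)[of "\<xi> - a"] \<xi> h 0 by simp
    then have "f (a + h) - f a < 0" unfolding \<xi>(3) using h(1) by (simp add: mult_less_0_iff)
    then show False using min[of "a + h"] h by auto
  qed
qed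

text \<open>The approximants need not have a minimum near \<open>z0\<close>. Adding a paraboloid of
  height comparable to the accuracy \<open>e\<close> forces one in the interior of the ball, where
  the classical conditions apply; the paraboloid changes the operator by a multiple of
  \<open>e\<close> only, and \<open>e\<close> tends to 0.\<close>

lemma supersol_local_min:
  assumes ss: "supersol \<sigma> r q f z0 k" and r: "r \<ge> 0" and d: "d > 0"
    and min: "\<And>z. z \<in> cball z0 d \<Longrightarrow> f z0 \<le> f z"
  shows "k \<le> r * f z0"
proof -
  obtain d0 where d0: "d0 > 0" "\<And>e. e > 0 \<Longrightarrow> supersol_approx \<sigma> r q f z0 k d0 e"
    using supersolE[OF ss] by metis
  define \<rho> where "\<rho> = min d d0"
  have \<rho>: "\<rho> > 0" "\<rho> \<le> d" "\<rho> \<le> d0" using d d0 by (auto simp: \<rho>_def)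
  define X where "X = \<bar>fst z0\<bar> + \<rho>"
  define A where "A = 2 * \<rho> + \<sigma>\<^sup>2 * X\<^sup>2 + \<bar>r - q\<bar> * X * (2 * \<rho>)"
  have X: "X > 0" and A: "A \<ge> 0" using \<rho> by (auto simp: X_def A_def intro!: add_nonneg_nonneg mult_nonneg_nonneg)
  define C where "C = 1 + r + 3 / \<rho>\<^sup>2 * A"
  have "C > 0" unfolding C_def using r A \<rho> by (intro add_pos_nonneg mult_nonneg_nonneg) auto
  have main: "k \<le> r * f z0 + C * e" if e: "e > 0" for e
  proof -
    obtain W Wx Wxx Wt where cl: "classical_on (cball z0 d0) W Wx Wxx Wt"
      and W: "\<And>z. z \<in> cball z0 d0 \<Longrightarrow> \<bar>W z - f z\<bar> < e \<and> k - e \<le> cb_operator \<sigma> r q W Wx Wxx Wt z"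
      using d0(2)[OF e] by blast
    \<comment> \<open>On the sphere the paraboloid is worth \<open>3 * e\<close>, more than the
      approximation errors at its centre and at the boundary point together, so the minimum is not
      attained there.\<close>
    define \<kappa> where "\<kappa> = 3 * e / \<rho>\<^sup>2"
    have \<kappa>: "\<kappa> > 0" using e \<rho> by (simp add: \<kappa>_def)
    define P where "P = (\<lambda>z. W z + \<kappa> * ((fst z - fst z0)\<^sup>2 + (snd z - snd z0)\<^sup>2))"
    have dist2: "(fst z - fst z0)\<^sup>2 + (snd z - snd z0)\<^sup>2 = (dist z0 z)\<^sup>2" for z
      by (cases z; cases z0) (simp add: dist_Pair_Pair dist_real_def power2_commute)
    have "continuous_on (cball z0 \<rho>) P"
      unfolding P_def using cl \<rho>(3) unfolding classical_on_def
      by (auto intro!: continuous_intros elim: continuous_on_subset)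
    then obtain z1 where z1: "z1 \<in> cball z0 \<rho>" "\<And>z. z \<in> cball z0 \<rho> \<Longrightarrow> P z1 \<le> P z"
      using continuous_attains_inf[of "cball z0 \<rho>" P] \<rho>(1) by (metis centre_in_cball compact_cball empty_iff less_imp_le)
    have "P z0 = W z0" by (simp add: P_def)
    moreover have "W z0 < f z0 + e" using W[of z0] d0(1) by auto
    ultimately have P1: "P z1 < f z0 + e" using z1(2)[of z0] \<rho>(1) by auto
    have W1: "\<bar>W z1 - f z1\<bar> < e" "k - e \<le> cb_operator \<sigma> r q W Wx Wxx Wt z1"
      using W[of z1] z1(1) \<rho>(3) by auto
    have "f z0 \<le> f z1" using min[of z1] z1(1) \<rho>(2) by auto
    have "dist z0 z1 < \<rho>"
    proof (rule ccontr)
      assume "\<not> dist z0 z1 < \<rho>"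
      then have "dist z0 z1 = \<rho>" using z1(1) by simp
      then have "P z1 = W z1 + 3 * e" using \<rho>(1) by (simp add: P_def dist2 \<kappa>_def)
      then show False using P1 W1(1) \<open>f z0 \<le> f z1\<close> by linarith
    qed
    define \<delta> where "\<delta> = \<rho> - dist z0 z1"
    have \<delta>: "\<delta> > 0" using \<open>dist z0 z1 < \<rho>\<close> by (simp add: \<delta>_def)
    have nx: "(x, snd z1) \<in> cball z0 \<rho>" if "\<bar>x - fst z1\<bar> < \<delta>" for x
      using that dist_triangle[of z0 "(x, snd z1)" z1] dist_Pair_le[of "fst z1" "snd z1" x "snd z1"]
      by (auto simp: \<delta>_def abs_minus_commute)
    have nt: "(fst z1, t) \<in> cball z0 \<rho>" if "\<bar>t - snd z1\<bar> < \<delta>" for t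
      using that dist_triangle[of z0 "(fst z1, t)" z1] dist_Pair_le[of "fst z1" "snd z1" "fst z1" t]
      by (auto simp: \<delta>_def abs_minus_commute)
    have dW: "((\<lambda>x. W (x, snd z)) has_real_derivative Wx z) (at (fst z))"
      "((\<lambda>x. Wx (x, snd z)) has_real_derivative Wxx z) (at (fst z))"
      "((\<lambda>t. W (fst z, t)) has_real_derivative Wt z) (at (snd z))" if "z \<in> cball z0 \<rho>" for z
      using cl \<rho>(3) that unfolding classical_on_def by auto
    let ?Px = "\<lambda>x. Wx (x, snd z1) + \<kappa> * (2 * (x - fst z0))"
    have x2: "?Px (fst z1) = 0" "Wxx z1 + \<kappa> * 2 \<ge> 0"
    proof -
      have 1: "((\<lambda>x. P (x, snd z1)) has_real_derivative ?Px x) (at x)" if "\<bar>x - fst z1\<bar> < \<delta>" for x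
        unfolding P_def using dW(1)[OF nx[OF that]]
        by (auto intro!: derivative_eq_intros)
      have 2: "(?Px has_real_derivative Wxx z1 + \<kappa> * 2) (at (fst z1))"
        using dW(2)[OF z1(1)] by (auto intro!: derivative_eq_intros)
      show "?Px (fst z1) = 0" "Wxx z1 + \<kappa> * 2 \<ge> 0"
        using second_derivative_nonneg_at_local_min[OF \<delta> 1 2] z1(2)[OF nx] by auto
    qed
    have t2: "Wt z1 + \<kappa> * (2 * (snd z1 - snd z0)) = 0"
    proof (rule DERIV_local_min[OF _ \<delta>])
      show "((\<lambda>t. P (fst z1, t)) has_real_derivative Wt z1 + \<kappa> * (2 * (snd z1 - snd z0))) (at (snd z1))"
        unfolding P_def using dW(3)[OF z1(1)] by (auto intro!: derivative_eq_intros)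
      show "\<forall>y. \<bar>snd z1 - y\<bar> < \<delta> \<longrightarrow> P (fst z1, snd z1) \<le> P (fst z1, y)"
        using z1(2)[OF nt] by (auto simp: abs_minus_commute)
    qed
    have b: "\<bar>fst z1 - fst z0\<bar> \<le> \<rho>" "\<bar>snd z1 - snd z0\<bar> \<le> \<rho>"
      using z1(1) abs_fst_diff_le_dist[of z1 z0] abs_snd_diff_le_dist[of z1 z0] by auto
    have x1: "\<bar>fst z1\<bar> \<le> X" using b(1) by (simp add: X_def)
    have "- Wt z1 \<le> \<kappa> * (2 * \<rho>)"
    proof -
      have "- Wt z1 = \<kappa> * (2 * (snd z1 - snd z0))" using t2 by linarith
      also have "\<dots> \<le> \<kappa> * (2 * \<rho>)" using b(2) \<kappa> by (intro mult_left_mono) auto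
      finally show ?thesis .
    qed
    moreover have "- (1/2 * \<sigma>\<^sup>2 * (fst z1)\<^sup>2 * Wxx z1) \<le> \<kappa> * (\<sigma>\<^sup>2 * X\<^sup>2)"
    proof -
      have "(1/2 * \<sigma>\<^sup>2 * (fst z1)\<^sup>2) * (- Wxx z1) \<le> (1/2 * \<sigma>\<^sup>2 * (fst z1)\<^sup>2) * (\<kappa> * 2)"
        using x2(2) by (intro mult_left_mono) auto
      also have "\<dots> \<le> (1/2 * \<sigma>\<^sup>2 * X\<^sup>2) * (\<kappa> * 2)"
        using x1 \<kappa> X by (intro mult_right_mono mult_left_mono) (auto simp: abs_le_square_iff[symmetric])
      finally show ?thesis by (simp add: mult_ac)
    qed
    moreover have "- ((r - q) * fst z1 * Wx z1) \<le> \<kappa> * (\<bar>r - q\<bar> * X * (2 * \<rho>))"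
    proof -
      have "\<bar>Wx z1\<bar> = \<kappa> * (2 * \<bar>fst z1 - fst z0\<bar>)"
      proof -
        have "Wx z1 = - (\<kappa> * 2) * (fst z1 - fst z0)" using x2(1) by (simp add: algebra_simps)
        then show ?thesis using \<kappa> by (simp add: abs_mult)
      qed
      also have "\<dots> \<le> \<kappa> * (2 * \<rho>)" using b(1) \<kappa> by (intro mult_left_mono) auto
      finally have "\<bar>r - q\<bar> * \<bar>fst z1\<bar> * \<bar>Wx z1\<bar> \<le> \<bar>r - q\<bar> * X * (\<kappa> * (2 * \<rho>))"
        using x1 X by (intro mult_mono) auto
      then show ?thesis
        using abs_ge_minus_self[of "(r - q) * fst z1 * Wx z1"] unfolding abs_mult by (simp add: mult_ac)
    qed
    moreover have "r * W z1 \<le> r * (f z0 + e)"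
    proof (rule mult_left_mono[OF _ r])
      have "\<kappa> * ((fst z1 - fst z0)\<^sup>2 + (snd z1 - snd z0)\<^sup>2) \<ge> 0" using \<kappa> by simp
      then show "W z1 \<le> f z0 + e" using P1 by (simp add: P_def)
    qed
    ultimately have "cb_operator \<sigma> r q W Wx Wxx Wt z1 \<le> \<kappa> * A + r * (f z0 + e)"
      unfolding cb_operator_def A_def by (simp add: algebra_simps)
    moreover have "\<kappa> * A = 3 / \<rho>\<^sup>2 * A * e" by (simp add: \<kappa>_def)
    ultimately show ?thesis using W1(2) unfolding C_def by (simp add: algebra_simps)
  qed
  show ?thesis
  proof (rule field_le_epsilon)
    fix e :: real assume "e > 0"
    then show "k \<le> r * f z0 + e" using main[of "e / C"] \<open>C > 0\<close> by simp
  qed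
qed

text \<open>At a negative minimum \<open>supersol_local_min\<close> gives
  \<open>0 \<le> r * g z0\<close>, against \<open>r > 0\<close>. The assumption concerns only points
  where \<open>g\<close> is negative: boundary points and contact points are excluded by showing
  that \<open>g\<close> cannot be negative there.\<close>

lemma minimum_principle:
  fixes g :: "real \<times> real \<Rightarrow> real"
  assumes "compact Q" "continuous_on Q g" "r > 0"
    and "\<And>z. z \<in> Q \<Longrightarrow> g z < 0 \<Longrightarrow> z \<in> interior Q \<and> supersol \<sigma> r q g z 0"
    and "z \<in> Q"
  shows "g z \<ge> 0"
proof (rule ccontr)
  assume "\<not> g z \<ge> 0"
  obtain z0 where z0: "z0 \<in> Q" "\<And>z. z \<in> Q \<Longrightarrow> g z0 \<le> g z"
    using continuous_attains_inf[OF assms(1) _ assms(2)] assms(5) by blast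
  then have neg: "g z0 < 0" using \<open>\<not> g z \<ge> 0\<close> assms(5) by (meson not_le order_le_less_trans)
  then obtain d where "d > 0" "cball z0 d \<subseteq> Q"
    using assms(4)[OF z0(1)] mem_interior_cball by blast
  then have "0 \<le> r * g z0"
    using assms(3,4) z0 neg by (intro supersol_local_min[of \<sigma> r q g z0 0 d]) auto
  then show False using neg assms(3) by (simp add: zero_le_mult_iff)
qed

text \<open>No data are needed at \<open>x = 0\<close> and \<open>t = 0\<close>: there the barrier \<open>exp (\<mu> (T - t)) / x + 1 / t\<close> is infinite.\<close>

lemma minimum_principle_quadrant:
  fixes g :: "real \<times> real \<Rightarrow> real"
  assumes "r > 0" "q \<ge> 0"
    and cont: "continuous_on ({0<..X} \<times> {0<..T}) g"
    and bd: "\<And>x t. 0 < x \<Longrightarrow> x \<le> X \<Longrightarrow> 0 < t \<Longrightarrow> t \<le> T \<Longrightarrow> - C \<le> g (x, t)"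
    and side: "\<And>t. 0 < t \<Longrightarrow> t \<le> T \<Longrightarrow> 0 \<le> g (X, t)"
    and top: "\<And>x. 0 < x \<Longrightarrow> x \<le> X \<Longrightarrow> 0 \<le> g (x, T)"
    and ss: "\<And>x t. 0 < x \<Longrightarrow> x < X \<Longrightarrow> 0 < t \<Longrightarrow> t < T \<Longrightarrow> g (x, t) < 0 \<Longrightarrow> supersol \<sigma> r q g (x, t) 0"
    and xt: "0 < x" "x \<le> X" "0 < t" "t \<le> T"
  shows "g (x, t) \<ge> 0"
proof -
  \<comment> \<open>The operator maps \<open>exp (\<mu> * (T - t)) / x\<close> to itself times
    \<open>\<mu> - \<sigma>\<^sup>2 + 2 * r - q\<close>; with this \<mu> the factor is
    \<open>2 * r\<close>.\<close>
  define \<mu> where "\<mu> = \<sigma>\<^sup>2 + q"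
  define b where "b = (\<lambda>z. exp (\<mu> * (T - snd z)) / fst z + 1 / snd z)"
  have main: "g (x, t) + \<epsilon> * b (x, t) \<ge> 0" if \<epsilon>: "\<epsilon> > 0" for \<epsilon>
  proof -
    let ?U = "{0<..} \<times> {0<..} :: (real \<times> real) set"
    let ?B = "\<lambda>z. \<epsilon> * b z" and ?Bx = "\<lambda>z. - \<epsilon> * exp (\<mu> * (T - snd z)) / (fst z)\<^sup>2"
      and ?Bxx = "\<lambda>z. 2 * \<epsilon> * exp (\<mu> * (T - snd z)) / (fst z) ^ 3"
      and ?Bt = "\<lambda>z. \<epsilon> * (- \<mu> * exp (\<mu> * (T - snd z)) / fst z - 1 / (snd z)\<^sup>2)"
    have contB: "continuous_on ?U ?B"
      unfolding b_def by (intro continuous_intros) auto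
    have clB: "classical_on ?U ?B ?Bx ?Bxx ?Bt"
      unfolding classical_on_def
    proof (intro conjI ballI contB)
      fix z assume "z \<in> ?U"
      then have z: "fst z > 0" "snd z > 0" by auto
      show "((\<lambda>x. ?B (x, snd z)) has_real_derivative ?Bx z) (at (fst z))"
        "((\<lambda>x. ?Bx (x, snd z)) has_real_derivative ?Bxx z) (at (fst z))"
        "((\<lambda>t. ?B (fst z, t)) has_real_derivative ?Bt z) (at (snd z))"
        unfolding b_def using z
        by (auto intro!: derivative_eq_intros simp: field_simps power2_eq_square power3_eq_cube)
    qed
    have opB: "cb_operator \<sigma> r q ?B ?Bx ?Bxx ?Bt z \<ge> 0" if "z \<in> ?U" for z
    proof -
      have z: "fst z > 0" "snd z > 0" using that by auto
      define E where "E = exp (\<mu> * (T - snd z))"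
      have "cb_operator \<sigma> r q ?B ?Bx ?Bxx ?Bt z = \<epsilon> * (1 / (snd z)\<^sup>2 + r / snd z + (\<mu> - \<sigma>\<^sup>2 + 2 * r - q) * (E / fst z))"
        unfolding cb_operator_def b_def E_def[symmetric] using z
        by (simp add: field_simps power2_eq_square power3_eq_cube)
      also have "\<dots> \<ge> 0"
        using \<epsilon> z assms(1,2) by (intro mult_nonneg_nonneg add_nonneg_nonneg) (auto simp: \<mu>_def E_def)
      finally show ?thesis .
    qed
    have bpos: "b z > 0" if "z \<in> ?U" for z using that by (auto simp: b_def intro!: add_pos_pos)
    \<comment> \<open>The box must contain the given point, and on the artificial sides
      \<open>x = \<delta>\<close> and \<open>t = \<delta>\<close> the barrier is at least
      \<open>\<epsilon> / \<delta>\<close>, which exceeds \<open>C\<close> and so outweighs the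
      lower bound of \<open>g\<close>.\<close>
    define \<delta> where "\<delta> = min (min x t) (\<epsilon> / (\<bar>C\<bar> + 1))"
    have \<delta>: "\<delta> > 0" "\<delta> \<le> x" "\<delta> \<le> t" "\<delta> \<le> \<epsilon> / (\<bar>C\<bar> + 1)" using xt \<epsilon> by (auto simp: \<delta>_def)
    have "\<epsilon> / \<delta> \<ge> \<bar>C\<bar> + 1" using \<delta> by (simp add: field_simps)
    then have big: "- C + \<epsilon> / \<delta> > 0" by linarith
    define Q where "Q = cbox (\<delta>, \<delta>) (X, T)"
    have QU: "Q \<subseteq> {0<..X} \<times> {0<..T}" using \<delta>(1) by (auto simp: Q_def cbox_Pair_eq)
    have intQ: "interior Q = {\<delta><..<X} \<times> {\<delta><..<T}"
      by (simp add: Q_def cbox_Pair_eq interior_Times)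
    show ?thesis
    proof (rule minimum_principle[where g="\<lambda>z. g z + ?B z" and Q=Q and z="(x, t)" and r=r and q=q and \<sigma>=\<sigma>])
      show "compact Q" by (simp add: Q_def)
      show "continuous_on Q (\<lambda>z. g z + ?B z)"
        using QU by (intro continuous_on_add continuous_on_subset[OF cont] continuous_on_subset[OF contB]) auto
      show "(x, t) \<in> Q" using \<delta> xt by (simp add: Q_def cbox_Pair_eq)
      fix z assume z: "z \<in> Q" and neg: "g z + ?B z < 0"
      obtain y s where ys: "z = (y, s)" by (cases z)
      have r: "\<delta> \<le> y" "y \<le> X" "\<delta> \<le> s" "s \<le> T" using z by (auto simp: ys Q_def cbox_Pair_eq)
      then have pos: "y > 0" "s > 0" using \<delta>(1) by auto
      have bz: "?B z > 0" using bpos[of z] pos \<epsilon> by (simp add: ys)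
      then have gneg: "g z < 0" using neg by simp
      have gC: "- C \<le> g z" using bd[of y s] r pos by (simp add: ys)
      have b1: "?B z \<ge> \<epsilon> / s"
        using pos \<epsilon> by (simp add: b_def ys distrib_left)
      have b2: "?B z \<ge> \<epsilon> / y"
      proof -
        have "1 \<le> exp (\<mu> * (T - s))" using r assms(2) by (simp add: \<mu>_def)
        then have "1 / y \<le> exp (\<mu> * (T - s)) / y" using pos by (intro divide_right_mono) auto
        then have "1 / y \<le> b z" using pos by (simp add: b_def ys add_increasing2)
        then have "\<epsilon> * (1 / y) \<le> \<epsilon> * b z" using \<epsilon> by (intro mult_left_mono) auto
        then show ?thesis by simp
      qed
      have "s \<noteq> \<delta>" "y \<noteq> \<delta>" using b1 b2 big neg gC by auto
      moreover have "y \<noteq> X" "s \<noteq> T" using side[of s] top[of y] r pos gneg by (auto simp: ys)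
      ultimately have i: "\<delta> < y" "y < X" "\<delta> < s" "s < T" using r by auto
      have "supersol \<sigma> r q g z 0" using ss[of y s] i pos gneg by (simp add: ys)
      moreover have "supersol \<sigma> r q ?B z 0"
        by (rule supersol_classical[OF _ _ clB opB]) (use pos in \<open>auto simp: ys open_Times\<close>)
      ultimately show "z \<in> interior Q \<and> supersol \<sigma> r q (\<lambda>z. g z + ?B z) z 0"
        using supersol_add[of \<sigma> r q g z 0 ?B 0] i by (auto simp: ys intQ)
    qed (use assms in auto)
  qed
  have bp: "b (x, t) > 0" using xt by (auto simp: b_def intro!: add_pos_pos)
  have "- g (x, t) \<le> 0"
  proof (rule field_le_epsilon)
    fix e :: real assume "e > 0"
    then show "- g (x, t) \<le> 0 + e" using main[of "e / b (x, t)"] bp by simp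
  qed
  then show ?thesis by simp
qed

section \<open>Solutions of the obstacle problem\<close>

locale cb_problem =
  fixes K \<gamma> T \<sigma> r q c :: real and V Vx Vxx Vt :: "real \<times> real \<Rightarrow> real"
  assumes params: "K > 0" "\<gamma> > 0" "T > 0" "\<sigma> > 0" "r > 0" "q > 0" "c \<ge> 0" "c < r * K"
    and sol: "cb_solution K \<gamma> T \<sigma> r q c V Vx Vxx Vt"
begin

abbreviation "b \<equiv> K / \<gamma>"
abbreviation "D \<equiv> cb_domain K \<gamma> T"

lemma b_pos: "b > 0"
  using params by simp

lemma \<gamma>_b: "\<gamma> * b = K"
  using params by simp

lemma mem_D: "(x, t) \<in> D \<longleftrightarrow> 0 < x \<and> x < b \<and> 0 < t \<and> t < T"
  by (auto simp: cb_domain_def)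

lemma open_D: "open D"
  by (simp add: cb_domain_def open_Times)

lemma D_subset_cbox: "D \<subseteq> cbox (0, 0) (b, T)"
  by (auto simp: cb_domain_def cbox_Pair_eq)

lemma V_cont: "continuous_on (D \<union> cb_data_boundary K \<gamma> T) V"
  using sol by (simp add: cb_solution_def)

lemma V_cont_D: "continuous_on D V"
  using V_cont continuous_on_subset by blast

lemma V_cont_quadrant: "continuous_on ({0<..b} \<times> {0<..T}) V"
  by (rule continuous_on_subset[OF V_cont]) (auto simp: cb_domain_def cb_data_boundary_def)

lemma V_side: "0 \<le> t \<Longrightarrow> t \<le> T \<Longrightarrow> V (b, t) = K" and V_top: "0 \<le> x \<Longrightarrow> x \<le> b \<Longrightarrow> V (x, T) = K"
  using sol by (auto simp: cb_solution_def)

lemma V_bounds: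
  assumes "0 < x" "x \<le> b" "0 < t" "t \<le> T"
  shows "\<gamma> * x \<le> V (x, t)" "V (x, t) \<le> K"
proof -
  have "\<gamma> * x \<le> V (x, t) \<and> V (x, t) \<le> K"
  proof (cases "x < b \<and> t < T")
    case True
    then have "(x, t) \<in> D" using assms by (simp add: mem_D)
    then show ?thesis using sol by (auto simp: cb_solution_def)
  next
    case False
    then have "x = b \<or> t = T" using assms by linarith
    then have "V (x, t) = K" using V_side[of t] V_top[of x] assms by (metis less_imp_le)
    moreover have "\<gamma> * x \<le> \<gamma> * b" using assms params by (intro mult_left_mono) auto
    ultimately show ?thesis using \<gamma>_b by simp
  qed
  then show "\<gamma> * x \<le> V (x, t)" "V (x, t) \<le> K" by auto
qed

lemma regularity:
  "has_weak_partial D (1, 0) V Vx" "has_weak_partial D (1, 0) Vx Vxx" "has_weak_partial D (0, 1) V Vt"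
  "locally_Lp D 6 Vx" "locally_Lp D 6 Vxx" "locally_Lp D 6 Vt"
  using sol by (auto simp: cb_solution_def cb_regular_def)

lemma supersol_V:
  assumes "z \<in> D" "s \<ge> 0"
  shows "supersol \<sigma> r q (\<lambda>z. s * V z) z (s * c)"
proof (rule weak_supersolution_imp_supersol[OF open_D V_cont_D regularity(1-5) open_D order_refl assms(1)])
  have "AE z in lebesgue. z \<in> D \<longrightarrow> cb_operator \<sigma> r q V Vx Vxx Vt z \<ge> c"
    using sol by (simp add: cb_solution_def)
  then show "AE z in lebesgue. z \<in> D \<longrightarrow> s * c \<le> s * cb_operator \<sigma> r q V Vx Vxx Vt z"
    by eventually_elim (auto intro: mult_left_mono assms(2))
qed

text \<open>The set \<open>N\<close> of points strictly between the obstacles is open, and on it the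
  equation holds with equality, so the sign of \<open>s\<close> is free. With \<open>s = - 1\<close>
  this is the only source of supersolutions of the form \<open>- V\<close>.\<close>

lemma supersol_V_continuation:
  assumes "z \<in> D" "\<gamma> * fst z < V z" "V z < K"
  shows "supersol \<sigma> r q (\<lambda>z. s * V z) z (s * c)"
proof -
  define N where "N = (D \<inter> (\<lambda>z. V z - \<gamma> * fst z) -` {0<..}) \<inter> (D \<inter> V -` {..<K})"
  have "open N" unfolding N_def
    by (rule open_Int; rule continuous_open_preimage[OF _ open_D])
      (auto intro!: continuous_intros V_cont_D)
  have "AE z in lebesgue. z \<in> D \<longrightarrow> \<gamma> * fst z < V z \<longrightarrow> V z < K \<longrightarrow> cb_operator \<sigma> r q V Vx Vxx Vt z = c"
    using sol by (simp add: cb_solution_def)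
  then have "AE z in lebesgue. z \<in> N \<longrightarrow> s * c \<le> s * cb_operator \<sigma> r q V Vx Vxx Vt z"
    by eventually_elim (auto simp: N_def)
  then show ?thesis
    by (rule weak_supersolution_imp_supersol[OF open_D V_cont_D regularity(1-5) \<open>open N\<close>, rotated 2])
      (use assms in \<open>auto simp: N_def\<close>)
qed

end

section \<open>The strong maximum principle\<close>

lemma bump_lower_bound:
  obtains \<kappa> where "\<kappa> > 0" "\<And>y. \<bar>y\<bar> \<le> 3/4 \<Longrightarrow> \<kappa> \<le> bump y"
proof -
  have "continuous_on {-3/4..3/4} bump"
    by (rule smooth_real_continuous[OF smooth_real_bump])
  then obtain y0 where y0: "y0 \<in> {-3/4..3/4}" "\<And>y. y \<in> {-3/4..3/4} \<Longrightarrow> bump y0 \<le> bump y"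
    using continuous_attains_inf[of "{-3/4..3/4::real}" bump] by auto
  then have "bump y0 > 0" by (intro bump_pos) auto
  moreover have "bump y0 \<le> bump y" if "\<bar>y\<bar> \<le> 3/4" for y
  proof (rule y0(2))
    show "y \<in> {-3/4..3/4}" using that unfolding atLeastAtMost_iff by linarith
  qed
  ultimately show ?thesis by (rule that)
qed

text \<open>The operator applied to \<open>- exp (\<mu> * t) * (p + M * p\<^sup>2)\<close> for \<open>p = d\<^sup>2 - (x - \<xi> t)\<^sup>2\<close>, where \<open>\<xi>\<close> has slope \<open>m\<close>
  and \<open>y = x - \<xi> t\<close>: a large \<open>M\<close> wins where \<open>p = 0\<close>, then a large \<open>\<mu>\<close> wins everywhere.\<close>

lemma tube_barrier_inequality:
  fixes x y p d m M xl b \<sigma> r q \<mu> A :: real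
  assumes y: "\<bar>y\<bar> \<le> d" and p: "p = d\<^sup>2 - y\<^sup>2" and x: "0 < xl" "xl \<le> x" "x \<le> b" and d: "0 < d" and "\<sigma> > 0"
    and A: "A = 2 * d * (\<bar>m\<bar> + \<bar>r - q\<bar> * b)"
    and M: "M = (1 + A / (\<sigma>\<^sup>2 * xl\<^sup>2)) / (4 * d\<^sup>2)"
    and l: "\<mu> = r + 2 * M * A + 6 * M * \<sigma>\<^sup>2 * b\<^sup>2"
  shows "0 \<le> \<mu> * (p + M * p\<^sup>2) + (1 + 2 * M * p) * (2 * y * m)
    + 1/2 * \<sigma>\<^sup>2 * x\<^sup>2 * (- 2 * (1 + 2 * M * p) + 8 * M * y\<^sup>2)
    + (r - q) * x * (1 + 2 * M * p) * (- 2 * y) - r * (p + M * p\<^sup>2)"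
proof -
  have b: "b > 0" using x by simp
  have p0: "p \<ge> 0" using y d by (simp add: p abs_le_square_iff[symmetric])
  have A0: "A \<ge> 0" unfolding A using d b by (intro mult_nonneg_nonneg add_nonneg_nonneg) auto
  have S: "\<sigma>\<^sup>2 * xl\<^sup>2 > 0" using assms by simp
  have M0: "M \<ge> 0" unfolding M using A0 S d by (intro divide_nonneg_nonneg add_nonneg_nonneg) auto
  have Md: "4 * M * d\<^sup>2 - 1 = A / (\<sigma>\<^sup>2 * xl\<^sup>2)" 
  proof -
    have "4 * M * d\<^sup>2 = 1 + A / (\<sigma>\<^sup>2 * xl\<^sup>2)" using d unfolding M by simp
    then show ?thesis by simp
  qed
  have xx: "xl\<^sup>2 \<le> x\<^sup>2" "x\<^sup>2 \<le> b\<^sup>2" using x by (auto intro!: power_mono)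
  have t1: "(1 + 2 * M * p) * (2 * y * m) + (r - q) * x * (1 + 2 * M * p) * (- 2 * y) \<ge> - ((1 + 2 * M * p) * A)"
  proof -
    have "\<bar>2 * y * (m - (r - q) * x)\<bar> \<le> 2 * d * (\<bar>m\<bar> + \<bar>r - q\<bar> * b)"
      unfolding abs_mult
    proof (intro mult_mono)
      have "\<bar>m - (r - q) * x\<bar> \<le> \<bar>m\<bar> + \<bar>r - q\<bar> * x" using x abs_triangle_ineq4[of m "(r - q) * x"] by (simp add: abs_mult)
      also have "\<dots> \<le> \<bar>m\<bar> + \<bar>r - q\<bar> * b" using x by (intro add_mono mult_left_mono) auto
      finally show "\<bar>m - (r - q) * x\<bar> \<le> \<bar>m\<bar> + \<bar>r - q\<bar> * b" .
    qed (use y d in auto)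
    then have "- A \<le> 2 * y * (m - (r - q) * x)" unfolding A by linarith
    then have "(1 + 2 * M * p) * (- A) \<le> (1 + 2 * M * p) * (2 * y * (m - (r - q) * x))"
      using M0 p0 by (intro mult_left_mono) auto
    then show ?thesis by (simp add: algebra_simps)
  qed
  have t2: "1/2 * \<sigma>\<^sup>2 * x\<^sup>2 * (- 2 * (1 + 2 * M * p) + 8 * M * y\<^sup>2) \<ge> A - 6 * M * \<sigma>\<^sup>2 * b\<^sup>2 * p"
  proof -
    have "1/2 * \<sigma>\<^sup>2 * x\<^sup>2 * (- 2 * (1 + 2 * M * p) + 8 * M * y\<^sup>2) = \<sigma>\<^sup>2 * x\<^sup>2 * (4 * M * d\<^sup>2 - 1) - 6 * M * \<sigma>\<^sup>2 * p * x\<^sup>2"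
      by (simp add: p field_simps)
    moreover have "\<sigma>\<^sup>2 * x\<^sup>2 * (4 * M * d\<^sup>2 - 1) \<ge> \<sigma>\<^sup>2 * xl\<^sup>2 * (A / (\<sigma>\<^sup>2 * xl\<^sup>2))"
      unfolding Md using xx A0 S by (intro mult_right_mono mult_left_mono divide_nonneg_nonneg) auto
    moreover have "\<sigma>\<^sup>2 * xl\<^sup>2 * (A / (\<sigma>\<^sup>2 * xl\<^sup>2)) = A" using \<open>\<sigma> > 0\<close> x(1) by simp
    moreover have "6 * M * \<sigma>\<^sup>2 * p * x\<^sup>2 \<le> 6 * M * \<sigma>\<^sup>2 * p * b\<^sup>2"
      using xx M0 p0 by (intro mult_left_mono mult_nonneg_nonneg) auto
    ultimately show ?thesis by (simp add: mult_ac)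
  qed
  have t3: "(\<mu> - r) * (p + M * p\<^sup>2) \<ge> (\<mu> - r) * p"
    unfolding l using M0 A0 p0 by (intro mult_left_mono) (auto intro!: add_nonneg_nonneg mult_nonneg_nonneg)
  have "(\<mu> - r) * p = 2 * M * A * p + 6 * M * \<sigma>\<^sup>2 * b\<^sup>2 * p" by (simp add: l algebra_simps)
  with t1 t2 t3 show ?thesis by (simp add: algebra_simps)
qed

context cb_problem
begin

text \<open>Since \<open>Vxx\<close> and \<open>Vt\<close> are in \<open>L\<^sup>6\<close>, parabolic means differ from point values by \<open>o(\<theta>)\<close>,
  so \<open>K - V\<close> cannot have a kink at a zero.\<close>

lemma no_linear_growth_at_max:
  assumes z: "(x, t) \<in> D" "V (x, t) = K" and "\<eta> > 0" and s: "s = 1 \<or> s = (- 1 :: real)" and \<theta>0: "\<theta>0 > 0"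
    and growth: "\<And>\<theta> y \<tau>. 0 < \<theta> \<Longrightarrow> \<theta> \<le> \<theta>0 \<Longrightarrow> 1/2 \<le> y \<Longrightarrow> y \<le> 3/4 \<Longrightarrow> 1/2 \<le> \<tau> \<Longrightarrow> \<tau> \<le> 3/4
      \<Longrightarrow> \<eta> * \<theta> \<le> K - V (x - s * \<theta> * y, t + \<theta>\<^sup>2 * \<tau>)"
  shows False
proof -
  obtain R where R: "R > 0" "cbox (x - 2 * R, t - 2 * R) (x + 2 * R, t + 2 * R) \<subseteq> D"
    using open_contains_box[OF open_D z(1)] by blast
  let ?a = "x - 2 * R" and ?b = "x + 2 * R" and ?c = "t - 2 * R" and ?d = "t + 2 * R"
  let ?B = "cbox (?a, ?c) (?b, ?d)"
  have cV: "continuous_on ?B V" using V_cont_D R(2) continuous_on_subset by blast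
  define m2 where "m2 = bump_mass * bump_mass"
  define \<theta>1 where "\<theta>1 = min 1 R"
  have \<theta>1: "\<theta>1 > 0" "\<theta>1 \<le> 1" "\<theta>1 \<le> R" using R by (auto simp: \<theta>1_def)
  have "\<theta>1\<^sup>2 \<le> \<theta>1" using \<theta>1 by (simp add: power2_eq_square mult_left_le)
  then have fits1: "?a \<le> x - \<theta>1" "x + \<theta>1 \<le> ?b" "?c \<le> t - \<theta>1\<^sup>2" "t + \<theta>1\<^sup>2 \<le> ?d"
    using \<theta>1 by auto
  let ?k = "\<lambda>\<theta> z. bump ((fst z - x) / \<theta>) * bump ((snd z - t) / \<theta>\<^sup>2)"
  obtain C where C: "\<forall>\<theta>>0. \<theta> \<le> \<theta>1 \<longrightarrow> \<bar>integral ?B (\<lambda>z. V z * ?k \<theta> z) - V (x, t) * (\<theta> ^ 3 * m2)\<bar> \<le> C * sqrt \<theta> * \<theta> ^ 4"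
    using parabolic_mean_estimate[OF open_D R(2) cV regularity(1-3,5,6) fits1] unfolding m2_def[symmetric]
    by (elim exE) (rule that)
  obtain \<kappa> where \<kappa>: "\<kappa> > 0" "\<And>y. \<bar>y\<bar> \<le> 3/4 \<Longrightarrow> \<kappa> \<le> bump y"
    using bump_lower_bound by metis
  define e where "e = \<eta> * \<kappa>\<^sup>2 / 16"
  have e: "e > 0" using \<open>\<eta> > 0\<close> \<kappa> by (simp add: e_def)
  have main: "e \<le> C * sqrt \<theta>" if \<theta>: "\<theta> > 0" "\<theta> \<le> \<theta>1" "\<theta> \<le> \<theta>0" for \<theta>
  proof -
    have sq: "\<theta>\<^sup>2 \<le> \<theta>" "\<theta>\<^sup>2 > 0" using \<theta> \<theta>1 by (auto simp: power2_eq_square mult_left_le)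
    have fits: "?a \<le> x - \<theta>" "x + \<theta> \<le> ?b" "?c \<le> t - \<theta>\<^sup>2" "t + \<theta>\<^sup>2 \<le> ?d"
      using \<theta> \<theta>1 sq R(1) by linarith+
    have ck: "continuous_on ?B (?k \<theta>)"
      using \<theta>(1) by (intro continuous_intros smooth_real_continuous_compose[OF smooth_real_bump]) auto
    have ik: "(?k \<theta> has_integral \<theta> ^ 3 * m2) ?B"
      using integrable_integral[OF integrable_continuous[OF ck]]
        integral_rescale_prod[OF smooth_real_continuous[OF smooth_real_bump] bump_zero
          smooth_real_continuous[OF smooth_real_bump] bump_zero \<theta>(1) sq(2) fits]
      by (simp add: m2_def power2_eq_square power3_eq_cube mult.assoc)
    have iV: "((\<lambda>z. V z * ?k \<theta> z) has_integral integral ?B (\<lambda>z. V z * ?k \<theta> z)) ?B"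
      by (intro integrable_integral integrable_continuous continuous_on_mult cV ck)
    have iu: "((\<lambda>z. (K - V z) * ?k \<theta> z) has_integral K * (\<theta> ^ 3 * m2) - integral ?B (\<lambda>z. V z * ?k \<theta> z)) ?B"
      using has_integral_diff[OF has_integral_mult_right[OF ik] iV] by (simp add: algebra_simps)
    \<comment> \<open>A rectangle of area \<open>\<theta> ^ 3 / 16\<close> on the side of growth, on
      which \<open>K - V\<close> is at least \<open>\<eta> * \<theta>\<close> and the kernel at
      least \<open>\<kappa>\<^sup>2\<close>. It contributes \<open>e * \<theta> ^ 4\<close> to the
      mean of \<open>K - V\<close>, whereas the mean is at most
      \<open>C * sqrt \<theta> * \<theta> ^ 4\<close>.\<close>
    define A where "A = cbox (x - s * (5/8 * \<theta>) - \<theta> / 8, t + \<theta>\<^sup>2 / 2) (x - s * (5/8 * \<theta>) + \<theta> / 8, t + 3/4 * \<theta>\<^sup>2)"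
    have AB: "A \<subseteq> ?B"
    proof
      fix z assume "z \<in> A"
      then have "x - s * (5/8 * \<theta>) - \<theta> / 8 \<le> fst z" "fst z \<le> x - s * (5/8 * \<theta>) + \<theta> / 8"
        "t + \<theta>\<^sup>2 / 2 \<le> snd z" "snd z \<le> t + 3/4 * \<theta>\<^sup>2"
        by (auto simp: A_def cbox_Pair_eq mem_Times_iff)
      moreover have "- (5/8 * \<theta>) \<le> s * (5/8 * \<theta>)" "s * (5/8 * \<theta>) \<le> 5/8 * \<theta>" using s \<theta>(1) by auto
      ultimately have "?a \<le> fst z" "fst z \<le> ?b" "?c \<le> snd z" "snd z \<le> ?d"
        using fits sq R(1) \<theta>(1) by linarith+
      then show "z \<in> ?B" by (cases z) (simp add: cbox_Pair_eq)
    qed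
    have u0: "0 \<le> K - V z" if "z \<in> ?B" for z
    proof -
      have "z \<in> D" using that R(2) by blast
      then show ?thesis using V_bounds(2)[of "fst z" "snd z"] by (cases z) (auto simp: mem_D)
    qed
    have lower: "\<eta> * \<theta> * \<kappa>\<^sup>2 \<le> (K - V z) * ?k \<theta> z" if zA: "z \<in> A" for z
    proof -
      define y where "y = s * (x - fst z) / \<theta>"
      define \<tau> where "\<tau> = (snd z - t) / \<theta>\<^sup>2"
      have zz: "x - s * (5/8 * \<theta>) - \<theta> / 8 \<le> fst z" "fst z \<le> x - s * (5/8 * \<theta>) + \<theta> / 8"
        "t + \<theta>\<^sup>2 / 2 \<le> snd z" "snd z \<le> t + 3/4 * \<theta>\<^sup>2"
        using zA by (auto simp: A_def cbox_Pair_eq mem_Times_iff)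
      have y: "1/2 \<le> y" "y \<le> 3/4" using s zz \<theta>(1) by (auto simp: y_def field_simps)
      have \<tau>: "1/2 \<le> \<tau>" "\<tau> \<le> 3/4" using zz sq by (auto simp: \<tau>_def field_simps)
      have zeq: "z = (x - s * \<theta> * y, t + \<theta>\<^sup>2 * \<tau>)"
        using s \<theta>(1) by (cases z) (auto simp: y_def \<tau>_def)
      have "(fst z - x) / \<theta> = - s * y" using s \<theta>(1) by (auto simp: y_def field_simps)
      then have "\<bar>(fst z - x) / \<theta>\<bar> \<le> 3/4" "\<bar>(snd z - t) / \<theta>\<^sup>2\<bar> \<le> 3/4"
        using y \<tau> s unfolding \<tau>_def[symmetric] by auto
      then have "\<kappa> \<le> bump ((fst z - x) / \<theta>)" "\<kappa> \<le> bump ((snd z - t) / \<theta>\<^sup>2)"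
        by (auto intro: \<kappa>(2))
      then have "\<kappa>\<^sup>2 \<le> ?k \<theta> z" unfolding power2_eq_square using \<kappa>(1) by (intro mult_mono) auto
      moreover have "\<eta> * \<theta> \<le> K - V z" using growth[OF \<theta>(1,3) y \<tau>] zeq by simp
      ultimately show ?thesis using u0[of z] AB zA \<kappa>(1) by (intro mult_mono) auto
    qed
    have "\<theta> ^ 4 * e = measure lborel A * (\<eta> * \<theta> * \<kappa>\<^sup>2)"
      using \<theta>(1) by (simp add: A_def content_Pair e_def field_simps eval_nat_numeral)
    also have "\<dots> = integral A (\<lambda>z. \<eta> * \<theta> * \<kappa>\<^sup>2)" by (simp add: A_def)
    also have "\<dots> \<le> integral A (\<lambda>z. (K - V z) * ?k \<theta> z)"
    proof (rule integral_le)
      show "(\<lambda>z. (K - V z) * ?k \<theta> z) integrable_on A"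
        using iu AB integrable_on_subcbox unfolding A_def by (blast intro: has_integral_integrable)
    qed (use lower in \<open>auto simp: A_def\<close>)
    also have "\<dots> \<le> integral ?B (\<lambda>z. (K - V z) * ?k \<theta> z)"
    proof (rule integral_subset_le[OF AB])
      show i: "(\<lambda>z. (K - V z) * ?k \<theta> z) integrable_on ?B" using iu by blast
      show "(\<lambda>z. (K - V z) * ?k \<theta> z) integrable_on A"
        using integrable_on_subcbox[OF i] AB unfolding A_def by blast
    qed (use u0 bump_nonneg in auto)
    also have "\<dots> = K * (\<theta> ^ 3 * m2) - integral ?B (\<lambda>z. V z * ?k \<theta> z)"
      using iu by (rule integral_unique)
    also have "\<dots> \<le> C * sqrt \<theta> * \<theta> ^ 4"
      using C[rule_format, OF \<theta>(1,2)] z(2) by simp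
    finally have "e * \<theta> ^ 4 \<le> C * sqrt \<theta> * \<theta> ^ 4" by (simp add: mult.commute)
    then show ?thesis using \<theta>(1) by simp
  qed
  \<comment> \<open>The last entry makes \<open>C * sqrt \<theta>\<close> at most
    \<open>e / 2\<close>.\<close>
  define \<theta> where "\<theta> = min (min \<theta>1 \<theta>0) ((e / (2 * (\<bar>C\<bar> + 1)))\<^sup>2)"
  have "\<theta> > 0" using \<theta>1 \<theta>0 e by (simp add: \<theta>_def)
  then have "e \<le> C * sqrt \<theta>" using main by (simp add: \<theta>_def)
  also have "\<dots> \<le> (\<bar>C\<bar> + 1) * (e / (2 * (\<bar>C\<bar> + 1)))"
  proof (rule mult_mono)
    have "sqrt \<theta> \<le> sqrt ((e / (2 * (\<bar>C\<bar> + 1)))\<^sup>2)"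
      by (rule real_sqrt_le_mono) (simp only: \<theta>_def min.cobounded2)
    also have "\<dots> = e / (2 * (\<bar>C\<bar> + 1))" using e by (simp only: real_sqrt_abs) simp
    finally show "sqrt \<theta> \<le> e / (2 * (\<bar>C\<bar> + 1))" .
  qed (use \<open>\<theta> > 0\<close> in auto)
  also have "\<dots> = e / 2" by (simp add: field_simps)
  finally show False using e by simp
qed

text \<open>A Hopf-type barrier \<open>\<psi>\<close> is compared with \<open>K - V\<close> in the
  slanted tube between the times \<tau> and \<open>t1\<close>. It vanishes on the lateral sides and
  is small at \<open>t1\<close>. At the bottom, where \<open>V\<close> may touch \<open>K\<close>,
  no bound is available; since time runs backward none is needed, and the term
  \<open>\<epsilon> / (t - \<tau>)\<close> takes its place until \<epsilon> tends to 0.\<close>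

lemma tube_lower_bound:
  assumes x01: "0 < x0" "x0 < b" "0 < x1" "x1 < b" and t01: "0 < t0" "t0 \<le> \<tau>" "\<tau> < t1" "t1 < T"
    and m: "\<xi> = (\<lambda>t. x1 + m * (t - t1))"
    and d: "d > 0" "\<And>t x. t0 \<le> t \<Longrightarrow> t \<le> t1 \<Longrightarrow> \<bar>x - \<xi> t\<bar> \<le> d \<Longrightarrow> xl \<le> x \<and> x \<le> b - \<beta>"
    and xl: "xl > 0" and \<beta>: "\<beta> > 0"
    and top: "\<And>x. \<bar>x - x1\<bar> \<le> d \<Longrightarrow> V (x, t1) < K"
    and below: "\<And>t x. \<tau> < t \<Longrightarrow> t \<le> t1 \<Longrightarrow> \<bar>x - \<xi> t\<bar> \<le> d \<Longrightarrow> V (x, t) < K"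
  shows "\<exists>\<eta>>0. \<forall>t x. \<tau> < t \<longrightarrow> t \<le> t1 \<longrightarrow> \<bar>x - \<xi> t\<bar> \<le> d \<longrightarrow> \<eta> * (d\<^sup>2 - (x - \<xi> t)\<^sup>2) \<le> K - V (x, t)"
proof -
  have inD: "(x, t) \<in> D" if "t0 \<le> t" "t \<le> t1" "\<bar>x - \<xi> t\<bar> \<le> d" for x t
    using d(2)[OF that] xl \<beta> t01 that by (simp add: mem_D)
  define A where "A = 2 * d * (\<bar>m\<bar> + \<bar>r - q\<bar> * b)"
  define M where "M = (1 + A / (\<sigma>\<^sup>2 * xl\<^sup>2)) / (4 * d\<^sup>2)"
  define \<mu> where "\<mu> = r + 2 * M * A + 6 * M * \<sigma>\<^sup>2 * b\<^sup>2"
  have A0: "A \<ge> 0" unfolding A_def using d b_pos by (intro mult_nonneg_nonneg add_nonneg_nonneg) auto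
  have M0: "M \<ge> 0" unfolding M_def using A0 by (intro divide_nonneg_nonneg add_nonneg_nonneg) auto
  have \<mu>0: "\<mu> \<ge> 0" unfolding \<mu>_def using A0 M0 params by (intro add_nonneg_nonneg mult_nonneg_nonneg) auto
  define p where "p = (\<lambda>z. d\<^sup>2 - (fst z - \<xi> (snd z))\<^sup>2)"
  define \<Phi> where "\<Phi> = d\<^sup>2 + M * (d\<^sup>2)\<^sup>2"
  have \<Phi>: "\<Phi> > 0" unfolding \<Phi>_def using d(1) M0 by (intro add_pos_nonneg) auto
  have p01: "0 \<le> p (x, t)" "p (x, t) \<le> d\<^sup>2" if "\<bar>x - \<xi> t\<bar> \<le> d" for x t
    using that d(1) by (auto simp: p_def abs_le_square_iff[symmetric])
  have \<phi>\<Phi>: "p z + M * (p z)\<^sup>2 \<le> \<Phi>" if "0 \<le> p z" "p z \<le> d\<^sup>2" for z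
    unfolding \<Phi>_def using that M0 by (intro add_mono mult_left_mono power_mono) auto
  have "continuous_on {x1 - d..x1 + d} (\<lambda>x. V (x, t1))"
  proof (rule continuous_on_compose2[OF V_cont_D])
    show "(\<lambda>x. (x, t1)) ` {x1 - d..x1 + d} \<subseteq> D"
      using inD[of t1] t01 by (auto simp: m abs_le_iff)
  qed (auto intro!: continuous_intros)
  then obtain xm where xm: "xm \<in> {x1 - d..x1 + d}" "\<And>x. x \<in> {x1 - d..x1 + d} \<Longrightarrow> V (x, t1) \<le> V (xm, t1)"
    using continuous_attains_sup[of "{x1 - d..x1 + d}" "\<lambda>x. V (x, t1)"] d(1) by auto
  define \<eta>0 where "\<eta>0 = K - V (xm, t1)"
  have \<eta>0: "\<eta>0 > 0" using top[of xm] xm(1) by (simp add: \<eta>0_def abs_le_iff)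
  \<comment> \<open>Below \<eta>0, the least value of \<open>K - V\<close> at the top, the barrier
    is admissible there. Below \<open>\<gamma> * \<beta>\<close>, a failure
    \<open>K - V < \<psi>\<close> implies \<open>V > \<gamma> * x\<close>, because the tube stays
    \<beta> away from \<open>b\<close>; such a point is off the lower obstacle and
    \<open>- V\<close> is a supersolution there.\<close>
  define \<eta> where "\<eta> = min \<eta>0 (\<gamma> * \<beta>) / (2 * \<Phi>)"
  have \<eta>: "\<eta> > 0" "\<eta> * \<Phi> < \<eta>0" "\<eta> * \<Phi> < \<gamma> * \<beta>"
  proof -
    have "\<gamma> * \<beta> > 0" using params \<beta> by simp
    then have "min \<eta>0 (\<gamma> * \<beta>) > 0" "min \<eta>0 (\<gamma> * \<beta>) / 2 < \<eta>0" "min \<eta>0 (\<gamma> * \<beta>) / 2 < \<gamma> * \<beta>"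
      using \<eta>0 by auto
    then show "\<eta> > 0" "\<eta> * \<Phi> < \<eta>0" "\<eta> * \<Phi> < \<gamma> * \<beta>"
      using \<Phi> by (auto simp: \<eta>_def)
  qed
  define \<psi> where "\<psi> = (\<lambda>z. \<eta> * (exp (\<mu> * (snd z - t1)) * (p z + M * (p z)\<^sup>2)))"
  have \<psi>_le: "\<psi> (x, t) \<le> \<eta> * \<Phi>" if "\<bar>x - \<xi> t\<bar> \<le> d" "t \<le> t1" for x t
  proof -
    have "exp (\<mu> * (t - t1)) \<le> 1" using that \<mu>0 by (simp add: mult_le_0_iff)
    then have "exp (\<mu> * (t - t1)) * (p (x, t) + M * (p (x, t))\<^sup>2) \<le> 1 * \<Phi>"
      using \<phi>\<Phi>[OF p01[OF that(1)]] p01[OF that(1)] M0 by (intro mult_mono) auto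
    then show ?thesis unfolding \<psi>_def using \<eta>(1) by (simp add: mult_left_mono)
  qed
  have main: "0 \<le> K - V (x, t) - \<psi> (x, t) + \<epsilon> / (t - \<tau>)"
    if \<epsilon>: "\<epsilon> > 0" and t: "\<tau> < t" "t \<le> t1" and x: "\<bar>x - \<xi> t\<bar> \<le> d" for \<epsilon> t x
  proof -
    \<comment> \<open>At time \<open>\<tau> + \<delta>\<close> the term
      \<open>\<epsilon> / \<delta>\<close> already dominates the barrier, so the comparison cannot
      fail at the bottom.\<close>
    define \<delta> where "\<delta> = min (t - \<tau>) (\<epsilon> / (\<eta> * \<Phi>))"
    have \<delta>: "\<delta> > 0" "\<delta> \<le> t - \<tau>" "\<delta> \<le> \<epsilon> / (\<eta> * \<Phi>)" using \<epsilon> \<eta> \<Phi> t by (auto simp: \<delta>_def)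
    define Q where "Q = {z. \<tau> + \<delta> \<le> snd z \<and> snd z \<le> t1 \<and> \<bar>fst z - \<xi> (snd z)\<bar> \<le> d}"
    have c\<xi>: "continuous_on S (\<lambda>z. \<xi> (snd z))" for S :: "(real \<times> real) set"
      unfolding m by (intro continuous_intros)
    have QD: "Q \<subseteq> D" using inD \<delta>(1) t01 by (auto simp: Q_def)
    define U where "U = {z :: real \<times> real. \<tau> < snd z \<and> snd z < t1 \<and> \<bar>fst z - \<xi> (snd z)\<bar> < d \<and> 0 < fst z}"
    have openU: "open U" unfolding U_def
      by (intro open_Collect_conj open_Collect_less continuous_intros c\<xi>)
    let ?W = "\<lambda>z. K - \<psi> z + \<epsilon> / (snd z - \<tau>)"
    let ?y = "\<lambda>z. fst z - \<xi> (snd z)" and ?E = "\<lambda>z. \<eta> * exp (\<mu> * (snd z - t1))"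
    let ?Wx = "\<lambda>z. - ?E z * ((1 + 2 * M * p z) * (- 2 * ?y z))"
    let ?Wxx = "\<lambda>z. - ?E z * (- 2 * (1 + 2 * M * p z) + 8 * M * (?y z)\<^sup>2)"
    let ?Wt = "\<lambda>z. - ?E z * (\<mu> * (p z + M * (p z)\<^sup>2) + (1 + 2 * M * p z) * (2 * ?y z * m)) - \<epsilon> / (snd z - \<tau>)\<^sup>2"
    have cW: "continuous_on {z. \<tau> < snd z} ?W"
      unfolding \<psi>_def p_def by (intro continuous_intros c\<xi>) auto
    have clW: "classical_on U ?W ?Wx ?Wxx ?Wt"
      unfolding classical_on_def
    proof (intro conjI ballI)
      show "continuous_on U ?W" by (rule continuous_on_subset[OF cW]) (auto simp: U_def)
      fix z assume "z \<in> U"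
      then have z: "\<tau> < snd z" by (simp add: U_def)
      show "((\<lambda>x. ?W (x, snd z)) has_real_derivative ?Wx z) (at (fst z))"
        unfolding \<psi>_def p_def
        by (auto intro!: derivative_eq_intros simp: algebra_simps)
      show "((\<lambda>x. ?Wx (x, snd z)) has_real_derivative ?Wxx z) (at (fst z))"
        unfolding p_def
        by (auto intro!: derivative_eq_intros simp: algebra_simps power2_eq_square)
      show "((\<lambda>t. ?W (fst z, t)) has_real_derivative ?Wt z) (at (snd z))"
      proof -
        have dp: "((\<lambda>t. p (fst z, t)) has_real_derivative 2 * ?y z * m) (at (snd z))"
          unfolding p_def m by (auto intro!: derivative_eq_intros simp: algebra_simps)
        have d\<phi>: "((\<lambda>t. p (fst z, t) + M * (p (fst z, t))\<^sup>2) has_real_derivative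
            (1 + 2 * M * p z) * (2 * ?y z * m)) (at (snd z))"
          by (auto intro!: derivative_eq_intros dp simp: algebra_simps)
        have de: "((\<lambda>t. \<eta> * exp (\<mu> * (t - t1))) has_real_derivative ?E z * \<mu>) (at (snd z))"
          by (auto intro!: derivative_eq_intros)
        have di: "((\<lambda>t. \<epsilon> / (t - \<tau>)) has_real_derivative - (\<epsilon> / (snd z - \<tau>)\<^sup>2)) (at (snd z))"
          using z by (auto intro!: derivative_eq_intros simp: power2_eq_square)
        show ?thesis
          using DERIV_add[OF DERIV_diff[OF DERIV_const[of K] DERIV_mult[OF de d\<phi>]] di]
          by (simp add: \<psi>_def mult.assoc) (simp add: algebra_simps)
      qed
    qed
    have opW: "r * K \<le> cb_operator \<sigma> r q ?W ?Wx ?Wxx ?Wt z" if "z \<in> U" for z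
    proof -
      have z: "\<tau> < snd z" "snd z < t1" "\<bar>?y z\<bar> \<le> d" using that by (auto simp: U_def)
      have zx: "xl \<le> fst z" "fst z \<le> b" using d(2)[of "snd z" "fst z"] z t01 \<beta> by auto
      let ?\<Psi> = "\<mu> * (p z + M * (p z)\<^sup>2) + (1 + 2 * M * p z) * (2 * ?y z * m)
          + 1/2 * \<sigma>\<^sup>2 * (fst z)\<^sup>2 * (- 2 * (1 + 2 * M * p z) + 8 * M * (?y z)\<^sup>2)
          + (r - q) * fst z * (1 + 2 * M * p z) * (- 2 * ?y z) - r * (p z + M * (p z)\<^sup>2)"
      have "cb_operator \<sigma> r q ?W ?Wx ?Wxx ?Wt z = r * K + \<epsilon> / (snd z - \<tau>)\<^sup>2 + r * (\<epsilon> / (snd z - \<tau>))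
        + ?E z * ?\<Psi>"
        unfolding cb_operator_def \<psi>_def by (simp add: algebra_simps)
      moreover have "0 \<le> ?\<Psi>"
        using tube_barrier_inequality[OF z(3) _ xl zx d(1) params(4) A_def M_def \<mu>_def, of "p z"]
        by (simp add: p_def)
      moreover have "\<epsilon> / (snd z - \<tau>)\<^sup>2 \<ge> 0" "r * (\<epsilon> / (snd z - \<tau>)) \<ge> 0" using \<epsilon> z params by auto
      moreover have "?E z \<ge> 0" using \<eta>(1) by simp
      ultimately show ?thesis using mult_nonneg_nonneg by (smt (verit, best))
    qed
    have "0 \<le> (- 1) * V (x, t) + ?W (x, t)"
    proof (rule minimum_principle[where Q=Q and g="\<lambda>z. (- 1) * V z + ?W z" and z="(x, t)" and r=r and q=q and \<sigma>=\<sigma>])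
      show "(x, t) \<in> Q" using t x \<delta> by (simp add: Q_def)
      show "compact Q"
      proof (rule compact_eq_bounded_closed[THEN iffD2], intro conjI)
        have "Q \<subseteq> cbox (0, 0) (b, T)"
          using QD D_subset_cbox by blast
        then show "bounded Q" using bounded_cbox bounded_subset by blast
        show "closed Q" unfolding Q_def
          by (intro closed_Collect_conj closed_Collect_le continuous_intros c\<xi>)
      qed
      show "continuous_on Q (\<lambda>z. (- 1) * V z + ?W z)"
        by (intro continuous_on_add continuous_on_mult continuous_on_const continuous_on_subset[OF V_cont_D QD]
            continuous_on_subset[OF cW]) (use \<delta>(1) in \<open>auto simp: Q_def\<close>)
      fix z assume zQ: "z \<in> Q" and neg: "(- 1) * V z + ?W z < 0"
      obtain y s where z: "z = (y, s)" by (cases z)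
      have ys: "\<tau> + \<delta> \<le> s" "s \<le> t1" "\<bar>y - \<xi> s\<bar> \<le> d" using zQ by (auto simp: Q_def z)
      have sp: "\<tau> < s" using ys \<delta> by simp
      have zD: "z \<in> D" using zQ QD by blast
      have VK: "V z < K" using below[OF sp ys(2,3)] by (simp add: z)
      have \<epsilon>s: "\<epsilon> / (s - \<tau>) > 0" using \<epsilon> sp by simp
      then have less: "K - V z < \<psi> z" using neg by (simp add: z)
      have \<psi>1: "\<psi> z \<le> \<eta> * \<Phi>" using \<psi>_le[OF ys(3,2)] by (simp add: z)
      have "s \<noteq> t1"
      proof
        assume "s = t1"
        then have "V z \<le> V (xm, t1)" using xm(2)[of y] ys(3) by (auto simp: z m abs_le_iff)
        then show False using less \<psi>1 \<eta>(2) by (simp add: \<eta>0_def)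
      qed
      moreover have "s \<noteq> \<tau> + \<delta>"
      proof
        assume "s = \<tau> + \<delta>"
        moreover have "\<eta> * \<Phi> \<le> \<epsilon> / \<delta>" using \<delta>(1,3) \<eta>(1) \<Phi> by (simp add: field_simps)
        ultimately show False using neg VK \<psi>1 by (simp add: z)
      qed
      moreover have "\<bar>y - \<xi> s\<bar> \<noteq> d"
      proof
        assume "\<bar>y - \<xi> s\<bar> = d"
        then have "(y - \<xi> s)\<^sup>2 = d\<^sup>2" by (metis power2_abs)
        then have "p z = 0" by (simp add: p_def z)
        then show False using less VK by (simp add: \<psi>_def)
      qed
      ultimately have ys': "\<tau> + \<delta> < s" "s < t1" "\<bar>y - \<xi> s\<bar> < d" using ys by auto
      have "open {z :: real \<times> real. \<tau> + \<delta> < snd z \<and> snd z < t1 \<and> \<bar>fst z - \<xi> (snd z)\<bar> < d}"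
        by (intro open_Collect_conj open_Collect_less continuous_intros c\<xi>)
      then have "z \<in> interior Q"
        by (rule interiorI) (use ys' in \<open>auto simp: z Q_def\<close>)
      moreover have sV: "supersol \<sigma> r q (\<lambda>z. (- 1) * V z) z ((- 1) * c)"
      proof (rule supersol_V_continuation[OF zD _ VK])
        have "y \<le> b - \<beta>" using d(2)[OF _ ys(2,3)] sp t01 by simp
        then have "\<gamma> * y \<le> \<gamma> * (b - \<beta>)" using params by (intro mult_left_mono) auto
        then have "\<gamma> * y \<le> K - \<gamma> * \<beta>" using \<gamma>_b by (simp add: right_diff_distrib)
        then show "\<gamma> * fst z < V z" using less \<psi>1 \<eta>(3) by (simp add: z)
      qed
      moreover have sW: "supersol \<sigma> r q ?W z (r * K)"
      proof (rule supersol_classical[OF openU _ clW opW])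
        show "z \<in> U" using ys' sp zD by (simp add: U_def z mem_D)
      qed
      \<comment> \<open>The condition \<open>c < r * K\<close> enters here, through
        \<open>- c + r * K \<ge> 0\<close>.\<close>
      moreover have "supersol \<sigma> r q (\<lambda>z. (- 1) * V z + ?W z) z 0"
        by (rule supersol_mono[OF supersol_add[OF sV sW]]) (use params in simp)
      ultimately show "z \<in> interior Q \<and> supersol \<sigma> r q (\<lambda>z. (- 1) * V z + ?W z) z 0"
        by blast
    qed (rule params)
    then show ?thesis by simp
  qed
  show ?thesis
  \<comment> \<open>Bounding the exponential by its value at \<open>t0\<close> and dropping the term
    with \<open>M\<close> leaves a constant that no longer depends on the time.\<close>
  proof (intro exI[of _ "\<eta> * exp (\<mu> * (t0 - t1))"] conjI allI impI)
    show "\<eta> * exp (\<mu> * (t0 - t1)) > 0" using \<eta>(1) by simp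
    fix t x assume t: "\<tau> < t" "t \<le> t1" and x: "\<bar>x - \<xi> t\<bar> \<le> d"
    have "\<psi> (x, t) \<le> K - V (x, t)"
    proof (rule field_le_epsilon)
      fix e :: real assume "e > 0"
      then show "\<psi> (x, t) \<le> K - V (x, t) + e"
        using main[OF _ t x, of "e * (t - \<tau>)"] t by simp
    qed
    moreover have "\<eta> * exp (\<mu> * (t0 - t1)) * p (x, t) \<le> \<psi> (x, t)"
    proof -
      have "\<mu> * (t0 - t1) \<le> \<mu> * (t - t1)" using t t01 \<mu>0 by (intro mult_left_mono) auto
      then have "exp (\<mu> * (t0 - t1)) * p (x, t) \<le> exp (\<mu> * (t - t1)) * (p (x, t) + M * (p (x, t))\<^sup>2)"
        using p01[OF x] M0 by (intro mult_mono) auto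
      then show ?thesis using \<eta>(1) by (simp add: \<psi>_def mult.assoc mult_left_mono)
    qed
    ultimately show "\<eta> * exp (\<mu> * (t0 - t1)) * (d\<^sup>2 - (x - \<xi> t)\<^sup>2) \<le> K - V (x, t)"
      by (simp add: p_def)
  qed
qed

text \<open>Move along a thin tube from \<open>(x1, t1)\<close> back to \<open>(x0, t0)\<close>. At the last time at which \<open>V = K\<close> somewhere in
  the tube, the barrier forces \<open>K - V\<close> to grow linearly away from such a point.\<close>

lemma less_K_propagates_backward:
  assumes z1: "(x1, t1) \<in> D" "V (x1, t1) < K" and x0: "0 < x0" "x0 < b" and t0: "0 < t0" "t0 < t1"
  shows "V (x0, t0) < K"
proof (rule ccontr)
  assume "\<not> V (x0, t0) < K"
  have x1: "0 < x1" "x1 < b" "t1 < T" using z1(1) by (auto simp: mem_D)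
  then have V0: "V (x0, t0) = K"
    using \<open>\<not> V (x0, t0) < K\<close> V_bounds(2)[of x0 t0] x0 t0 by simp
  define m where "m = (x1 - x0) / (t1 - t0)"
  define \<xi> where "\<xi> = (\<lambda>t. x1 + m * (t - t1))"
  define lo hi where "lo = min x0 x1" and "hi = max x0 x1"
  have lohi: "0 < lo" "hi < b" using x0 x1 by (auto simp: lo_def hi_def)
  have \<xi>01: "\<xi> t0 = x0" "\<xi> t1 = x1" using t0 by (simp_all add: \<xi>_def m_def field_simps)
  have \<xi>: "lo \<le> \<xi> t \<and> \<xi> t \<le> hi" if "t0 \<le> t" "t \<le> t1" for t
  proof -
    define u where "u = (t1 - t) / (t1 - t0)"
    have u: "0 \<le> u" "u \<le> 1" using that t0 by (auto simp: u_def field_simps)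
    have "\<xi> t = (1 - u) * x1 + u * x0"
    proof -
      have "m * (t - t1) = - (m * (t1 - t))" "m * (t1 - t) = (x1 - x0) * u"
        by (simp add: algebra_simps, simp add: m_def u_def)
      then show ?thesis by (simp add: \<xi>_def algebra_simps)
    qed
    moreover have "(1 - u) * lo + u * lo \<le> (1 - u) * x1 + u * x0" "(1 - u) * x1 + u * x0 \<le> (1 - u) * hi + u * hi"
      using u by (auto simp: lo_def hi_def intro!: add_mono mult_left_mono)
    ultimately show ?thesis by (simp add: algebra_simps)
  qed
  have "open (D \<inter> V -` {..<K})"
    by (rule continuous_open_preimage[OF V_cont_D open_D]) auto
  then obtain e where e: "e > 0" "cball (x1, t1) e \<subseteq> D \<inter> V -` {..<K}"
    using z1 open_contains_cball by blast
  define d where "d = min e (min (lo / 2) ((b - hi) / 2))"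
  have d: "d > 0" "d \<le> e" "d \<le> lo / 2" "d \<le> (b - hi) / 2"
  proof -
    have "e > 0" "lo / 2 > 0" "(b - hi) / 2 > 0" using e lohi by auto
    then show "d > 0" unfolding d_def by (simp only: min_less_iff_conj)
    show "d \<le> e" "d \<le> lo / 2" "d \<le> (b - hi) / 2"
      unfolding d_def using min.cobounded1 min.cobounded2 order_trans by metis+
  qed
  have tube: "lo / 2 \<le> x \<and> x \<le> b - (b - hi) / 2" if "t0 \<le> t" "t \<le> t1" "\<bar>x - \<xi> t\<bar> \<le> d" for t x
    using \<xi>[OF that(1,2)] that(3) d by (auto simp: abs_le_iff field_simps)
  have top: "V (x, t1) < K" if "\<bar>x - x1\<bar> \<le> d" for x
  proof -
    have "(x, t1) \<in> cball (x1, t1) e"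
      using that d(2) dist_Pair_le[of x1 t1 x t1] by (simp add: abs_minus_commute)
    then show ?thesis using e(2) by auto
  qed
  define Q where "Q = {z. t0 \<le> snd z \<and> snd z \<le> t1 \<and> \<bar>fst z - \<xi> (snd z)\<bar> \<le> d}"
  have QD: "Q \<subseteq> D"
  proof
    fix z assume "z \<in> Q"
    then have z: "t0 \<le> snd z" "snd z \<le> t1" "\<bar>fst z - \<xi> (snd z)\<bar> \<le> d" by (auto simp: Q_def)
    have half: "B - (B - h) / 2 < B" if "h < B" for B h :: real using that by (simp add: field_simps)
    have "0 < fst z" "fst z < b"
      using tube[OF z] lohi(1) half[OF lohi(2)] by (linarith, blast intro: le_less_trans)
    then show "z \<in> D" using z t0 x1(3) by (cases z) (simp add: mem_D)
  qed
  have "closed Q" unfolding Q_def \<xi>_def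
    by (intro closed_Collect_conj closed_Collect_le continuous_intros)
  \<comment> \<open>Compactness provides a contact point of maximal time. That time is before
    \<open>t1\<close>, since \<open>V < K\<close> across the top of the tube.\<close>
  define S where "S = Q \<inter> V -` {K}"
  have "closed S" unfolding S_def
    by (rule continuous_closed_preimage[OF continuous_on_subset[OF V_cont_D QD] \<open>closed Q\<close>]) simp
  moreover have "S \<subseteq> cbox (0, 0) (b, T)"
    using QD D_subset_cbox unfolding S_def by blast
  ultimately have "compact S"
    using bounded_cbox bounded_subset compact_eq_bounded_closed by blast
  moreover have "(x0, t0) \<in> S" using V0 \<xi>01 d(1) t0 by (simp add: S_def Q_def)
  ultimately obtain z2 where z2: "z2 \<in> S" "\<And>z. z \<in> S \<Longrightarrow> snd z \<le> snd z2"
    using continuous_attains_sup[of S snd] continuous_on_snd[OF continuous_on_id, of S] by fastforce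
  obtain x2 \<tau> where x2\<tau>: "z2 = (x2, \<tau>)" by (cases z2)
  have \<tau>: "t0 \<le> \<tau>" "\<tau> \<le> t1" "\<bar>x2 - \<xi> \<tau>\<bar> \<le> d" "V (x2, \<tau>) = K" using z2(1) by (auto simp: x2\<tau> S_def Q_def)
  have "\<tau> \<noteq> t1" using top[of x2] \<tau> \<xi>01 by auto
  then have \<tau>1: "\<tau> < t1" using \<tau> by simp
  have z2D: "(x2, \<tau>) \<in> D" using z2(1) QD by (auto simp: x2\<tau> S_def)
  have below: "V (x, t) < K" if "\<tau> < t" "t \<le> t1" "\<bar>x - \<xi> t\<bar> \<le> d" for t x
  proof -
    have "(x, t) \<in> Q" using that \<tau> by (simp add: Q_def)
    moreover have "(x, t) \<notin> S" using z2(2)[of "(x, t)"] that by (auto simp: x2\<tau>)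
    ultimately have "V (x, t) \<noteq> K" "(x, t) \<in> D" using QD by (auto simp: S_def)
    then show ?thesis using V_bounds(2)[of x t] by (auto simp: mem_D)
  qed
  have pos: "lo / 2 > 0" "(b - hi) / 2 > 0" using lohi by auto
  have "\<exists>\<eta>>0. \<forall>t x. \<tau> < t \<longrightarrow> t \<le> t1 \<longrightarrow> \<bar>x - \<xi> t\<bar> \<le> d \<longrightarrow> \<eta> * (d\<^sup>2 - (x - \<xi> t)\<^sup>2) \<le> K - V (x, t)"
    by (rule tube_lower_bound[OF x0 x1(1,2) t0(1) \<tau>(1) \<tau>1 x1(3) \<xi>_def d(1) _ pos]; rule tube top below)
  then obtain \<eta> where \<eta>: "\<eta> > 0"
    "\<And>t x. \<tau> < t \<Longrightarrow> t \<le> t1 \<Longrightarrow> \<bar>x - \<xi> t\<bar> \<le> d \<Longrightarrow> \<eta> * (d\<^sup>2 - (x - \<xi> t)\<^sup>2) \<le> K - V (x, t)"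
    by blast
  \<comment> \<open>The side of the axis on which the contact point lies:
    \<open>x2 - s * \<theta> * y\<close> moves towards the axis, or crosses it slightly, and hence
    works also for a contact point on the lateral boundary, where the barrier vanishes.\<close>
  define s :: real where "s = (if \<xi> \<tau> \<le> x2 then 1 else - 1)"
  have s: "s = 1 \<or> s = - 1" "s * (x2 - \<xi> \<tau>) = \<bar>x2 - \<xi> \<tau>\<bar>" by (auto simp: s_def)
  \<comment> \<open>The bounds keep the later time below \<open>t1\<close>, prevent the inward step
    from reaching the opposite side, and limit the drift of the axis to \<open>\<theta> / 4\<close>,
    half of the smallest inward step \<open>\<theta> / 2\<close>. So at least
    \<open>\<theta> / 4\<close> of distance to the lateral boundary is gained.\<close>
  define \<theta>0 where "\<theta>0 = min (min 1 (t1 - \<tau>)) (min (d / 2) (1 / (4 * (\<bar>m\<bar> + 1))))"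
  have \<theta>0: "\<theta>0 > 0" "\<theta>0 \<le> 1" "\<theta>0 \<le> t1 - \<tau>" "\<theta>0 \<le> d / 2" "\<theta>0 \<le> 1 / (4 * (\<bar>m\<bar> + 1))"
  proof -
    show "\<theta>0 > 0" using d(1) \<tau>1 by (simp add: \<theta>0_def)
    show "\<theta>0 \<le> 1" "\<theta>0 \<le> t1 - \<tau>" "\<theta>0 \<le> d / 2" "\<theta>0 \<le> 1 / (4 * (\<bar>m\<bar> + 1))"
      unfolding \<theta>0_def using min.cobounded1 min.cobounded2 order_trans by metis+
  qed
  show False
  proof (rule no_linear_growth_at_max[OF z2D \<tau>(4) _ s(1) \<theta>0(1), of "\<eta> * d / 4"])
    show "0 < \<eta> * d / 4" using \<eta> d by simp
    fix \<theta> y \<zeta> :: real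
    assume \<theta>: "0 < \<theta>" "\<theta> \<le> \<theta>0" and y: "1/2 \<le> y" "y \<le> 3/4" and \<zeta>: "1/2 \<le> \<zeta>" "\<zeta> \<le> 3/4"
    let ?x = "x2 - s * \<theta> * y" and ?t = "\<tau> + \<theta>\<^sup>2 * \<zeta>"
    have "\<theta>\<^sup>2 \<le> \<theta>" using \<theta> \<theta>0 by (simp add: power2_eq_square mult_left_le)
    then have "\<theta>\<^sup>2 * \<zeta> \<le> \<theta> * 1" using \<zeta> \<theta> by (intro mult_mono) auto
    then have t: "\<tau> < ?t" "?t \<le> t1" using \<theta> \<zeta> \<theta>0 by auto
    define w where "w = ?x - \<xi> ?t"
    have "\<bar>m\<bar> * \<theta> \<le> 1/4"
    proof -
      have "\<theta> * (4 * (\<bar>m\<bar> + 1)) \<le> 1"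
        using \<theta> \<theta>0(5) by (subst pos_le_divide_eq[symmetric]) auto
      then show ?thesis using \<theta> by (simp add: algebra_simps)
    qed
    then have "\<bar>m\<bar> * \<theta> * (\<theta> * \<zeta>) \<le> 1/4 * (\<theta> * 1)" using \<theta> \<zeta> by (intro mult_mono) auto
    then have "\<bar>s * m * \<theta>\<^sup>2 * \<zeta>\<bar> \<le> \<theta> / 4"
      using s(1) \<theta> \<zeta> by (auto simp: abs_mult power2_eq_square mult_ac)
    moreover have "s * w = \<bar>x2 - \<xi> \<tau>\<bar> - \<theta> * y - s * m * \<theta>\<^sup>2 * \<zeta>"
    proof -
      have "w = (x2 - \<xi> \<tau>) - s * \<theta> * y - m * \<theta>\<^sup>2 * \<zeta>" by (simp add: w_def \<xi>_def algebra_simps)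
      then have "s * w = s * ((x2 - \<xi> \<tau>) - s * \<theta> * y - m * \<theta>\<^sup>2 * \<zeta>)" by (rule arg_cong)
      then have "s * w = s * (x2 - \<xi> \<tau>) - (s * s) * \<theta> * y - s * m * \<theta>\<^sup>2 * \<zeta>"
        by (simp only: right_diff_distrib mult.assoc)
      moreover have "s * s = 1" using s(1) by auto
      ultimately show ?thesis using s(2) by simp
    qed
    moreover have "\<theta> / 2 \<le> \<theta> * y" "\<theta> * y \<le> 3/4 * \<theta>" using \<theta> y by (auto simp: field_simps)
    ultimately have "s * w \<le> d - \<theta> / 4" "- (s * w) \<le> d - \<theta> / 4"
      using \<tau>(3) \<theta> \<theta>0(4) by linarith+
    then have w: "\<bar>w\<bar> \<le> d - \<theta> / 4" using s(1) by auto
    then have "w\<^sup>2 \<le> (d - \<theta> / 4)\<^sup>2" by (metis abs_ge_zero power2_abs power_mono)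
    also have "\<dots> = d\<^sup>2 - \<theta> * d / 2 + \<theta> * \<theta> / 16" by (simp add: power2_eq_square field_simps)
    also have "\<dots> \<le> d\<^sup>2 - \<theta> * d / 4"
    proof -
      have "\<theta> * \<theta> \<le> \<theta> * d" using \<theta> \<theta>0(4) d by (intro mult_left_mono) auto
      moreover have "\<theta> * d \<ge> 0" using \<theta> d by simp
      ultimately show ?thesis by linarith
    qed
    finally have "\<theta> * d / 4 \<le> d\<^sup>2 - w\<^sup>2" by simp
    then have "\<eta> * (\<theta> * d / 4) \<le> \<eta> * (d\<^sup>2 - w\<^sup>2)" using \<eta>(1) by (intro mult_left_mono) auto
    also have "\<dots> \<le> K - V (?x, ?t)"
      unfolding w_def by (rule \<eta>(2)[OF t]) (use w \<theta> in \<open>simp add: w_def\<close>)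
    finally show "\<eta> * d / 4 * \<theta> \<le> K - V (?x, ?t)" by (simp add: mult_ac)
  qed
qed

end

section \<open>Shape of the conversion region\<close>

context cb_problem
begin

text \<open>Contrapositive of \<open>less_K_propagates_backward\<close>, which needs strictly
  ordered times. The time \<open>t0\<close> itself follows by continuity from later times.\<close>

lemma V_eq_K_propagates_forward:
  assumes "(x0, t0) \<in> D" "V (x0, t0) = K" "0 < x" "x < b" "t0 \<le> t" "t < T"
  shows "V (x, t) = K"
proof -
  have t0: "0 < t0" "0 < x0" "x0 < b" using assms(1) by (auto simp: mem_D)
  have later: "V (x, s) = K" if "t0 < s" "s < T" for s
  proof (rule ccontr)
    assume "V (x, s) \<noteq> K"
    then have "V (x, s) < K" using V_bounds(2)[of x s] assms that t0 by simp
    then show False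
      using less_K_propagates_backward[of x s x0 t0] assms that t0 by (simp add: mem_D)
  qed
  show ?thesis
  proof (cases "t = t0")
    case True
    have "(x, t0) \<in> D" using assms t0 by (simp add: mem_D)
    then have "isCont V (x, t0)"
      using V_cont_D open_D continuous_on_eq_continuous_at by blast
    then have "((\<lambda>s. V (x, s)) \<longlongrightarrow> V (x, t0)) (at_right t0)"
      by (rule isCont_tendsto_compose) (auto intro!: tendsto_eq_intros)
    moreover have "((\<lambda>s. V (x, s)) \<longlongrightarrow> K) (at_right t0)"
      by (rule tendsto_eventually, rule eventually_at_rightI[of t0 T]) (use later assms in auto)
    ultimately show ?thesis using True tendsto_unique trivial_limit_at_right_real by blast
  next
    case False
    then show ?thesis using later assms by simp
  qed
qed

text \<open>The left side is the price of the zero-coupon bond: it is annihilated by the operator,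
  equals \<open>K\<close> at maturity and is at most \<open>K\<close> on the side, while
  \<open>c \<ge> 0\<close> makes \<open>V\<close> a supersolution of the homogeneous
  equation.\<close>

lemma V_lower_bound:
  assumes "0 < x" "x \<le> b" "0 < t" "t \<le> T"
  shows "K * exp (- r * (T - t)) \<le> V (x, t)"
proof -
  let ?E = "\<lambda>z. - K * exp (- r * (T - snd z))"
  have "0 \<le> 1 * V (x, t) + ?E (x, t)"
  proof (rule minimum_principle_quadrant[where g="\<lambda>z. 1 * V z + ?E z" and X=b and T=T and C=K and r=r and q=q and \<sigma>=\<sigma>])
    show "continuous_on ({0<..b} \<times> {0<..T}) (\<lambda>z. 1 * V z + ?E z)"
      by (intro continuous_intros V_cont_quadrant)
    have e: "exp (- r * (T - t)) \<le> 1" if "t \<le> T" for t using that params by simp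
    show "- K \<le> 1 * V (x, t) + ?E (x, t)" if "0 < x" "x \<le> b" "0 < t" "t \<le> T" for x t
    proof -
      have "K * exp (- r * (T - t)) \<le> K * 1" using e[OF that(4)] params by (intro mult_left_mono) auto
      moreover have "0 \<le> \<gamma> * x" using that params by simp
      ultimately show ?thesis using V_bounds(1)[OF that] by simp
    qed
    show "0 \<le> 1 * V (b, t) + ?E (b, t)" if "0 < t" "t \<le> T" for t
      using e[OF that(2)] V_side[of t] that params by simp
    show "0 \<le> 1 * V (x, T) + ?E (x, T)" if "0 < x" "x \<le> b" for x
      using V_top[of x] that by simp
    fix x t assume xt: "0 < x" "x < b" "0 < t" "t < T"
    have "supersol \<sigma> r q (\<lambda>z. 1 * V z) (x, t) (1 * c)"
      using xt by (intro supersol_V) (auto simp: mem_D)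
    moreover have "supersol \<sigma> r q ?E (x, t) 0"
    proof (rule supersol_classical[OF open_UNIV UNIV_I, where Wx="\<lambda>z. 0" and Wxx="\<lambda>z. 0" and Wt="\<lambda>z. r * ?E z"])
      show "classical_on UNIV ?E (\<lambda>z. 0) (\<lambda>z. 0) (\<lambda>z. r * ?E z)"
        unfolding classical_on_def by (auto intro!: continuous_intros derivative_eq_intros)
    qed (simp add: cb_operator_def)
    ultimately show "supersol \<sigma> r q (\<lambda>z. 1 * V z + ?E z) (x, t) 0"
      using params by (intro supersol_mono[OF supersol_add]) auto
  qed (use assms params in auto)
  then show ?thesis by simp
qed

text \<open>This says that \<open>V / x\<close> decreases in \<open>x\<close>, so contact with
  \<open>\<gamma> * x\<close> persists to the right. At \<open>x = b / a\<close> the lower obstacle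
  gives \<open>a * V \<ge> K\<close>. Where the inequality fails, \<open>V (a * x, t)\<close> lies
  above \<open>\<gamma> * a * x\<close>; it is not \<open>K\<close>, for then
  \<open>V (x, t) = K\<close> as well. So the equation holds at the dilated point, and the sources
  add up to \<open>a * c - c \<ge> 0\<close>.\<close>

lemma V_dilate:
  assumes a: "1 \<le> a" and x: "0 < x" "a * x \<le> b" and t: "0 < t" "t \<le> T"
  shows "V (a * x, t) \<le> a * V (x, t)"
proof -
  \<comment> \<open>The idle shift \<open>+ 0\<close> matches the form of
    \<open>supersol_dilate_translate\<close>, which handles dilation and translation at
    once.\<close>
  let ?W = "\<lambda>z. - 1 * V (a * fst z, snd z + 0)"
  have ax: "0 < a * x \<and> x \<le> b \<and> a * x \<le> b" if "0 < x" "x \<le> b / a" for x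
  proof -
    have "a * (B / a) = B" for B using a by simp
    then have "a * x \<le> b" using mult_left_mono[OF that(2), of a] a by (metis order_trans zero_le_one)
    moreover have "x \<le> a * x" using that a by simp
    ultimately show ?thesis using that(1) by linarith
  qed
  have "0 \<le> a * V (x, t) + ?W (x, t)"
  proof (rule minimum_principle_quadrant[where g="\<lambda>z. a * V z + ?W z" and X="b / a" and T=T and C=K and r=r and q=q and \<sigma>=\<sigma>])
    show "continuous_on ({0<..b / a} \<times> {0<..T}) (\<lambda>z. a * V z + ?W z)"
    proof (intro continuous_on_add continuous_on_mult continuous_on_const)
      show "continuous_on ({0<..b / a} \<times> {0<..T}) V"
        by (rule continuous_on_subset[OF V_cont_quadrant]) (use ax in auto)
      show "continuous_on ({0<..b / a} \<times> {0<..T}) (\<lambda>z. V (a * fst z, snd z + 0))"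
        by (rule continuous_on_compose2[OF V_cont_quadrant]) (use ax in \<open>auto intro!: continuous_intros\<close>)
    qed
    show "- K \<le> a * V (x, t) + ?W (x, t)" if "0 < x" "x \<le> b / a" "0 < t" "t \<le> T" for x t
    proof -
      have "0 \<le> \<gamma> * x" using that params by simp
      then have "0 \<le> a * V (x, t)" using V_bounds(1)[of x t] ax[OF that(1,2)] that a by simp
      then show ?thesis using V_bounds(2)[of "a * x" t] ax[OF that(1,2)] that by simp
    qed
    show "0 \<le> a * V (b / a, t) + ?W (b / a, t)" if "0 < t" "t \<le> T" for t
    proof -
      have "0 < b / a" using a params by simp
      then have "a * (\<gamma> * (b / a)) \<le> a * V (b / a, t)"
        using V_bounds(1)[of "b / a" t] ax[of "b / a"] that a by (intro mult_left_mono) auto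
      moreover have "a * (\<gamma> * (b / a)) = K" using a params by simp
      moreover have "V (a * fst (b / a, t), snd (b / a, t) + 0) = K"
      proof -
        have "a * (B / a) = B" for B using a by simp
        then show ?thesis unfolding fst_conv snd_conv using V_side[of t] that by (metis add_0_right less_imp_le)
      qed
      ultimately show ?thesis by linarith
    qed
    show "0 \<le> a * V (x, T) + ?W (x, T)" if "0 < x" "x \<le> b / a" for x
      using V_top[of x] V_top[of "a * x"] ax[OF that] that a params by simp
    fix x t assume xt: "0 < x" "x < b / a" "0 < t" "t < T" and neg: "a * V (x, t) + ?W (x, t) < 0"
    have "a * x < a * (b / a)" by (rule mult_strict_left_mono[OF xt(2)]) (use a in linarith)
    moreover have "a * (B / a) = B" for B using a by simp
    ultimately have axb: "a * x < b" by metis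
    have "x \<le> a * x" using xt(1) a by simp
    then have "x < b" "0 < a * x" using axb xt(1) by linarith+
    then have xD: "(x, t) \<in> D" "(a * x, t) \<in> D" using xt axb unfolding mem_D by blast+
    have less: "a * V (x, t) < V (a * x, t)" using neg by simp
    have VK: "V (a * x, t) \<le> K" using V_bounds(2)[of "a * x" t] xD(2) by (simp add: mem_D)
    have "V (a * x, t) \<noteq> K"
    proof
      assume "V (a * x, t) = K"
      then have "V (x, t) = K" using V_eq_K_propagates_forward[OF xD(2)] xD(1) by (simp add: mem_D)
      moreover have "1 * K \<le> a * K" using a params by (intro mult_right_mono) auto
      ultimately show False using less VK by simp
    qed
    moreover have "\<gamma> * (a * x) < V (a * x, t)"
    proof -
      have "a * (\<gamma> * x) \<le> a * V (x, t)" using V_bounds(1)[of x t] xD a by (intro mult_left_mono) (auto simp: mem_D)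
      then show ?thesis using less by (simp add: mult_ac)
    qed
    ultimately have "supersol \<sigma> r q (\<lambda>z. - 1 * V z) (a * x, t + 0) (- 1 * c)"
      using supersol_V_continuation[OF xD(2), of "- 1"] VK by simp
    then have "supersol \<sigma> r q ?W (x, t) (- 1 * c)"
      by (rule supersol_dilate_translate[OF _ a])
    moreover have "supersol \<sigma> r q (\<lambda>z. a * V z) (x, t) (a * c)"
      using supersol_V[OF xD(1), of a] a by simp
    ultimately show "supersol \<sigma> r q (\<lambda>z. a * V z + ?W z) (x, t) 0"
      using params a by (intro supersol_mono[OF supersol_add]) (auto simp: mult_le_cancel_right1)
  qed (use x t a params in \<open>auto simp: field_simps\<close>)
  then show ?thesis by simp
qed

text \<open>The comparison runs up to \<open>T - s\<close>, where the shifted function has its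
  terminal value \<open>K\<close>. A failure at \<open>(x, t)\<close> puts \<open>V\<close> above
  \<open>\<gamma> * x\<close> there, and \<open>V (x, t) = K\<close> would propagate to
  \<open>t + s\<close>; the two sources \<open>c\<close> cancel.\<close>

lemma V_increasing_in_time:
  assumes x: "0 < x" "x \<le> b" and t: "0 < t" "t + s \<le> T" and s: "0 \<le> s"
  shows "V (x, t) \<le> V (x, t + s)"
proof -
  let ?W = "\<lambda>z. 1 * V (1 * fst z, snd z + s)"
  have "0 \<le> - 1 * V (x, t) + ?W (x, t)"
  proof (rule minimum_principle_quadrant[where g="\<lambda>z. - 1 * V z + ?W z" and X=b and T="T - s" and C=K and r=r and q=q and \<sigma>=\<sigma>])
    show "continuous_on ({0<..b} \<times> {0<..T - s}) (\<lambda>z. - 1 * V z + ?W z)"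
    proof (intro continuous_on_add continuous_on_mult continuous_on_const)
      show "continuous_on ({0<..b} \<times> {0<..T - s}) V"
        by (rule continuous_on_subset[OF V_cont_quadrant]) (use s in auto)
      show "continuous_on ({0<..b} \<times> {0<..T - s}) (\<lambda>z. V (1 * fst z, snd z + s))"
        by (rule continuous_on_compose2[OF V_cont_quadrant]) (use s in \<open>auto intro!: continuous_intros\<close>)
    qed
    show "- K \<le> - 1 * V (x, t) + ?W (x, t)" if "0 < x" "x \<le> b" "0 < t" "t \<le> T - s" for x t
    proof -
      have "0 \<le> \<gamma> * x" using that params by simp
      then show ?thesis using V_bounds(2)[of x t] V_bounds(1)[of x "t + s"] that s by simp
    qed
    show "0 \<le> - 1 * V (b, t) + ?W (b, t)" if "0 < t" "t \<le> T - s" for t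
      using V_side[of t] V_side[of "t + s"] that s by simp
    show "0 \<le> - 1 * V (x, T - s) + ?W (x, T - s)" if "0 < x" "x \<le> b" for x
      using V_top[of x] V_bounds(2)[of x "T - s"] that s t by simp
    fix x t assume xt: "0 < x" "x < b" "0 < t" "t < T - s" and neg: "- 1 * V (x, t) + ?W (x, t) < 0"
    have xD: "(x, t) \<in> D" "(x, t + s) \<in> D" using xt s by (auto simp: mem_D)
    have less: "V (x, t + s) < V (x, t)" using neg by simp
    have VK: "V (x, t) \<le> K" using V_bounds(2)[of x t] xt s by simp
    have "V (x, t) \<noteq> K"
    proof
      assume "V (x, t) = K"
      then have "V (x, t + s) = K" using V_eq_K_propagates_forward[OF xD(1)] xD(2) s by (simp add: mem_D)
      then show False using less VK by simp
    qed
    moreover have "\<gamma> * x < V (x, t)" using V_bounds(1)[of x "t + s"] xt s less by simp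
    ultimately have "supersol \<sigma> r q (\<lambda>z. - 1 * V z) (x, t) (- 1 * c)"
      using supersol_V_continuation[OF xD(1), of "- 1"] VK by simp
    moreover have "supersol \<sigma> r q (\<lambda>z. 1 * V z) (1 * x, t + s) (1 * c)"
      using supersol_V[of "(1 * x, t + s)" 1] xD by simp
    then have "supersol \<sigma> r q ?W (x, t) (1 * c)"
      by (rule supersol_dilate_translate) simp
    ultimately show "supersol \<sigma> r q (\<lambda>z. - 1 * V z + ?W z) (x, t) 0"
      by (intro supersol_mono[OF supersol_add]) auto
  qed (use x t s params in auto)
  then show ?thesis by simp
qed

text \<open>With \<open>y = b - x\<close>, the function \<open>\<gamma> * x + \<gamma> / 2 * y + M * y\<^sup>2\<close> is a subsolution for large \<open>M\<close>; it lies below \<open>K\<close>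
  for small \<open>y\<close>, hence below \<open>V\<close> at the terminal time.\<close>

lemma above_conversion_near_corner:
  "\<exists>y0 \<delta>. y0 > 0 \<and> y0 < b \<and> \<delta> > 0 \<and> \<delta> < T \<and>
    (\<forall>x t. b - y0 < x \<longrightarrow> x < b \<longrightarrow> T - \<delta> < t \<longrightarrow> t < T \<longrightarrow> \<gamma> * x < V (x, t))"
proof -
  define B where "B = K / \<gamma>"
  have B: "B > 0" "\<gamma> * B = K" using b_pos \<gamma>_b by (auto simp: B_def)
  define A where "A = 2 * \<bar>r - q\<bar> * K + r * K + 1"
  have A: "A > 0" unfolding A_def using params by (intro add_nonneg_pos add_nonneg_nonneg mult_nonneg_nonneg) auto
  \<comment> \<open>For \<open>x \<ge> B / 2\<close> the second order term is then at least
    \<open>A\<close>, which exceeds what the drift and the zero order term can subtract.\<close>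
  define M where "M = 4 * A / (\<sigma>\<^sup>2 * B\<^sup>2)"
  have M: "M > 0" unfolding M_def using A B params by simp
  have MA: "\<sigma>\<^sup>2 * (B / 2)\<^sup>2 * M = A" unfolding M_def using B params by (simp add: power2_eq_square field_simps)
  \<comment> \<open>Within distance \<open>y0\<close> of the corner the quadratic term is at most a
    quarter of the linear gain, which leaves \<open>P x \<le> K - \<gamma> / 4 * (B - x)\<close>. At
    \<open>x = B - y0\<close> this is strictly below the terminal value \<open>K\<close>, and
    continuity extends the gap to times near \<open>T\<close>.\<close>
  define y0 where "y0 = min (B / 2) (\<gamma> / (8 * M))"
  have y0: "y0 > 0" "y0 \<le> B / 2" "y0 \<le> \<gamma> / (8 * M)"
  proof -
    show "y0 > 0" using B M params by (simp add: y0_def)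
    show "y0 \<le> B / 2" "y0 \<le> \<gamma> / (8 * M)"
      unfolding y0_def by (rule min.cobounded1, rule min.cobounded2)
  qed
  have My: "M * y \<le> \<gamma> / 8" if "y \<le> y0" for y
  proof -
    have "M * y \<le> M * (\<gamma> / (8 * M))" using that y0 M by (intro mult_left_mono) auto
    then show ?thesis using M by simp
  qed
  define P where "P = (\<lambda>x. \<gamma> * x + \<gamma> / 2 * (B - x) + M * (B - x)\<^sup>2)"
  have P_le: "P x \<le> K - \<gamma> / 4 * (B - x)" if "B - y0 \<le> x" "x \<le> B" for x
  proof -
    have "M * (B - x) * (B - x) \<le> \<gamma> / 8 * (B - x)" using My[of "B - x"] that by (intro mult_right_mono) auto
    moreover have "\<gamma> * (B - x) \<ge> 0" using that params by simp
    moreover have "P x = K - \<gamma> / 2 * (B - x) + M * (B - x) * (B - x)"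
      by (simp add: P_def power2_eq_square B(2)[symmetric] field_simps)
    ultimately show ?thesis by (simp add: field_simps)
  qed
  have P_le_K: "P x \<le> K" if "B - y0 \<le> x" "x \<le> B" for x
  proof -
    have "\<gamma> / 4 * (B - x) \<ge> 0" using that params by (intro mult_nonneg_nonneg) auto
    then show ?thesis using P_le[OF that] by linarith
  qed
  let ?x0 = "B - y0"
  have x0: "0 < ?x0" "?x0 < B" using y0 B by auto
  have V0: "P ?x0 < V (?x0, T)"
  proof -
    have "\<gamma> * y0 > 0" using params y0 by simp
    then show ?thesis using P_le[of ?x0] y0 x0 V_top[of ?x0] by (simp add: B_def[symmetric])
  qed
  have "continuous_on {0<..T} (\<lambda>t. V (?x0, t))"
    by (rule continuous_on_compose2[OF V_cont_quadrant])
      (use x0 in \<open>auto intro!: continuous_intros simp: B_def[symmetric]\<close>)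
  then obtain e where e: "e > 0" "\<And>t. t \<in> {0<..T} \<Longrightarrow> dist t T < e \<Longrightarrow> dist (V (?x0, t)) (V (?x0, T)) < V (?x0, T) - P ?x0"
    using V0 params unfolding continuous_on_iff
    by (metis diff_gt_0_iff_gt greaterThanAtMost_iff order_refl)
  define \<delta> where "\<delta> = min (e / 2) (T / 2)"
  have \<delta>: "\<delta> > 0" "\<delta> < e" "\<delta> < T" using e params by (auto simp: \<delta>_def min_less_iff_disj)
  define \<tau> where "\<tau> = T - \<delta>"
  have \<tau>: "0 < \<tau>" "\<tau> < T" using \<delta> by (auto simp: \<tau>_def)
  have left: "P ?x0 < V (?x0, t)" if "\<tau> \<le> t" "t \<le> T" for t
    using e(2)[of t] that \<tau> \<delta> by (auto simp: dist_real_def \<tau>_def abs_less_iff)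
  have main: "0 \<le> 1 * V (x, t) + (\<epsilon> / (t - \<tau>) - P x)"
    if \<epsilon>: "\<epsilon> > 0" and x: "?x0 \<le> x" "x \<le> B" and t: "\<tau> < t" "t \<le> T" for \<epsilon> x t
  proof -
    \<comment> \<open>At the bottom \<open>\<epsilon> / \<zeta> \<ge> K \<ge> P\<close>, so no
      information on \<open>V\<close> at time \<tau> is used beyond
      \<open>V \<ge> 0\<close>.\<close>
    define \<zeta> where "\<zeta> = min (t - \<tau>) (\<epsilon> / K)"
    have \<zeta>: "\<zeta> > 0" "\<zeta> \<le> t - \<tau>" "\<zeta> \<le> \<epsilon> / K" using t \<epsilon> params by (auto simp: \<zeta>_def)
    let ?W = "\<lambda>z. \<epsilon> / (snd z - \<tau>) - P (fst z)"
    let ?Wx = "\<lambda>z. - (\<gamma> / 2 - 2 * M * (B - fst z))" and ?Wxx = "\<lambda>z::real \<times> real. - (2 * M)"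
      and ?Wt = "\<lambda>z. - (\<epsilon> / (snd z - \<tau>)\<^sup>2)"
    define U where "U = {?x0<..<B} \<times> {\<tau><..<T}"
    have cW: "continuous_on (UNIV \<times> {\<tau><..}) ?W"
      unfolding P_def by (intro continuous_intros) auto
    have clW: "classical_on U ?W ?Wx ?Wxx ?Wt"
      unfolding classical_on_def
    proof (intro conjI ballI)
      show "continuous_on U ?W" by (rule continuous_on_subset[OF cW]) (auto simp: U_def)
      fix z assume "z \<in> U"
      then have z: "\<tau> < snd z" by (auto simp: U_def)
      show "((\<lambda>x. ?W (x, snd z)) has_real_derivative ?Wx z) (at (fst z))"
        unfolding P_def by (auto intro!: derivative_eq_intros simp: algebra_simps)
      show "((\<lambda>x. ?Wx (x, snd z)) has_real_derivative ?Wxx z) (at (fst z))"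
        by (auto intro!: derivative_eq_intros)
      show "((\<lambda>t. ?W (fst z, t)) has_real_derivative ?Wt z) (at (snd z))"
        using z by (auto intro!: derivative_eq_intros simp: power2_eq_square)
    qed
    have opW: "0 \<le> cb_operator \<sigma> r q ?W ?Wx ?Wxx ?Wt z" if "z \<in> U" for z
    proof -
      have z: "?x0 < fst z" "fst z < B" "\<tau> < snd z" using that by (auto simp: U_def)
      have "(B / 2)\<^sup>2 \<le> (fst z)\<^sup>2" using z y0 B by (intro power_mono) auto
      then have 1: "A \<le> \<sigma>\<^sup>2 * (fst z)\<^sup>2 * M"
        unfolding MA[symmetric] using M by (intro mult_right_mono mult_left_mono) auto
      have 2: "- (\<bar>r - q\<bar> * K) \<le> (r - q) * fst z * (\<gamma> / 2 - 2 * M * (B - fst z))"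
      proof -
        have "0 \<le> M * (B - fst z)" "M * (B - fst z) \<le> \<gamma> / 8" using My[of "B - fst z"] z M by auto
        then have "\<bar>\<gamma> / 2 - 2 * M * (B - fst z)\<bar> \<le> \<gamma>" using params by (simp add: abs_le_iff)
        then have "\<bar>r - q\<bar> * \<bar>fst z\<bar> * \<bar>\<gamma> / 2 - 2 * M * (B - fst z)\<bar> \<le> \<bar>r - q\<bar> * B * \<gamma>"
          using z x0 by (intro mult_mono) auto
        then have "\<bar>(r - q) * fst z * (\<gamma> / 2 - 2 * M * (B - fst z))\<bar> \<le> \<bar>r - q\<bar> * K"
          unfolding abs_mult B(2)[symmetric] by (simp add: mult_ac)
        then show ?thesis by linarith
      qed
      have "P (fst z) \<le> K" using P_le_K[of "fst z"] z by simp
      then have 3: "r * P (fst z) \<le> r * K" using params by (intro mult_left_mono) auto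
      have 4: "\<epsilon> / (snd z - \<tau>)\<^sup>2 \<ge> 0" "r * (\<epsilon> / (snd z - \<tau>)) \<ge> 0" using z \<epsilon> params by auto
      have "cb_operator \<sigma> r q ?W ?Wx ?Wxx ?Wt z = \<epsilon> / (snd z - \<tau>)\<^sup>2 + r * (\<epsilon> / (snd z - \<tau>)) + \<sigma>\<^sup>2 * (fst z)\<^sup>2 * M
          + (r - q) * fst z * (\<gamma> / 2 - 2 * M * (B - fst z)) - r * P (fst z)"
        unfolding cb_operator_def by (simp add: algebra_simps)
      moreover have "\<bar>r - q\<bar> * K \<ge> 0" using params by simp
      ultimately show ?thesis using 1 2 3 4 unfolding A_def by linarith
    qed
    define Q where "Q = {?x0..B} \<times> {\<tau> + \<zeta>..T}"
    have QU: "Q \<subseteq> {0<..B} \<times> {0<..T}" using x0 \<tau> \<zeta> by (auto simp: Q_def)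
    have "0 \<le> 1 * V (x, t) + ?W (x, t)"
    proof (rule minimum_principle[where Q=Q and g="\<lambda>z. 1 * V z + ?W z" and z="(x, t)" and r=r and q=q and \<sigma>=\<sigma>])
      show "compact Q" unfolding Q_def by (intro compact_Times compact_Icc)
      show "continuous_on Q (\<lambda>z. 1 * V z + ?W z)"
        by (intro continuous_on_add continuous_on_mult continuous_on_const
            continuous_on_subset[OF V_cont_quadrant] continuous_on_subset[OF cW])
          (use QU \<zeta> in \<open>auto simp: Q_def B_def\<close>)
      show "(x, t) \<in> Q" using x t \<zeta> by (simp add: Q_def)
      fix z assume zQ: "z \<in> Q" and neg: "1 * V z + ?W z < 0"
      obtain y s where z: "z = (y, s)" by (cases z)
      have ys: "?x0 \<le> y" "y \<le> B" "\<tau> + \<zeta> \<le> s" "s \<le> T" using zQ by (auto simp: Q_def z)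
      have sp: "\<tau> < s" using ys \<zeta> by simp
      then have less: "V (y, s) < P y" using neg \<epsilon> by (simp add: z) (smt (verit) divide_pos_pos)
      have PK: "P y \<le> K" using P_le_K[OF ys(1,2)] .
      have V0: "V (y, s) \<ge> 0"
      proof -
        have "\<gamma> * y \<ge> 0" using ys x0 params by (intro mult_nonneg_nonneg) auto
        then show ?thesis
          using V_bounds(1)[of y s] ys sp \<tau> x0 by (simp add: B_def[symmetric])
      qed
      have "y \<noteq> ?x0" using left[of s] less ys sp by auto
      moreover have "y \<noteq> B"
        using V_side[of s] less PK ys sp \<tau> by (auto simp: B_def[symmetric])
      moreover have "s \<noteq> T"
        using V_top[of y] less PK ys x0 by (auto simp: B_def[symmetric])
      moreover have "s \<noteq> \<tau> + \<zeta>"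
      proof
        assume s: "s = \<tau> + \<zeta>"
        have "K \<le> \<epsilon> / \<zeta>" using \<zeta> params by (simp add: field_simps)
        then show False using neg V0 PK by (simp add: z s)
      qed
      ultimately have i: "?x0 < y" "y < B" "\<tau> + \<zeta> < s" "s < T" using ys by auto
      have "interior Q = {?x0<..<B} \<times> {\<tau> + \<zeta><..<T}" by (simp add: Q_def interior_Times)
      then have "z \<in> interior Q" using i by (simp add: z)
      moreover have "supersol \<sigma> r q (\<lambda>z. 1 * V z + ?W z) z 0"
      proof (rule supersol_mono[OF supersol_add])
        have "z \<in> D" using i sp x0 \<tau> by (simp add: z mem_D B_def[symmetric])
        then show "supersol \<sigma> r q (\<lambda>z. 1 * V z) z (1 * c)" by (rule supersol_V) simp
        show "supersol \<sigma> r q ?W z 0"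
          by (rule supersol_classical[OF _ _ clW opW]) (use i sp in \<open>auto simp: U_def z open_Times\<close>)
      qed (use params in auto)
      ultimately show "z \<in> interior Q \<and> supersol \<sigma> r q (\<lambda>z. 1 * V z + ?W z) z 0" by blast
    qed (rule params)
    then show ?thesis by simp
  qed
  show ?thesis
  proof (rule exI[of _ y0], rule exI[of _ \<delta>], intro conjI allI impI)
    show "y0 > 0" "\<delta> > 0" "\<delta> < T" by fact+
    show "y0 < b" using x0 by (simp add: B_def)
    fix x t assume x: "b - y0 < x" "x < b" and t: "T - \<delta> < t" "t < T"
    have "P x \<le> V (x, t)"
    proof (rule field_le_epsilon)
      fix e :: real assume "e > 0"
      then show "P x \<le> V (x, t) + e"
        using main[of "e * (t - \<tau>)" x t] x t by (simp add: \<tau>_def B_def)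
    qed
    moreover have "\<gamma> * x < P x"
    proof -
      have "\<gamma> / 2 * (B - x) > 0" "M * (B - x)\<^sup>2 \<ge> 0" using x params M by (auto simp: B_def[symmetric])
      then show ?thesis by (simp add: P_def)
    qed
    ultimately show "\<gamma> * x < V (x, t)" by simp
  qed
qed

section \<open>Topology of the conversion region and the closure of the free boundary\<close>

abbreviation "\<Lambda> \<equiv> cb_conversion_region K \<gamma> T V"
abbreviation "\<Gamma> \<equiv> cb_free_boundary K \<gamma> T V"

lemma mem_\<Lambda>: "(x, t) \<in> \<Lambda> \<longleftrightarrow> (x, t) \<in> D \<and> V (x, t) = \<gamma> * x"
  by (simp add: cb_conversion_region_def)

text \<open>Monotonicity in time, then dilation by \<open>y / x\<close>: \<open>V (y, s) \<le> V (y,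
  t) \<le> (y / x) * V (x, t) = \<gamma> * y\<close>.\<close>

lemma \<Lambda>_up_closed:
  assumes "(x, t) \<in> \<Lambda>" "x \<le> y" "y < b" "0 < s" "s \<le> t"
  shows "(y, s) \<in> \<Lambda>"
proof -
  have xt: "0 < x" "x < b" "0 < t" "t < T" "V (x, t) = \<gamma> * x" using assms(1) by (auto simp: mem_\<Lambda> mem_D)
  have "V (y, s) \<le> V (y, t)"
    using V_increasing_in_time[of y s "t - s"] assms xt by simp
  also have "\<dots> \<le> \<gamma> * y"
    using V_dilate[of "y / x" x t] assms xt by (simp add: mult.commute)
  finally show ?thesis
    using V_bounds(1)[of y s] assms xt by (auto simp: mem_\<Lambda> mem_D)
qed

lemma free_boundary_subset: "\<Gamma> \<subseteq> \<Lambda>"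
proof
  fix z assume z: "z \<in> \<Gamma>"
  define G where "G = {z \<in> D. \<gamma> * fst z < V z}"
  have "G = D \<inter> (\<lambda>z. V z - \<gamma> * fst z) -` {0<..}" by (auto simp: G_def)
  then have "open G"
    by (auto intro!: continuous_open_preimage open_D continuous_intros V_cont_D)
  then have "z \<notin> G" "z \<in> D"
    using z frontier_disjoint_eq[of G] unfolding cb_free_boundary_def G_def by auto
  then show "z \<in> \<Lambda>"
    using V_bounds(1)[of "fst z" "snd z"] by (cases z) (auto simp: G_def mem_\<Lambda> mem_D)
qed

lemma free_boundary_disjoint_interior:
  assumes "open U" "U \<inter> D \<subseteq> \<Lambda>"
  shows "U \<inter> \<Gamma> = {}"
proof -
  have "U \<inter> D \<inter> {z \<in> D. V z > \<gamma> * fst z} = {}"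
    using assms(2) by (auto simp: cb_conversion_region_def)
  moreover have "open (U \<inter> D)" using assms(1) open_D by blast
  ultimately have "U \<inter> D \<inter> closure {z \<in> D. V z > \<gamma> * fst z} = {}"
    using open_Int_closure_eq_empty by blast
  then show ?thesis by (auto simp: cb_free_boundary_def frontier_def)
qed

text \<open>The two ways to stay away from the free boundary: near \<open>p\<close> there is no
  conversion point, or every point of \<open>D\<close> is one. Every fixed boundary point but one
  falls under one of them.\<close>

lemma not_in_closure_free_boundary:
  assumes "open U" "p \<in> U" "U \<inter> \<Lambda> = {} \<or> U \<inter> D \<subseteq> \<Lambda>"
  shows "p \<notin> closure \<Gamma>"
proof -
  have "U \<inter> \<Gamma> = {}"
    using assms(3) free_boundary_subset free_boundary_disjoint_interior[OF assms(1)] by blast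
  then have "U \<inter> closure \<Gamma> = {}"
    using open_Int_closure_eq_empty[OF assms(1)] by blast
  then show ?thesis using assms(2) by blast
qed

lemma free_boundary_hits_fixed_boundary_once:
  assumes "\<Lambda> \<noteq> {}"
  shows "\<exists>tstar<T. closure \<Gamma> \<inter> cb_fixed_boundary K \<gamma> T = {(b, tstar)}"
proof -
  obtain y0 \<delta> where corner: "y0 > 0" "y0 < b" "\<delta> > 0" "\<delta> < T"
    "\<And>x t. b - y0 < x \<Longrightarrow> x < b \<Longrightarrow> T - \<delta> < t \<Longrightarrow> t < T \<Longrightarrow> \<gamma> * x < V (x, t)"
    using above_conversion_near_corner by blast
  define times where "times = snd ` \<Lambda>"
  have times_le: "t \<le> T - \<delta>" if tm: "t \<in> times" for t
  proof (rule ccontr)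
    assume t: "\<not> t \<le> T - \<delta>"
    obtain x where x: "(x, t) \<in> \<Lambda>" using tm by (auto simp: times_def)
    have xb: "x < b" "0 < t" "t < T" using x by (auto simp: mem_\<Lambda> mem_D)
    then have "max x (b - y0) < b" using corner(1) by simp
    then obtain y where y: "max x (b - y0) < y" "y < b" using dense by blast
    have "(y, t) \<in> \<Lambda>" using xb y by (intro \<Lambda>_up_closed[OF x]) auto
    then show False using corner(5)[of y t] y t xb by (simp add: mem_\<Lambda>)
  qed
  \<comment> \<open>Conversion times form a nonempty set bounded by \<open>T - \<delta>\<close>: by
    up-closedness a conversion point at a later time would bring one into the corner where
    \<open>V > \<gamma> * x\<close>.\<close>
  define ts where "ts = Sup times"
  have ne: "times \<noteq> {}" and bdd: "bdd_above times"
    using assms times_le by (auto simp: times_def bdd_above_def)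
  have ts_upper: "t \<le> ts" if "t \<in> times" for t
    unfolding ts_def using that bdd by (rule cSup_upper)
  have ts_less: "\<exists>t'\<in>times. t < t'" if "t < ts" for t
    using less_cSupD[OF ne] that unfolding ts_def by blast
  have "ts \<le> T - \<delta>" unfolding ts_def using ne times_le by (rule cSup_least)
  then have tsT: "ts < T" using corner(3) by simp
  have ts0: "0 < ts"
  proof -
    obtain t where "t \<in> times" using ne by blast
    moreover from this have "0 < t" by (auto simp: times_def cb_conversion_region_def cb_domain_def)
    ultimately show ?thesis using ts_upper by fastforce
  qed
  have "p = (b, ts)" if p: "p \<in> closure \<Gamma>" "p \<in> cb_fixed_boundary K \<gamma> T" for p
  proof (rule ccontr)
    assume np: "p \<noteq> (b, ts)"
    obtain x t where xt: "p = (x, t)" by (cases p)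
    have "\<exists>U. open U \<and> p \<in> U \<and> (U \<inter> \<Lambda> = {} \<or> U \<inter> D \<subseteq> \<Lambda>)"
    proof -
      \<comment> \<open>The reasons in turn: the bond price bound keeps conversion away from
        \<open>x = 0\<close>; before \<open>ts\<close> up-closedness fills a neighbourhood in
        \<open>D\<close>; after \<open>ts\<close> there is no conversion; the corner is covered by
        \<open>above_conversion_near_corner\<close>; on the open terminal side
        \<open>V = K > \<gamma> * x\<close> and continuity applies.\<close>
      consider "x = 0" | "x = b" "0 \<le> t" "t < ts" | "x = b" "ts < t" "t < T" | "x = b" "t = T" | "0 < x" "x < b" "t = T"
        using p(2) np by (auto simp: xt cb_fixed_boundary_def) (smt (verit))+
      then show ?thesis
      proof cases
        case 1
        let ?U = "{z :: real \<times> real. \<gamma> * fst z < K * exp (- r * T)}"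
        have "open ?U" by (intro open_Collect_less continuous_intros)
        moreover have "p \<in> ?U" using 1 params by (simp add: xt)
        moreover have "?U \<inter> \<Lambda> = {}"
        proof -
          have False if "(y, s) \<in> ?U" "(y, s) \<in> \<Lambda>" for y s
          proof -
            have ys: "0 < y" "y < b" "0 < s" "s < T" "V (y, s) = \<gamma> * y" using that(2) by (auto simp: mem_\<Lambda> mem_D)
            have "K * exp (- r * T) \<le> K * exp (- r * (T - s))"
              using ys params by (intro mult_left_mono) auto
            also have "\<dots> \<le> \<gamma> * y" using V_lower_bound[of y s] ys by simp
            finally show False using that(1) by simp
          qed
          then show ?thesis by auto
        qed
        ultimately show ?thesis by blast
      next
        case 2
        obtain t' x' where t': "(x', t') \<in> \<Lambda>" "t < t'" using ts_less[OF 2(3)] by (auto simp: times_def)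
        let ?U = "{x'<..} \<times> {..<t'}"
        have "?U \<inter> D \<subseteq> \<Lambda>"
        proof
          fix z assume "z \<in> ?U \<inter> D"
          then show "z \<in> \<Lambda>"
            by (cases z) (auto simp: mem_D intro: \<Lambda>_up_closed[OF t'(1)])
        qed
        moreover have "p \<in> ?U" using 2 t' by (auto simp: xt mem_\<Lambda> mem_D)
        ultimately show ?thesis by (intro exI[of _ ?U]) (auto intro: open_Times)
      next
        case 3
        have "(UNIV \<times> {ts<..}) \<inter> \<Lambda> = {}" using ts_upper by (force simp: times_def)
        then show ?thesis using 3 by (intro exI[of _ "UNIV \<times> {ts<..}"]) (auto simp: xt intro: open_Times)
      next
        case 4
        let ?U = "{b - y0<..} \<times> {T - \<delta><..}"
        have "?U \<inter> \<Lambda> = {}"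
          using corner(5) by (auto simp: mem_\<Lambda> mem_D) (metis less_irrefl)
        then show ?thesis using 4 corner by (intro exI[of _ ?U]) (auto simp: xt intro: open_Times)
      next
        case 5
        have "continuous_on ({0<..b} \<times> {0<..T}) (\<lambda>z. V z - \<gamma> * fst z)"
          by (intro continuous_intros V_cont_quadrant)
        then obtain U where U: "open U" "U \<inter> ({0<..b} \<times> {0<..T}) = (\<lambda>z. V z - \<gamma> * fst z) -` {0<..} \<inter> ({0<..b} \<times> {0<..T})"
          unfolding continuous_on_open_invariant using open_greaterThan by blast
        have "\<gamma> * x < \<gamma> * b" using 5 params by (intro mult_strict_left_mono) auto
        then have "p \<in> (\<lambda>z. V z - \<gamma> * fst z) -` {0<..} \<inter> ({0<..b} \<times> {0<..T})"
          using 5 V_top[of x] \<gamma>_b params by (simp add: xt)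
        then have "p \<in> U" using U(2) by blast
        moreover have "U \<inter> \<Lambda> = {}"
        proof -
          have False if "z \<in> U" "z \<in> \<Lambda>" for z
          proof -
            have "z \<in> {0<..b} \<times> {0<..T}" "V z = \<gamma> * fst z"
              using that(2) by (auto simp: cb_conversion_region_def cb_domain_def)
            moreover from this have "z \<in> (\<lambda>z. V z - \<gamma> * fst z) -` {0<..}" using U(2) that(1) by blast
            ultimately show False by simp
          qed
          then show ?thesis by blast
        qed
        ultimately show ?thesis using U(1) by blast
      qed
    qed
    then show False using not_in_closure_free_boundary p(1) by blast
  qed
  moreover have "(b, ts) \<in> closure \<Gamma>"
  proof (subst closure_approachable, intro allI impI)
    fix e :: real assume e: "e > 0"
    define d where "d = min (e / 2) (min ts (T - ts))"
    have d: "d > 0" "d \<le> e / 2" "d \<le> ts" "d \<le> T - ts" 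
    proof -
      show "d > 0" using e ts0 tsT by (simp add: d_def)
      show "d \<le> e / 2" "d \<le> ts" "d \<le> T - ts"
        unfolding d_def using min.cobounded1 min.cobounded2 order_trans by metis+
    qed
    obtain x1 s1 where s1: "(x1, s1) \<in> \<Lambda>" "ts - d < s1" using ts_less[of "ts - d"] d(1) by (auto simp: times_def)
    have x1: "0 < x1" "x1 < b" "0 < s1" "s1 \<le> ts"
    proof -
      have "s1 \<in> times" using s1(1) unfolding times_def by force
      then show "0 < x1" "x1 < b" "0 < s1" "s1 \<le> ts"
        using s1(1) ts_upper by (auto simp: mem_\<Lambda> mem_D)
    qed
    have "max x1 (b - d) < b" using x1 d(1) by simp
    then obtain x where x: "max x1 (b - d) < x" "x < b" using dense by blast
    define s2 where "s2 = ts + d / 2"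
    have s2: "ts < s2" "s2 < T" "s2 < ts + d" using d by (auto simp: s2_def)
    \<comment> \<open>A short segment in time, close to \<open>x = b\<close>, that starts in the
      conversion region just before or at \<open>ts\<close> and ends outside it just after. Being
      connected, it meets the frontier within distance \<open>e\<close> of
      \<open>(b, ts)\<close>.\<close>
    let ?S = "{x} \<times> {s1..s2}" and ?G = "{z \<in> D. V z > \<gamma> * fst z}"
    have SD: "?S \<subseteq> D" using x x1 s2 by (auto simp: mem_D)
    have "(x, s1) \<in> \<Lambda>" using x x1 by (intro \<Lambda>_up_closed[OF s1(1)]) auto
    then have "(x, s1) \<in> ?S - ?G" using x1 s2 by (auto simp: mem_\<Lambda>)
    moreover have "(x, s2) \<in> ?S \<inter> ?G"
    proof -
      have "(x, s2) \<in> D" using SD x1 s2 by auto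
      moreover have "(x, s2) \<notin> \<Lambda>" using ts_upper[of s2] s2 by (force simp: times_def)
      ultimately show ?thesis using V_bounds(1)[of x s2] x1 s2 by (auto simp: mem_\<Lambda> mem_D)
    qed
    moreover have "connected ?S" by (intro connected_Times) auto
    ultimately obtain z where z: "z \<in> ?S" "z \<in> frontier ?G"
      using connected_Int_frontier[of ?S ?G] by blast
    then have "z \<in> \<Gamma>" using SD unfolding cb_free_boundary_def by blast
    moreover have "dist z (b, ts) < e"
    proof -
      have "\<bar>fst z - b\<bar> < d" "\<bar>snd z - ts\<bar> < d" using z(1) x s1(2) s2 by auto
      then show ?thesis using dist_Pair_le[of "fst z" "snd z" b ts] d(2) by simp
    qed
    ultimately show "\<exists>y\<in>\<Gamma>. dist y (b, ts) < e" by blast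
  qed
  moreover have "(b, ts) \<in> cb_fixed_boundary K \<gamma> T"
    using ts0 tsT by (simp add: cb_fixed_boundary_def)
  ultimately have "closure \<Gamma> \<inter> cb_fixed_boundary K \<gamma> T = {(b, ts)}" by blast
  then show ?thesis using tsT by blast
qed

end

theorem proposition1p2:
  fixes K \<gamma> T \<sigma> r q c :: real
    and V Vx Vxx Vt :: "real \<times> real \<Rightarrow> real"
  assumes "K > 0" and "\<gamma> > 0" and "T > 0" and "\<sigma> > 0" and "r > 0" and "q > 0" and "c \<ge> 0"
    and "c < r * K" and "c < q * K"
    and "cb_solution K \<gamma> T \<sigma> r q c V Vx Vxx Vt"
    and "cb_vanishing_at_zero T Vx Vxx"
    and "cb_conversion_region K \<gamma> T V \<noteq> {}"
  shows "\<exists>tstar<T. closure (cb_free_boundary K \<gamma> T V) \<inter> cb_fixed_boundary K \<gamma> T = {(K/\<gamma>, tstar)}"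
proof -
  interpret cb_problem K \<gamma> T \<sigma> r q c V Vx Vxx Vt
    by unfold_locales (use assms in auto)
  show ?thesis using free_boundary_hits_fixed_boundary_once assms(12) by blast
qed

end
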